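(* Let $\Sigma_M$, $\dot q(t)=V_{u}(q(t))$, $u\in U$, be a control dynamical system on a compact connected manifold $M^n$. Suppose that through an arbitrary point $p$ of $M^n$ there goes some closed orbit $p(t)$, $0\le t\le t_p$, of $\Sigma_M$ (i.e. a trajectory with $p(0)=p(t_p)=p$) which is non-trivial (i.e. $t_p>0$) and which contains some point $q(p)$ at which the set of control vectors $V(q(p))$ is ample and the Lie algebra rank condition (LARC) is satisfied. Then the system $\Sigma_M$ is controllable on $M^n$.
   Context: $M^n$ is an $n$-dimensional manifold without boundary. The control system $\Sigma_M$ is given by smooth vector fields $V_u$ on $M^n$ depending on a control parameter $u\in U$ (usually $U$ is a domain in $\mathbb{R}^d$); each $V_u$ generates a one-parameter group of diffeomorphisms $P_u^t$. A trajectory of $\Sigma_M$ is a curve $q(t)$ with $\dot q(t)=V_{u(t)}(q(t))$ for some admissible (usually locally integrable) control function $u(t)\in U$; it is assumed that control functions and trajectories can be approximated by piecewise constant controls and the corresponding trajectories. A closed orbit (closed trajectory) is a trajectory $q(t)$, $0\le t\le t_q$, with $q(0)=q(t_q)$. The system is controllable on $M^n$ if for every two points $p,p'\in M^n$ there is a trajectory of $\Sigma_M$ starting at $p$ and ending at $p'$. LARC at $q$: the Lie algebra generated by some finite number of the control vector fields $V_{u_i}$, evaluated at $q$, is the whole tangent space $T_qM^n$. For a point $q$ put $V(q)=\{V_u(q): u\in U\}\subset T_qM^n$, and let $L(q)$ be the linear subspace of $T_qM^n$ spanned by $V(q)$. It is assumed that $\dim L(q)$ is locally constant and that the spaces $L(q')$,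 for $q'$ in a small neighborhood $B(q)$ of $q$, form a smooth locally trivial vector bundle $L_B=\bigcup_{q'\in B(q)}L(q')$ (a subbundle of $TM|_{B(q)}$). The set of control vectors is open at $q$ if $\bigcup_{q'\in B(q)}V(q')$ is an open subset of $L_B$. $V(q)$ is ample if it is open at $q$ in this sense and the convex hull of $V(q)$ equals $L(q)$. *)

theory Defs
  imports "HOL-Analysis.Analysis"
begin

section \<open>Smooth functions on open subsets of Euclidean spaces\<close>

text \<open>All partial derivatives up to order \<open>k\<close> exist and are continuous. The notion is only
  meant for open sets \<open>S\<close>.\<close>

primrec Ck_on :: "nat \<Rightarrow> 'a::euclidean_space set \<Rightarrow> ('a \<Rightarrow> 'b::euclidean_space) \<Rightarrow> bool" where
  "Ck_on 0 S f \<longleftrightarrow> continuous_on S f"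
| "Ck_on (Suc k) S f \<longleftrightarrow>
     (\<forall>x\<in>S. f differentiable (at x)) \<and> (\<forall>v. Ck_on k S (\<lambda>x. frechet_derivative f (at x) v))"

definition smooth_on :: "'a::euclidean_space set \<Rightarrow> ('a \<Rightarrow> 'b::euclidean_space) \<Rightarrow> bool" where
  "smooth_on S f \<longleftrightarrow> (\<forall>k. Ck_on k S f)"


section \<open>Smooth manifolds\<close>

text \<open>The manifold is the type \<open>'a\<close> with its topology, together with an atlas modelled on the
  Euclidean space \<open>'e\<close>; its dimension is \<open>DIM('e)\<close>. A chart is a pair of a domain and a
  coordinate map. Chart images are open in \<open>'e\<close>, so there is no boundary.\<close>

type_synonym ('a, 'e) chart = "'a set \<times> ('a \<Rightarrow> 'e)"

definition chart_inv :: "('a, 'e) chart \<Rightarrow> 'e \<Rightarrow> 'a" where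
  "chart_inv c = inv_into (fst c) (snd c)"

definition is_chart :: "('a::topological_space, 'e::euclidean_space) chart \<Rightarrow> bool" where
  "is_chart c \<longleftrightarrow> open (fst c) \<and> open (snd c ` fst c) \<and>
     homeomorphism (fst c) (snd c ` fst c) (snd c) (chart_inv c)"

definition smooth_atlas :: "('a::topological_space, 'e::euclidean_space) chart set \<Rightarrow> bool" where
  "smooth_atlas A \<longleftrightarrow>
     (\<forall>c\<in>A. is_chart c) \<and> (\<Union>c\<in>A. fst c) = UNIV \<and>
     (\<forall>c\<in>A. \<forall>d\<in>A. smooth_on (snd c ` (fst c \<inter> fst d)) (snd d \<circ> chart_inv c))"

text \<open>Each point gets a preferred chart, and a tangent vector at \<open>q\<close> is represented by its
  coordinates in the preferred chart at \<open>q\<close>. Thus every tangent space is a copy of \<open>'e\<close>, and the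
  linear notions of the library (\<^const>\<open>span\<close>, \<^const>\<open>dim\<close>, \<^const>\<open>hull\<close>) apply to it.
  A vector field is a function of type \<open>'a \<Rightarrow> 'e\<close>. Since the preferred chart jumps from point to
  point, regularity of vector fields is always expressed through \<open>coords A c q v\<close>, the coordinates
  in the fixed chart \<open>c\<close> of the tangent vector \<open>v\<close> at \<open>q\<close>.\<close>

definition chart_at :: "('a, 'e) chart set \<Rightarrow> 'a \<Rightarrow> ('a, 'e) chart" where
  "chart_at A q = (SOME c. c \<in> A \<and> q \<in> fst c)"

definition coords :: "('a, 'e::euclidean_space) chart set \<Rightarrow> ('a, 'e) chart \<Rightarrow> 'a \<Rightarrow> 'e \<Rightarrow> 'e" where
  "coords A c q v =
     frechet_derivative (snd c \<circ> chart_inv (chart_at A q)) (at (snd (chart_at A q) q)) v"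

definition local_rep :: "('a, 'e::euclidean_space) chart set \<Rightarrow> ('a, 'e) chart \<Rightarrow> ('a \<Rightarrow> 'e) \<Rightarrow> 'e \<Rightarrow> 'e" where
  "local_rep A c X x = coords A c (chart_inv c x) (X (chart_inv c x))"

definition smooth_vector_field_on ::
    "('a, 'e::euclidean_space) chart set \<Rightarrow> 'a set \<Rightarrow> ('a \<Rightarrow> 'e) \<Rightarrow> bool" where
  "smooth_vector_field_on A W X \<longleftrightarrow>
     (\<forall>c\<in>A. smooth_on (snd c ` (fst c \<inter> W)) (local_rep A c X))"

text \<open>The topology of the tangent bundle \<open>TM = 'a \<times> 'e\<close>: the preimages of open sets under the
  bundle charts induced by the charts of the atlas form a basis.\<close>

definition tangent_topology ::
    "('a::topological_space, 'e::euclidean_space) chart set \<Rightarrow> ('a \<times> 'e) topology" where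
  "tangent_topology A = topology_generated_by
     {{(q, v). q \<in> fst c \<and> (snd c q, coords A c q v) \<in> O'} | c O'. c \<in> A \<and> open O'}"

text \<open>The bracket \<open>[X, Y] = DY X - DX Y\<close>, computed at each point in the preferred chart.\<close>

definition lie_bracket ::
    "('a, 'e::euclidean_space) chart set \<Rightarrow> ('a \<Rightarrow> 'e) \<Rightarrow> ('a \<Rightarrow> 'e) \<Rightarrow> 'a \<Rightarrow> 'e" where
  "lie_bracket A X Y q =
     (let c = chart_at A q; x = snd c q
      in frechet_derivative (local_rep A c Y) (at x) (local_rep A c X x)
       - frechet_derivative (local_rep A c X) (at x) (local_rep A c Y x))"

inductive_set lie_algebra_gen ::
    "('a, 'e::euclidean_space) chart set \<Rightarrow> ('a \<Rightarrow> 'e) set \<Rightarrow> ('a \<Rightarrow> 'e) set"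
  for A :: "('a, 'e) chart set" and F :: "('a \<Rightarrow> 'e) set" where
  gen: "X \<in> F \<Longrightarrow> X \<in> lie_algebra_gen A F"
| zero: "(\<lambda>q. 0) \<in> lie_algebra_gen A F"
| add: "X \<in> lie_algebra_gen A F \<Longrightarrow> Y \<in> lie_algebra_gen A F \<Longrightarrow>
    (\<lambda>q. X q + Y q) \<in> lie_algebra_gen A F"
| scale: "X \<in> lie_algebra_gen A F \<Longrightarrow> (\<lambda>q. r *\<^sub>R X q) \<in> lie_algebra_gen A F"
| bracket: "X \<in> lie_algebra_gen A F \<Longrightarrow> Y \<in> lie_algebra_gen A F \<Longrightarrow>
    lie_bracket A X Y \<in> lie_algebra_gen A F"

text \<open>\<open>X\<close> generates a one-parameter group of diffeomorphisms, i.e. a smooth action \<open>P\<close> of the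
  additive reals whose orbits are the integral curves of \<open>X\<close>. (The inverse of \<open>P t\<close> is
  \<open>P (- t)\<close>.)\<close>

definition generates_flow ::
    "('a::topological_space, 'e::euclidean_space) chart set \<Rightarrow> ('a \<Rightarrow> 'e) \<Rightarrow> bool" where
  "generates_flow A X \<longleftrightarrow> (\<exists>P :: real \<Rightarrow> 'a \<Rightarrow> 'a.
     P 0 = id \<and> (\<forall>s t. P (s + t) = P s \<circ> P t) \<and>
     continuous_on UNIV (\<lambda>(t, q). P t q) \<and>
     (\<forall>c\<in>A. \<forall>d\<in>A. smooth_on {(t, x). x \<in> snd c ` fst c \<and> P t (chart_inv c x) \<in> fst d}
        (\<lambda>(t, x). snd d (P t (chart_inv c x)))) \<and>
     (\<forall>q t. \<forall>c\<in>A. P t q \<in> fst c \<longrightarrow>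
        ((\<lambda>s. snd c (P s q)) has_vector_derivative coords A c (P t q) (X (P t q))) (at t)))"


section \<open>Control systems\<close>

text \<open>A trajectory with control \<open>u\<close> on \<open>[0, T]\<close> is a Caratheodory solution of
  \<open>q'(t) = V (u t) (q t)\<close>: a continuous curve that satisfies the equation in integrated form
  (with a Lebesgue integral) over every time interval on which the curve stays in one chart. As
  controls are merely integrable in time, the differential equation cannot be required at every
  \<open>t\<close>.\<close>

definition solves ::
    "('a::topological_space, 'e::euclidean_space) chart set \<Rightarrow> ('u \<Rightarrow> 'a \<Rightarrow> 'e) \<Rightarrow>
     (real \<Rightarrow> 'u) \<Rightarrow> real \<Rightarrow> (real \<Rightarrow> 'a) \<Rightarrow> bool" where
  "solves A V u T q \<longleftrightarrow> 0 \<le> T \<and> continuous_on {0..T} q \<and>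
     (\<forall>c\<in>A. \<forall>a b. 0 \<le> a \<and> a \<le> b \<and> b \<le> T \<and> q ` {a..b} \<subseteq> fst c \<longrightarrow>
        (\<lambda>s. coords A c (q s) (V (u s) (q s))) absolutely_integrable_on {a..b} \<and>
        integral {a..b} (\<lambda>s. coords A c (q s) (V (u s) (q s))) = snd c (q b) - snd c (q a))"

definition trajectory ::
    "('a::topological_space, 'e::euclidean_space) chart set \<Rightarrow> ('u \<Rightarrow> 'a \<Rightarrow> 'e) \<Rightarrow>
     (real \<Rightarrow> 'u) set \<Rightarrow> real \<Rightarrow> (real \<Rightarrow> 'a) \<Rightarrow> bool" where
  "trajectory A V Adm T q \<longleftrightarrow> (\<exists>u\<in>Adm. solves A V u T q)"

definition closed_orbit ::
    "('a::topological_space, 'e::euclidean_space) chart set \<Rightarrow> ('u \<Rightarrow> 'a \<Rightarrow> 'e) \<Rightarrow>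
     (real \<Rightarrow> 'u) set \<Rightarrow> real \<Rightarrow> (real \<Rightarrow> 'a) \<Rightarrow> bool" where
  "closed_orbit A V Adm T q \<longleftrightarrow> trajectory A V Adm T q \<and> q 0 = q T"

definition controllable ::
    "('a::topological_space, 'e::euclidean_space) chart set \<Rightarrow> ('u \<Rightarrow> 'a \<Rightarrow> 'e) \<Rightarrow>
     (real \<Rightarrow> 'u) set \<Rightarrow> bool" where
  "controllable A V Adm \<longleftrightarrow> (\<forall>p p'. \<exists>T q. trajectory A V Adm T q \<and> q 0 = p \<and> q T = p')"

text \<open>Finitely many switches in each bounded time interval; the values at the switching times
  are arbitrary.\<close>

definition piecewise_constant :: "(real \<Rightarrow> 'u) \<Rightarrow> bool" where
  "piecewise_constant u \<longleftrightarrow> (\<forall>a b. \<exists>S. finite S \<and>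
     (\<forall>s t. a \<le> s \<and> s \<le> t \<and> t \<le> b \<and> {s..t} \<inter> S = {} \<longrightarrow> u s = u t))"

text \<open>Approximation by piecewise constant controls: every trajectory \<open>q\<close> on \<open>[0, T]\<close> is a uniform
  limit of trajectories of piecewise constant controls passing through the same point at a
  prescribed time \<open>t0\<close>. Uniform closeness is expressed without a metric, by requiring the
  graph to lie in a given neighbourhood \<open>W\<close> of the graph of \<open>q\<close>.\<close>

definition approximable_by_piecewise_constant ::
    "('a::topological_space, 'e::euclidean_space) chart set \<Rightarrow> 'u set \<Rightarrow> ('u \<Rightarrow> 'a \<Rightarrow> 'e) \<Rightarrow>
     (real \<Rightarrow> 'u) set \<Rightarrow> bool" where
  "approximable_by_piecewise_constant A U V Adm \<longleftrightarrow>
     (\<forall>T q. trajectory A V Adm T q \<longrightarrow>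
        (\<forall>t0\<in>{0..T}. \<forall>W. open W \<and> (\<forall>t\<in>{0..T}. (t, q t) \<in> W) \<longrightarrow>
           (\<exists>u' q'. piecewise_constant u' \<and> range u' \<subseteq> U \<and> solves A V u' T q' \<and>
              q' t0 = q t0 \<and> (\<forall>t\<in>{0..T}. (t, q' t) \<in> W))))"

text \<open>\<open>Adm\<close> is the class of admissible control functions (for example the locally integrable
  ones). They are total functions of time; a trajectory on \<open>[0, T]\<close> only uses the
  restriction to \<open>[0, T]\<close>.\<close>

definition control_system ::
    "('a::topological_space, 'e::euclidean_space) chart set \<Rightarrow> 'u set \<Rightarrow> ('u \<Rightarrow> 'a \<Rightarrow> 'e) \<Rightarrow>
     (real \<Rightarrow> 'u) set \<Rightarrow> bool" where
  "control_system A U V Adm \<longleftrightarrow>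
     (\<forall>u\<in>U. smooth_vector_field_on A UNIV (V u) \<and> generates_flow A (V u)) \<and>
     (\<forall>u\<in>Adm. range u \<subseteq> U) \<and>
     {u. piecewise_constant u \<and> range u \<subseteq> U} \<subseteq> Adm \<and>
     approximable_by_piecewise_constant A U V Adm"

definition LARC ::
    "('a, 'e::euclidean_space) chart set \<Rightarrow> 'u set \<Rightarrow> ('u \<Rightarrow> 'a \<Rightarrow> 'e) \<Rightarrow> 'a \<Rightarrow> bool" where
  "LARC A U V q \<longleftrightarrow>
     (\<exists>F. finite F \<and> F \<subseteq> U \<and> (\<lambda>X. X q) ` lie_algebra_gen A (V ` F) = UNIV)"

definition control_vectors :: "'u set \<Rightarrow> ('u \<Rightarrow> 'a \<Rightarrow> 'e) \<Rightarrow> 'a \<Rightarrow> 'e set" where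
  "control_vectors U V q = (\<lambda>u. V u q) ` U"

definition control_span :: "'u set \<Rightarrow> ('u \<Rightarrow> 'a \<Rightarrow> 'e::euclidean_space) \<Rightarrow> 'a \<Rightarrow> 'e set" where
  "control_span U V q = span (control_vectors U V q)"

text \<open>The subspaces \<open>L x\<close>, \<open>x \<in> B\<close>, form a smooth locally trivial subbundle of \<open>TM\<close> over \<open>B\<close>: around
  each point there is a smooth local frame. In particular \<open>dim (L x)\<close> is locally constant.\<close>

definition smooth_subbundle_on ::
    "('a::topological_space, 'e::euclidean_space) chart set \<Rightarrow> 'a set \<Rightarrow> ('a \<Rightarrow> 'e set) \<Rightarrow> bool" where
  "smooth_subbundle_on A B L \<longleftrightarrow>
     (\<forall>x\<in>B. \<exists>W (k::nat) E. open W \<and> x \<in> W \<and> W \<subseteq> B \<and>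
        (\<forall>i<k. smooth_vector_field_on A W (E i)) \<and>
        (\<forall>y\<in>W. inj_on (\<lambda>i. E i y) {..<k} \<and> independent ((\<lambda>i. E i y) ` {..<k}) \<and>
           span ((\<lambda>i. E i y) ` {..<k}) = L y))"

definition control_vectors_open_at ::
    "('a::topological_space, 'e::euclidean_space) chart set \<Rightarrow> 'u set \<Rightarrow> ('u \<Rightarrow> 'a \<Rightarrow> 'e) \<Rightarrow> 'a \<Rightarrow> bool" where
  "control_vectors_open_at A U V q \<longleftrightarrow>
     (\<exists>B. open B \<and> q \<in> B \<and> smooth_subbundle_on A B (control_span U V) \<and>
        openin (subtopology (tangent_topology A) (Sigma B (control_span U V)))
          (Sigma B (control_vectors U V)))"

definition ample_at ::
    "('a::topological_space, 'e::euclidean_space) chart set \<Rightarrow> 'u set \<Rightarrow> ('u \<Rightarrow> 'a \<Rightarrow> 'e) \<Rightarrow> 'a \<Rightarrow> bool" where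
  "ample_at A U V q \<longleftrightarrow> control_vectors_open_at A U V q \<and>
     convex hull (control_vectors U V q) = control_span U V q"

end

theory Submission
  imports Defs
begin

text \<open>
  Call two points equivalent if each can be reached from the other with piecewise constant
  controls. Since $M$ is connected, it is enough that every point has a neighbourhood whose points
  are mutually reachable. This splits into a local statement at a point \<open>q\<close> where the system is
  ample and satisfies the rank condition, and a transport of this local statement along the closed
  orbit.

  Local statement (\<open>control_family.locally_controllable\<close>). Ampleness enters through the
  following consequence: the fields \<open>- X u\<close> of finitely many controls are, near \<open>q\<close>, combinations of
  control fields with nonnegative continuous coefficients (\<open>reversing_coefficients\<close>). Following
  the flows of these fields for short times proportional to the coefficients approximates motion
  along \<open>- X u\<close>, so that the backward flow of \<open>X u\<close> is a uniform limit of \<^emph>\<open>continuous\<close> maps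
  which send each point to a reachable point (\<open>approx_realizable_backward\<close>). On the other hand, by
  an argument of Krener, some concatenation of forward flows, with switching times depending on a
  parameter \<open>v\<close> in the model space, has an endpoint with invertible derivative in \<open>v\<close>: if the
  rank cannot be increased by another flow, then the ranges of the derivatives along all
  prolongations contain the control fields and are moved by their flows, hence contain all
  brackets of control fields, and the rank condition makes them the whole space
  (\<open>lie_closure_in_tangent_family\<close>). Undoing the concatenation by an approximate backward
  flow gives a continuous family of reachable points close to \<open>q + v\<close>. By Brouwer's theorem this
  family covers a ball about \<open>q\<close>; all estimates persist when the starting point is moved from
  \<open>q\<close> to a nearby point, so all points of a small ball reach each other.

  Transport. The closed orbit through \<open>p\<close> passes through such a point \<open>q\<close>. Approximating it
  once with the initial point fixed and once with the final point fixed gives a way from \<open>p\<close>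
  into the neighbourhood of \<open>q\<close> and a way from this neighbourhood back to \<open>p\<close>. Trajectories of
  piecewise constant controls are compositions of flows, which are homeomorphisms, so both ways
  exist for all points near \<open>p\<close> (\<open>mutually_reachable_nhd\<close>).
\<close>

section \<open>Calculus of smooth functions\<close>

lemma Ck_on_cong:
  assumes "open S" "\<And>x. x \<in> S \<Longrightarrow> f x = g x"
  shows "Ck_on k S f \<longleftrightarrow> Ck_on k S g"
  using assms(2)
proof (induction k arbitrary: f g)
  case 0
  then show ?case by (simp cong: continuous_on_cong)
next
  case (Suc k)
  have hd: "(f has_derivative D) (at x) \<longleftrightarrow> (g has_derivative D) (at x)" if "x \<in> S" for x D
    using has_derivative_transform_within_open[OF _ assms(1) that] Suc.prems by metis
  have d: "f differentiable (at x) \<longleftrightarrow> g differentiable (at x)" if "x \<in> S" for x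
    using hd[OF that] by (simp add: differentiable_def)
  have fd: "frechet_derivative f (at x) = frechet_derivative g (at x)" if "x \<in> S" for x
    unfolding frechet_derivative_def using hd[OF that] by simp
  have "Ck_on k S (\<lambda>x. frechet_derivative f (at x) v) \<longleftrightarrow>
        Ck_on k S (\<lambda>x. frechet_derivative g (at x) v)" for v
    by (rule Suc.IH) (simp add: fd)
  then show ?case by (simp add: d)
qed

lemma Ck_on_subset: "Ck_on k S f \<Longrightarrow> T \<subseteq> S \<Longrightarrow> Ck_on k T f"
  by (induction k arbitrary: f) (auto intro: continuous_on_subset)

lemma Ck_on_Suc_lower: "Ck_on (Suc k) S f \<Longrightarrow> Ck_on k S f"
proof (induction k arbitrary: f)
  case 0
  then have "\<forall>x\<in>S. isCont f x"
    using differentiable_imp_continuous_within by auto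
  then show ?case
    using continuous_at_imp_continuous_on by auto
next
  case (Suc k)
  then show ?case by (metis Ck_on.simps(2))
qed

lemma Ck_on_const: "Ck_on k S (\<lambda>x. c)"
  by (induction k arbitrary: c) auto

lemma Ck_on_add:
  assumes "open S"
  shows "Ck_on k S f \<Longrightarrow> Ck_on k S g \<Longrightarrow> Ck_on k S (\<lambda>x. f x + g x)"
proof (induction k arbitrary: f g)
  case 0
  then show ?case by (auto intro: continuous_intros)
next
  case (Suc k)
  have "frechet_derivative (\<lambda>x. f x + g x) (at x) =
      (\<lambda>v. frechet_derivative f (at x) v + frechet_derivative g (at x) v)" if "x \<in> S" for x
    using Suc.prems that
    by (intro frechet_derivative_at[symmetric] has_derivative_add)
      (auto simp: frechet_derivative_works[symmetric])
  then have "Ck_on k S (\<lambda>x. frechet_derivative (\<lambda>x. f x + g x) (at x) v)" for v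
    using Suc.IH[of "\<lambda>x. frechet_derivative f (at x) v" "\<lambda>x. frechet_derivative g (at x) v"] Suc.prems
    by (subst Ck_on_cong[OF assms]) auto
  then show ?case using Suc.prems by auto
qed

lemma Ck_on_sum:
  assumes "open S" "\<And>i. i \<in> I \<Longrightarrow> Ck_on k S (f i)"
  shows "Ck_on k S (\<lambda>x. \<Sum>i\<in>I. f i x)"
  using assms(2)
  by (induction I rule: infinite_finite_induct) (auto intro: Ck_on_const Ck_on_add[OF assms(1)])

lemma Ck_on_scaleR:
  assumes "open S"
  shows "Ck_on k S f \<Longrightarrow> Ck_on k S g \<Longrightarrow> Ck_on k S (\<lambda>x. (f x :: real) *\<^sub>R g x)"
proof (induction k arbitrary: f g)
  case 0
  then show ?case by (auto intro: continuous_intros)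
next
  case (Suc k)
  have "frechet_derivative (\<lambda>x. f x *\<^sub>R g x) (at x) =
      (\<lambda>v. f x *\<^sub>R frechet_derivative g (at x) v + frechet_derivative f (at x) v *\<^sub>R g x)"
    if "x \<in> S" for x
    using Suc.prems that
    by (intro frechet_derivative_at[symmetric] has_derivative_scaleR)
      (auto simp: frechet_derivative_works[symmetric])
  moreover have "Ck_on k S f" "Ck_on k S g" using Suc.prems Ck_on_Suc_lower by blast+
  moreover have "Ck_on k S (\<lambda>x. f x *\<^sub>R frechet_derivative g (at x) v
      + frechet_derivative f (at x) v *\<^sub>R g x)" for v
    using Suc.prems calculation(2,3) by (auto intro!: Ck_on_add[OF assms] Suc.IH)
  ultimately have "Ck_on k S (\<lambda>x. frechet_derivative (\<lambda>x. f x *\<^sub>R g x) (at x) v)" for v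
    using Ck_on_cong[OF assms, of "\<lambda>x. frechet_derivative (\<lambda>x. f x *\<^sub>R g x) (at x) v"] by simp
  then show ?case using Suc.prems by auto
qed

lemma Ck_on_inner_const:
  assumes "open S"
  shows "Ck_on k S f \<Longrightarrow> Ck_on k S (\<lambda>x. f x \<bullet> b)"
proof (induction k arbitrary: f)
  case 0
  then show ?case by (auto intro: continuous_intros)
next
  case (Suc k)
  have "frechet_derivative (\<lambda>x. f x \<bullet> b) (at x) = (\<lambda>v. frechet_derivative f (at x) v \<bullet> b)"
    if "x \<in> S" for x
    using Suc.prems that
    by (intro frechet_derivative_at[symmetric] has_derivative_inner_left)
      (auto simp: frechet_derivative_works[symmetric])
  then have "Ck_on k S (\<lambda>x. frechet_derivative (\<lambda>x. f x \<bullet> b) (at x) v)" for v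
    using Suc.prems by (subst Ck_on_cong[OF assms]) (auto intro!: Suc.IH)
  then show ?case using Suc.prems by auto
qed

lemma smooth_on_cong:
  assumes "open S" "\<And>x. x \<in> S \<Longrightarrow> f x = g x"
  shows "smooth_on S f \<longleftrightarrow> smooth_on S g"
  using Ck_on_cong[OF assms] by (simp add: smooth_on_def)

lemma smooth_on_subset: "smooth_on S f \<Longrightarrow> T \<subseteq> S \<Longrightarrow> smooth_on T f"
  unfolding smooth_on_def by (meson Ck_on_subset)

lemma smooth_on_const: "smooth_on S (\<lambda>x. c)"
  by (simp add: smooth_on_def Ck_on_const)

lemma smooth_on_add: "open S \<Longrightarrow> smooth_on S f \<Longrightarrow> smooth_on S g \<Longrightarrow> smooth_on S (\<lambda>x. f x + g x)"
  by (simp add: smooth_on_def Ck_on_add)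

lemma smooth_on_scaleR_const: "open S \<Longrightarrow> smooth_on S f \<Longrightarrow> smooth_on S (\<lambda>x. c *\<^sub>R f x)"
  by (simp add: smooth_on_def Ck_on_scaleR Ck_on_const)

lemma smooth_on_diff: "open S \<Longrightarrow> smooth_on S f \<Longrightarrow> smooth_on S g \<Longrightarrow> smooth_on S (\<lambda>x. f x - g x)"
  using smooth_on_add[of S f "\<lambda>x. (-1) *\<^sub>R g x"] smooth_on_scaleR_const[of S g "-1"] by simp

lemma smooth_on_continuous_on: "smooth_on S f \<Longrightarrow> continuous_on S f"
  by (metis smooth_on_def Ck_on.simps(1))

lemma smooth_on_has_derivative:
  "smooth_on S f \<Longrightarrow> x \<in> S \<Longrightarrow> (f has_derivative frechet_derivative f (at x)) (at x)"
  unfolding smooth_on_def by (metis Ck_on.simps(2) frechet_derivative_works)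

lemma smooth_on_frechet_derivative:
  "smooth_on S f \<Longrightarrow> smooth_on S (\<lambda>x. frechet_derivative f (at x) v)"
  unfolding smooth_on_def by (metis Ck_on.simps(2))

lemma frechet_derivative_expand:
  fixes f :: "'a::euclidean_space \<Rightarrow> 'b::euclidean_space"
  assumes "smooth_on S f" "x \<in> S"
  shows "frechet_derivative f (at x) v = (\<Sum>b\<in>Basis. (v \<bullet> b) *\<^sub>R frechet_derivative f (at x) b)"
proof -
  have "linear (frechet_derivative f (at x))"
    using smooth_on_has_derivative[OF assms] has_derivative_linear by blast
  then show ?thesis
    by (subst euclidean_representation[of v, symmetric]) (simp add: linear_sum linear_scale)
qed

lemma smooth_on_frechet_derivative_along:
  fixes f :: "'a::euclidean_space \<Rightarrow> 'b::euclidean_space"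
  assumes "open S" "smooth_on S f" "smooth_on S g"
  shows "smooth_on S (\<lambda>x. frechet_derivative f (at x) (g x))"
proof -
  have "smooth_on S (\<lambda>x. \<Sum>b\<in>Basis. (g x \<bullet> b) *\<^sub>R frechet_derivative f (at x) b)"
    using assms(2,3) smooth_on_frechet_derivative[OF assms(2)]
    unfolding smooth_on_def
    by (auto intro!: Ck_on_sum Ck_on_scaleR Ck_on_inner_const assms(1))
  then show ?thesis
    by (rule iffD2[OF smooth_on_cong[OF assms(1)], rotated])
      (rule frechet_derivative_expand[OF assms(2)])
qed

text \<open>The second difference of \<open>f\<close> over the parallelogram spanned by \<open>t *\<^sub>R u\<close> and \<open>t *\<^sub>R v\<close> is
  symmetric in \<open>u\<close> and \<open>v\<close>. Seen as the increment over \<open>{0..t}\<close> of the difference of \<open>f\<close> along two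
  parallel sides in the direction \<open>u\<close>, it is \<open>(t * t) *\<^sub>R A v\<close> up to \<open>o(t * t)\<close>, so the symmetry
  passes to the second derivative.\<close>

lemma second_difference_approx:
  fixes f :: "'a::real_normed_vector \<Rightarrow> 'b::real_normed_vector"
  assumes "open S" "x \<in> S" "\<And>y. y \<in> S \<Longrightarrow> f differentiable (at y)"
    and A: "((\<lambda>y. frechet_derivative f (at y) u) has_derivative A) (at x)"
    and "e > 0"
  shows "\<exists>d>0. \<forall>t. 0 < t \<and> t < d \<longrightarrow>
    norm (f (x + t *\<^sub>R u + t *\<^sub>R v) - f (x + t *\<^sub>R u) - f (x + t *\<^sub>R v) + f x - (t * t) *\<^sub>R A v)
      \<le> e * (t * t)"
proof -
  define g where "g y = frechet_derivative f (at y) u" for y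
  define m where "m = 2 * (norm u + norm v) + 1"
  have m: "m > 0" by (auto simp: m_def intro: add_nonneg_pos)
  obtain r where r: "r > 0" "ball x r \<subseteq> S" using assms open_contains_ball by blast
  have "\<exists>d>0. \<forall>y. norm (y - x) < d \<longrightarrow> norm (g y - g x - A (y - x)) \<le> e/m * norm (y - x)"
    using A[unfolded has_derivative_at_alt] \<open>e > 0\<close> m unfolding g_def
    by (metis divide_pos_pos)
  then obtain d where d: "d > 0"
    and dg: "\<And>y. norm (y - x) < d \<Longrightarrow> norm (g y - g x - A (y - x)) \<le> e/m * norm (y - x)" by blast
  have linA: "linear A" using A has_derivative_linear by blast
  show ?thesis
  proof (intro exI conjI allI impI)
    show "min d r / m > 0" using d r m by simp
    fix t :: real assume t: "0 < t \<and> t < min d r / m"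
    then have tm: "t * m < d" "t * m < r" using m by (auto simp: field_simps)
    have nb: "norm (s *\<^sub>R u + w *\<^sub>R v) \<le> t * (norm u + norm v)"
      if "0 \<le> s" "s \<le> t" "0 \<le> w" "w \<le> t" for s w
    proof -
      have "norm (s *\<^sub>R u + w *\<^sub>R v) \<le> s * norm u + w * norm v"
        using that norm_triangle_ineq[of "s *\<^sub>R u" "w *\<^sub>R v"] by simp
      also have "\<dots> \<le> t * norm u + t * norm v"
        using that by (intro add_mono mult_right_mono) auto
      finally show ?thesis by (simp add: algebra_simps)
    qed
    have tm': "t * (norm u + norm v) < t * m"
    proof -
      have "norm u + norm v < m"
        using add_nonneg_nonneg[OF norm_ge_zero[of u] norm_ge_zero[of v]] by (simp add: m_def add_nonneg_pos)
      then show ?thesis using t by simp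
    qed
    define h where "h s = f (x + s *\<^sub>R u + t *\<^sub>R v) - f (x + s *\<^sub>R u) - (s * t) *\<^sub>R A v" for s
    have der: "(h has_derivative (\<lambda>k. k *\<^sub>R (g (x + s *\<^sub>R u + t *\<^sub>R v) - g (x + s *\<^sub>R u) - t *\<^sub>R A v)))
        (at s within {0..t})" if s: "s \<in> {0..t}" for s
    proof -
      have in1: "x + s *\<^sub>R u + t *\<^sub>R v \<in> S"
      proof (rule subsetD[OF r(2)])
        have "dist x (x + s *\<^sub>R u + t *\<^sub>R v) = norm (s *\<^sub>R u + t *\<^sub>R v)"
          by (metis add.assoc dist_0_norm dist_add_cancel add.right_neutral)
        also have "\<dots> \<le> t * (norm u + norm v)" using nb[of s t] s t by simp
        also note tm'
        also note tm(2)
        finally show "x + s *\<^sub>R u + t *\<^sub>R v \<in> ball x r" by simp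
      qed
      have in2: "x + s *\<^sub>R u \<in> S"
      proof (rule subsetD[OF r(2)])
        have "dist x (x + s *\<^sub>R u) = norm (s *\<^sub>R u + 0 *\<^sub>R v)"
          by (simp add: dist_norm)
        also have "\<dots> \<le> t * (norm u + norm v)" using nb[of s 0] s t by simp
        also note tm'
        also note tm(2)
        finally show "x + s *\<^sub>R u \<in> ball x r" by simp
      qed
      have fd: "(f has_derivative frechet_derivative f (at y)) (at y)" if "y \<in> S" for y
        using assms(3)[OF that] frechet_derivative_works by blast
      have l: "frechet_derivative f (at y) (k *\<^sub>R u) = k *\<^sub>R g y" if "y \<in> S" for y k
        using has_derivative_linear[OF fd[OF that]] by (simp add: linear_scale g_def)
      have p1: "((\<lambda>s. x + s *\<^sub>R u + t *\<^sub>R v) has_derivative (\<lambda>k. k *\<^sub>R u)) (at s within {0..t})"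
        by (auto intro!: derivative_eq_intros)
      have p2: "((\<lambda>s. x + s *\<^sub>R u) has_derivative (\<lambda>k. k *\<^sub>R u)) (at s within {0..t})"
        by (auto intro!: derivative_eq_intros)
      have d1: "((\<lambda>s. f (x + s *\<^sub>R u + t *\<^sub>R v)) has_derivative (\<lambda>k. k *\<^sub>R g (x + s *\<^sub>R u + t *\<^sub>R v))) (at s within {0..t})"
        using has_derivative_compose[OF p1 fd[OF in1]] l[OF in1] by simp
      have d2: "((\<lambda>s. f (x + s *\<^sub>R u)) has_derivative (\<lambda>k. k *\<^sub>R g (x + s *\<^sub>R u))) (at s within {0..t})"
        using has_derivative_compose[OF p2 fd[OF in2]] l[OF in2] by simp
      show ?thesis unfolding h_def
        by (rule derivative_eq_intros d1 d2 refl)+ (auto simp: algebra_simps)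
    qed
    have bd: "onorm (\<lambda>k. k *\<^sub>R (g (x + s *\<^sub>R u + t *\<^sub>R v) - g (x + s *\<^sub>R u) - t *\<^sub>R A v)) \<le> e * t"
      if s: "s \<in> {0..t}" for s
    proof (rule onorm_bound)
      show "0 \<le> e * t" using \<open>e>0\<close> t by auto
      fix k :: real
      let ?y1 = "x + s *\<^sub>R u + t *\<^sub>R v" and ?y2 = "x + s *\<^sub>R u"
      have n1: "norm (?y1 - x) \<le> t * (norm u + norm v)"
        using nb[of s t] s t by (simp add: add.assoc)
      have n2: "norm (?y2 - x) \<le> t * (norm u + norm v)" using nb[of s 0] s t by simp
      have e: "A (?y1 - x) = A (?y2 - x) + t *\<^sub>R A v"
        using linA by (simp add: linear_add linear_scale add.assoc)
      then have "g ?y1 - g ?y2 - t *\<^sub>R A v = (g ?y1 - g x - A (?y1 - x)) - (g ?y2 - g x - A (?y2 - x))"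
        by (simp only: e) (simp add: algebra_simps)
      also have "norm \<dots> \<le> e/m * norm (?y1 - x) + e/m * norm (?y2 - x)"
        using dg[of ?y1] dg[of ?y2] n1 n2 tm tm'
        by (smt (verit) norm_triangle_ineq4)
      also have "\<dots> \<le> e/m * (t * (norm u + norm v)) + e/m * (t * (norm u + norm v))"
        using n1 n2 \<open>e>0\<close> m by (intro add_mono mult_left_mono) auto
      also have "\<dots> = e * t * ((2 * (norm u + norm v))/m)" by (simp add: field_simps)
      also have "\<dots> \<le> e * t * 1"
        using \<open>e>0\<close> t m by (intro mult_left_mono) (auto simp: m_def)
      finally show "norm (k *\<^sub>R (g ?y1 - g ?y2 - t *\<^sub>R A v)) \<le> e * t * norm k"
        by (simp add: mult.commute[of "e * t"] mult_left_mono)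
    qed
    have "norm (h t - h 0) \<le> e * t * norm (t - 0)"
      by (rule differentiable_bound[of "{0..t}" h, OF _ der bd]) (use t in auto)
    then show "norm (f (x + t *\<^sub>R u + t *\<^sub>R v) - f (x + t *\<^sub>R u) - f (x + t *\<^sub>R v) + f x - (t * t) *\<^sub>R A v)
      \<le> e * (t * t)"
      using t by (simp add: h_def algebra_simps)
  qed
qed

lemma second_derivative_symmetric:
  fixes f :: "'a::real_normed_vector \<Rightarrow> 'b::real_normed_vector"
  assumes "open S" "x \<in> S" "\<And>y. y \<in> S \<Longrightarrow> f differentiable (at y)"
    and A: "((\<lambda>y. frechet_derivative f (at y) u) has_derivative A) (at x)"
    and B: "((\<lambda>y. frechet_derivative f (at y) v) has_derivative B) (at x)"
  shows "A v = B u"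
proof -
  have "norm (A v - B u) \<le> 2 * e" if "e > 0" for e :: real
  proof -
    from second_difference_approx[OF assms(1-3) A \<open>e > 0\<close>] obtain d1 where d1: "d1 > 0"
      "\<And>t. 0 < t \<and> t < d1 \<Longrightarrow> norm (f (x + t *\<^sub>R u + t *\<^sub>R v) - f (x + t *\<^sub>R u) - f (x + t *\<^sub>R v)
        + f x - (t * t) *\<^sub>R A v) \<le> e * (t * t)" by blast
    from second_difference_approx[OF assms(1-3) B \<open>e > 0\<close>] obtain d2 where d2: "d2 > 0"
      "\<And>t. 0 < t \<and> t < d2 \<Longrightarrow> norm (f (x + t *\<^sub>R v + t *\<^sub>R u) - f (x + t *\<^sub>R v) - f (x + t *\<^sub>R u)
        + f x - (t * t) *\<^sub>R B u) \<le> e * (t * t)" by blast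
    define t where "t = min d1 d2 / 2"
    have t: "0 < t" "t < d1" "t < d2" using d1 d2 by (auto simp: t_def)
    define a where "a = f (x + t *\<^sub>R u + t *\<^sub>R v) - f (x + t *\<^sub>R u) - f (x + t *\<^sub>R v) + f x"
    have "norm (a - (t * t) *\<^sub>R A v) \<le> e * (t * t)" "norm (a - (t * t) *\<^sub>R B u) \<le> e * (t * t)"
      using d1(2)[of t] d2(2)[of t] t by (auto simp: a_def algebra_simps)
    then have "norm ((a - (t * t) *\<^sub>R B u) - (a - (t * t) *\<^sub>R A v)) \<le> 2 * e * (t * t)"
      using norm_triangle_ineq4[of "a - (t * t) *\<^sub>R B u" "a - (t * t) *\<^sub>R A v"] by linarith
    then have "norm ((t * t) *\<^sub>R (A v - B u)) \<le> 2 * e * (t * t)" by (simp add: algebra_simps)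
    then show ?thesis using t by simp
  qed
  then have "norm (A v - B u) \<le> 0"
    using field_le_epsilon[of "norm (A v - B u)" 0]
    by (metis add.left_neutral field_sum_of_halves mult_2 half_gt_zero)
  then show ?thesis by simp
qed

lemma smooth_on_second_derivative_symmetric:
  assumes "open S" "x \<in> S" "smooth_on S f"
  shows "frechet_derivative (\<lambda>y. frechet_derivative f (at y) u) (at x) v =
         frechet_derivative (\<lambda>y. frechet_derivative f (at y) v) (at x) u"
proof (rule second_derivative_symmetric[OF assms(1,2), of f])
  show "\<And>y. y \<in> S \<Longrightarrow> f differentiable at y"
    using smooth_on_has_derivative[OF assms(3)] differentiable_def by blast
qed (use smooth_on_has_derivative[OF smooth_on_frechet_derivative[OF assms(3)] assms(2)] in auto)

text \<open>The product rule for \<open>z \<mapsto> Df(h z) (g z)\<close>. All computations with brackets below (Jacobi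
  identity, naturality, pullback along a flow) are instances of it.\<close>

lemma has_derivative_frechet_derivative_along:
  fixes f :: "'a::euclidean_space \<Rightarrow> 'b::euclidean_space" and g :: "'c::real_normed_vector \<Rightarrow> 'a"
  assumes "open S" "smooth_on S f" "h z \<in> S"
    and h: "(h has_derivative h') (at z)" and g: "(g has_derivative g') (at z)"
  shows "((\<lambda>z. frechet_derivative f (at (h z)) (g z)) has_derivative
     (\<lambda>w. frechet_derivative f (at (h z)) (g' w) +
          frechet_derivative (\<lambda>x. frechet_derivative f (at x) (g z)) (at (h z)) (h' w))) (at z)"
proof -
  have lin: "linear (frechet_derivative f (at x))" if "x \<in> S" for x
    using smooth_on_has_derivative[OF assms(2) that] has_derivative_linear by blast
  have D: "((\<lambda>z. frechet_derivative f (at (h z)) b) has_derivative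
     (\<lambda>w. frechet_derivative (\<lambda>x. frechet_derivative f (at x) b) (at (h z)) (h' w))) (at z)" for b
    using has_derivative_compose[OF h smooth_on_has_derivative[OF smooth_on_frechet_derivative[OF assms(2)] assms(3)]] .
  have E: "frechet_derivative (\<lambda>x. frechet_derivative f (at x) (g z)) (at (h z)) w
     = (\<Sum>b\<in>Basis. (g z \<bullet> b) *\<^sub>R frechet_derivative (\<lambda>x. frechet_derivative f (at x) b) (at (h z)) w)" for w
  proof -
    have "((\<lambda>x. \<Sum>b\<in>Basis. (g z \<bullet> b) *\<^sub>R frechet_derivative f (at x) b) has_derivative
       (\<lambda>w. \<Sum>b\<in>Basis. (g z \<bullet> b) *\<^sub>R frechet_derivative (\<lambda>x. frechet_derivative f (at x) b) (at (h z)) w)) (at (h z))"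
      by (intro has_derivative_sum has_derivative_scaleR_right
           smooth_on_has_derivative[OF smooth_on_frechet_derivative[OF assms(2)] assms(3)])
    then have "((\<lambda>x. frechet_derivative f (at x) (g z)) has_derivative
       (\<lambda>w. \<Sum>b\<in>Basis. (g z \<bullet> b) *\<^sub>R frechet_derivative (\<lambda>x. frechet_derivative f (at x) b) (at (h z)) w)) (at (h z))"
      by (rule has_derivative_transform_within_open[OF _ assms(1,3)])
        (rule frechet_derivative_expand[OF assms(2), symmetric])
    from frechet_derivative_at[OF this] show ?thesis by (simp add: fun_eq_iff)
  qed
  have "((\<lambda>z. \<Sum>b\<in>Basis. (g z \<bullet> b) *\<^sub>R frechet_derivative f (at (h z)) b) has_derivative
     (\<lambda>w. \<Sum>b\<in>Basis. (g z \<bullet> b) *\<^sub>R frechet_derivative (\<lambda>x. frechet_derivative f (at x) b) (at (h z)) (h' w)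
        + (g' w \<bullet> b) *\<^sub>R frechet_derivative f (at (h z)) b)) (at z)"
    by (intro has_derivative_sum has_derivative_scaleR D has_derivative_inner_left g)
  moreover have "(\<lambda>w. \<Sum>b\<in>Basis. (g z \<bullet> b) *\<^sub>R frechet_derivative (\<lambda>x. frechet_derivative f (at x) b) (at (h z)) (h' w)
        + (g' w \<bullet> b) *\<^sub>R frechet_derivative f (at (h z)) b) =
     (\<lambda>w. frechet_derivative f (at (h z)) (g' w) +
          frechet_derivative (\<lambda>x. frechet_derivative f (at x) (g z)) (at (h z)) (h' w))"
    by (simp add: E sum.distrib frechet_derivative_expand[OF assms(2,3), of "g' _"] add.commute)
  ultimately have F: "((\<lambda>z. \<Sum>b\<in>Basis. (g z \<bullet> b) *\<^sub>R frechet_derivative f (at (h z)) b) has_derivative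
    (\<lambda>w. frechet_derivative f (at (h z)) (g' w) +
          frechet_derivative (\<lambda>x. frechet_derivative f (at x) (g z)) (at (h z)) (h' w))) (at z)" by simp
  have "(h \<longlongrightarrow> h z) (at z)" using h has_derivative_continuous isCont_def by blast
  then have "(h \<longlongrightarrow> h z) (nhds z)" by (simp add: tendsto_at_iff_tendsto_nhds)
  then have "eventually (\<lambda>y. h y \<in> S) (nhds z)" using assms(1,3) topological_tendstoD by fastforce
  then obtain T where "open T" "z \<in> T" "\<And>y. y \<in> T \<Longrightarrow> h y \<in> S" unfolding eventually_nhds by blast
  then show ?thesis
    by (intro has_derivative_transform_within_open[OF F, of T])
      (use frechet_derivative_expand[OF assms(2)] in auto)
qed

section \<open>Local flows in Euclidean space\<close>

text \<open>A flow on a manifold seen in a chart. An orbit may leave \<open>Om\<close> and return, so the times \<open>t\<close> with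
  \<open>(t, x) \<in> D\<close> need not form an interval. \<open>D_add\<close> and \<open>phi_add\<close> are the group law: following the
  flow for the time \<open>t\<close> after the time \<open>s\<close> stays in the chart exactly if the time \<open>s + t\<close> does.\<close>

locale local_flow =
  fixes Om :: "'e::euclidean_space set" and D :: "(real \<times> 'e) set"
    and phi :: "real \<Rightarrow> 'e \<Rightarrow> 'e" and X :: "'e \<Rightarrow> 'e"
  assumes open_Om: "open Om" and open_D: "open D"
    and smooth_phi: "smooth_on D (\<lambda>(t, x). phi t x)"
    and smooth_X: "smooth_on Om X"
    and D_0: "x \<in> Om \<Longrightarrow> (0, x) \<in> D"
    and phi_0: "x \<in> Om \<Longrightarrow> phi 0 x = x"
    and D_Om: "(t, x) \<in> D \<Longrightarrow> x \<in> Om \<and> phi t x \<in> Om"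
    and phi_deriv: "(t, x) \<in> D \<Longrightarrow> ((\<lambda>s. phi s x) has_vector_derivative X (phi t x)) (at t)"
    and D_add: "(s, x) \<in> D \<Longrightarrow> (t, phi s x) \<in> D \<longleftrightarrow> (s + t, x) \<in> D"
    and phi_add: "(s, x) \<in> D \<Longrightarrow> (t, phi s x) \<in> D \<Longrightarrow> phi t (phi s x) = phi (s + t) x"
begin

text \<open>The derivative of \<open>phi t\<close> at \<open>x\<close>, taken from the joint derivative of the flow so that it inherits
  smoothness in \<open>(t, x)\<close>.\<close>

definition Dx :: "real \<Rightarrow> 'e \<Rightarrow> 'e \<Rightarrow> 'e" where
  "Dx t x v = frechet_derivative (\<lambda>(t, x). phi t x) (at (t, x)) (0, v)"

lemma D_uminus: "(t, x) \<in> D \<Longrightarrow> (- t, phi t x) \<in> D"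
  using D_add[of t x "- t"] D_0 D_Om by auto

lemma phi_uminus: "(t, x) \<in> D \<Longrightarrow> phi (- t) (phi t x) = x"
  using phi_add[of t x "- t"] D_uminus phi_0 D_Om by auto

lemma phi_has_derivative:
  "z \<in> D \<Longrightarrow> ((\<lambda>(t, x). phi t x) has_derivative
     frechet_derivative (\<lambda>(t, x). phi t x) (at z)) (at z)"
  by (rule smooth_on_has_derivative[OF smooth_phi])

lemma frechet_derivative_phi:
  assumes "(t, x) \<in> D"
  shows "frechet_derivative (\<lambda>(t, x). phi t x) (at (t, x)) (a, v) = a *\<^sub>R X (phi t x) + Dx t x v"
proof -
  let ?F = "frechet_derivative (\<lambda>(t, x). phi t x) (at (t, x))"
  have lin: "linear ?F" using phi_has_derivative[OF assms] has_derivative_linear by blast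
  have "((\<lambda>s. (s, x)) has_derivative (\<lambda>a. (a, 0))) (at t)"
    by (auto intro!: derivative_eq_intros)
  from has_derivative_compose[OF this phi_has_derivative[OF assms]]
  have "((\<lambda>s. phi s x) has_derivative (\<lambda>a. ?F (a, 0))) (at t)" by simp
  moreover have "((\<lambda>s. phi s x) has_derivative (\<lambda>a. a *\<^sub>R X (phi t x))) (at t)"
    using phi_deriv[OF assms] by (simp add: has_vector_derivative_def)
  ultimately have "?F (a, 0) = a *\<^sub>R X (phi t x)"
    using has_derivative_unique by metis
  moreover have "?F (a, v) = ?F (a, 0) + ?F (0, v)"
    using linear_add[OF lin, of "(a, 0)" "(0, v)"] by simp
  ultimately show ?thesis by (simp add: Dx_def)
qed

lemma has_derivative_phi_compose:
  assumes a: "(a has_derivative a') (at z within S)" and b: "(b has_derivative b') (at z within S)"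
    and D: "(a z, b z) \<in> D"
  shows "((\<lambda>z. phi (a z) (b z)) has_derivative
     (\<lambda>w. a' w *\<^sub>R X (phi (a z) (b z)) + Dx (a z) (b z) (b' w))) (at z within S)"
  using has_derivative_compose[OF has_derivative_Pair[OF a b] phi_has_derivative[OF D]]
  by (simp add: frechet_derivative_phi[OF D])

lemma phi_has_derivative_x:
  "(t, x) \<in> D \<Longrightarrow> (phi t has_derivative Dx t x) (at x)"
  using has_derivative_phi_compose[OF has_derivative_const has_derivative_ident, of t x UNIV] by simp

lemma linear_Dx: "(t, x) \<in> D \<Longrightarrow> linear (Dx t x)"
  using phi_has_derivative_x has_derivative_linear by blast

lemma Dx_0:
  assumes "x \<in> Om"
  shows "Dx 0 x v = v"
proof -
  have "((\<lambda>x. x) has_derivative Dx 0 x) (at x)"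
    by (rule has_derivative_transform_within_open[OF phi_has_derivative_x[OF D_0[OF assms]] open_Om assms])
      (rule phi_0)
  then show ?thesis using has_derivative_unique[OF _ has_derivative_ident] by metis
qed

lemma open_D_slice: "open {y. (t, y) \<in> D}"
  using open_D by (rule open_vimage[of D "Pair t", unfolded vimage_def]) (auto intro: continuous_intros)

lemma Dx_uminus:
  assumes "(t, x) \<in> D"
  shows "Dx (- t) (phi t x) (Dx t x v) = v"
proof -
  have "((\<lambda>y. phi (- t) (phi t y)) has_derivative (\<lambda>v. Dx (- t) (phi t x) (Dx t x v))) (at x)"
    using has_derivative_phi_compose[OF has_derivative_const phi_has_derivative_x[OF assms], of "- t"]
      D_uminus[OF assms] by simp
  then have "((\<lambda>y. y) has_derivative (\<lambda>v. Dx (- t) (phi t x) (Dx t x v))) (at x)"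
    by (rule has_derivative_transform_within_open[OF _ open_D_slice]) (use assms phi_uminus in auto)
  then show ?thesis using has_derivative_unique[OF _ has_derivative_ident] by metis
qed

lemma inj_Dx: "(t, x) \<in> D \<Longrightarrow> inj (Dx t x)"
  by (metis Dx_uminus injI)

text \<open>A flow preserves its own field: differentiate \<open>phi t (phi s x) = phi (s + t) x\<close> at \<open>s = 0\<close>.\<close>

lemma Dx_X:
  assumes "(t, x) \<in> D"
  shows "Dx t x (X x) = X (phi t x)"
proof -
  have xO: "x \<in> Om" using D_Om assms by blast
  have 1: "((\<lambda>s. phi s x) has_derivative (\<lambda>a. a *\<^sub>R X x)) (at 0)"
    using phi_deriv[OF D_0[OF xO]] phi_0[OF xO] by (simp add: has_vector_derivative_def)
  have "((\<lambda>s. phi t (phi s x)) has_derivative (\<lambda>w. Dx t x (w *\<^sub>R X x))) (at 0)"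
    using has_derivative_phi_compose[OF has_derivative_const 1, of t] assms phi_0[OF xO] by simp
  moreover have "((\<lambda>s. phi t (phi s x)) has_derivative (\<lambda>w. w *\<^sub>R X (phi t x))) (at 0)"
  proof -
    have "((\<lambda>s. s + t) has_derivative (\<lambda>w. w)) (at 0)" by (auto intro!: derivative_eq_intros)
    from has_derivative_compose[OF this, of "\<lambda>s. phi s x"] phi_deriv[OF assms]
    have 2: "((\<lambda>s. phi (s + t) x) has_derivative (\<lambda>w. w *\<^sub>R X (phi t x))) (at 0)"
      by (simp add: has_vector_derivative_def)
    have "open {s. (s, x) \<in> D \<and> (s + t, x) \<in> D}"
      using open_D by (intro open_Collect_conj open_vimage[of D "\<lambda>s. (s, x)", unfolded vimage_def]
          open_vimage[of D "\<lambda>s. (s + t, x)", unfolded vimage_def]) (auto intro!: continuous_intros)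
    from has_derivative_transform_within_open[OF 2 this, of "\<lambda>s. phi t (phi s x)"]
    show ?thesis using phi_add D_add D_0[OF xO] assms by auto
  qed
  ultimately have "(\<lambda>w. Dx t x (w *\<^sub>R X x)) = (\<lambda>w. w *\<^sub>R X (phi t x))"
    by (rule has_derivative_unique)
  then show ?thesis by (metis scaleR_one)
qed

text \<open>The infinitesimal form of the pullback of \<open>Z\<close> along the flow of \<open>X\<close> is the bracket
  \<open>[X, Z]\<close>. The mixed derivative of the flow in time and space is computed in the order in which
  the time derivative, which is \<open>X\<close>, comes first.\<close>

lemma pullback_has_vector_derivative:
  assumes y: "y \<in> Om" and Z: "smooth_on Om Z"
  shows "((\<lambda>s. Dx (- s) (phi s y) (Z (phi s y))) has_vector_derivative
     frechet_derivative Z (at y) (X y) - frechet_derivative X (at y) (Z y)) (at 0)"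
proof -
  let ?P = "\<lambda>(t, x). phi t x"
  let ?v = "Z y"
  let ?G = "\<lambda>z. frechet_derivative ?P (at z) (0, ?v)"
  have D0: "(0, y) \<in> D" using y D_0 by blast
  have phi1: "((\<lambda>s. phi s y) has_derivative (\<lambda>a. a *\<^sub>R X y)) (at 0)"
    using phi_deriv[OF D0] phi_0[OF y] by (simp add: has_vector_derivative_def)
  have h: "((\<lambda>s. (- s, phi s y)) has_derivative (\<lambda>a. (- a, a *\<^sub>R X y))) (at 0)"
    by (intro has_derivative_Pair phi1) (auto intro!: derivative_eq_intros)
  have Zd: "(Z has_derivative frechet_derivative Z (at (phi 0 y))) (at (phi 0 y))"
    using smooth_on_has_derivative[OF Z y] phi_0[OF y] by simp
  have linZ: "linear (frechet_derivative Z (at y))"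
    using smooth_on_has_derivative[OF Z y] has_derivative_linear by blast
  have g: "((\<lambda>s. (0::real, Z (phi s y))) has_derivative
      (\<lambda>a. (0, a *\<^sub>R frechet_derivative Z (at y) (X y)))) (at 0)"
    using has_derivative_Pair[OF has_derivative_const has_derivative_compose[OF phi1 Zd]]
    by (simp add: phi_0[OF y] linear_scale[OF linZ])
  have Gd: "(?G has_derivative frechet_derivative ?G (at (0, y))) (at (0, y))"
    using smooth_on_has_derivative[OF smooth_on_frechet_derivative[OF smooth_phi] D0] .
  have linG: "linear (frechet_derivative ?G (at (0, y)))"
    using Gd has_derivative_linear by blast
  have G0: "frechet_derivative ?G (at (0, y)) (0, b) = 0" for b
  proof -
    have "((\<lambda>x. (0::real, x)) has_derivative (\<lambda>b. (0, b))) (at y)"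
      by (auto intro!: derivative_eq_intros)
    from has_derivative_compose[OF this Gd]
    have "((\<lambda>x. ?G (0, x)) has_derivative (\<lambda>b. frechet_derivative ?G (at (0, y)) (0, b))) (at y)" .
    then have "((\<lambda>x. ?v) has_derivative (\<lambda>b. frechet_derivative ?G (at (0, y)) (0, b))) (at y)"
      by (rule has_derivative_transform_within_open[OF _ open_Om y]) (metis Dx_def Dx_0)
    from has_derivative_unique[OF this has_derivative_const] show ?thesis by metis
  qed
  have G1: "frechet_derivative ?G (at (0, y)) (1, 0) = frechet_derivative X (at y) ?v"
  proof -
    have "frechet_derivative ?G (at (0, y)) (1, 0) =
        frechet_derivative (\<lambda>z. frechet_derivative ?P (at z) (1, 0)) (at (0, y)) (0, ?v)"
      by (rule smooth_on_second_derivative_symmetric[OF open_D D0 smooth_phi])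
    moreover have "((\<lambda>z. frechet_derivative ?P (at z) (1, 0)) has_derivative
        (\<lambda>w. frechet_derivative X (at y) (frechet_derivative ?P (at (0, y)) w))) (at (0, y))"
    proof (rule has_derivative_transform_within_open[OF _ open_D D0])
      have "(X has_derivative frechet_derivative X (at (?P (0, y)))) (at (?P (0, y)))"
        using smooth_on_has_derivative[OF smooth_X y] phi_0[OF y] by simp
      from has_derivative_compose[OF phi_has_derivative[OF D0] this]
      show "((\<lambda>z. X (?P z)) has_derivative
        (\<lambda>w. frechet_derivative X (at y) (frechet_derivative ?P (at (0, y)) w))) (at (0, y))"
        by (simp add: phi_0[OF y])
    next
      fix z assume "z \<in> D"
      moreover obtain t x where "z = (t, x)" by force
      ultimately show "X (?P z) = frechet_derivative ?P (at z) (1, 0)"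
        using frechet_derivative_phi[of t x 1 0] linear_Dx[of t x] by (simp add: linear_0)
    qed
    from frechet_derivative_at[OF this, symmetric] calculation show ?thesis using Dx_0[OF y, of ?v] by (simp add: Dx_def)
  qed
  have "frechet_derivative ?G (at (0, y)) (- a, b) = - a *\<^sub>R frechet_derivative X (at y) ?v" for a b
    using linear_add[OF linG, of "(- a) *\<^sub>R (1, 0)" "(0, b)"] linear_scale[OF linG, of "- a" "(1, 0)"] G0 G1
    by simp
  moreover have "((\<lambda>s. frechet_derivative ?P (at (- s, phi s y)) (0, Z (phi s y))) has_derivative
     (\<lambda>a. frechet_derivative ?P (at (- 0, phi 0 y)) (0, a *\<^sub>R frechet_derivative Z (at y) (X y)) +
       frechet_derivative (\<lambda>z. frechet_derivative ?P (at z) (0, Z (phi 0 y))) (at (- 0, phi 0 y)) (- a, a *\<^sub>R X y)))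
      (at 0)"
    by (rule has_derivative_frechet_derivative_along[OF open_D smooth_phi _ h g])
      (use D0 phi_0[OF y] in simp)
  ultimately show ?thesis
    unfolding has_vector_derivative_def Dx_def[symmetric]
    by (simp add: phi_0[OF y] Dx_0[OF y] scaleR_diff_right)
qed

text \<open>Uniqueness of integral curves: flowing back along \<open>X\<close> from the point reached at time \<open>r\<close>
  gives a curve with derivative zero.\<close>

lemma integral_curve_unique:
  assumes der: "\<And>r. r \<in> {a..b} \<Longrightarrow> (x has_vector_derivative X (x r)) (at r within {a..b})"
    and D: "\<And>r. r \<in> {a..b} \<Longrightarrow> (r0 - r, x r) \<in> D"
    and r: "r0 \<in> {a..b}" "r \<in> {a..b}"
  shows "phi (r0 - r) (x r) = x r0"
proof -
  have "\<exists>c. \<forall>r\<in>{a..b}. phi (r0 - r) (x r) = c"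
  proof (rule has_derivative_zero_constant)
    fix r assume r: "r \<in> {a..b}"
    have 1: "((\<lambda>r. r0 - r) has_derivative (\<lambda>w. - w)) (at r within {a..b})"
      by (auto intro!: derivative_eq_intros)
    show "((\<lambda>r. phi (r0 - r) (x r)) has_derivative (\<lambda>w. 0)) (at r within {a..b})"
      using has_derivative_phi_compose[OF 1 der[OF r, unfolded has_vector_derivative_def] D[OF r]]
      by (simp add: linear_scale[OF linear_Dx[OF D[OF r]]] Dx_X[OF D[OF r]])
  qed simp
  then have "phi (r0 - r) (x r) = phi (r0 - r0) (x r0)" using r by metis
  also have "\<dots> = x r0" using D[OF r(1)] D_Om phi_0 by auto
  finally show ?thesis .
qed

lemma uniform_tube:
  assumes K: "compact K" "K \<subseteq> Om" and W: "open W" "\<And>x. x \<in> K \<Longrightarrow> (0, x) \<in> W"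
  shows "\<exists>d>0. \<forall>t x. \<bar>t\<bar> \<le> d \<and> x \<in> K \<longrightarrow> (t, x) \<in> (W :: (real \<times> 'e) set)"
proof -
  have "{0} \<times> K \<subseteq> W" using W(2) by auto
  from Elementary_Topology.tube_lemma[OF K(1) W(1) this]
  obtain T where T: "0 \<in> T" "open T" "T \<times> K \<subseteq> W" by blast
  then obtain e where e: "e > 0" "cball 0 e \<subseteq> T" using open_contains_cball by blast
  then have "t \<in> T" if "\<bar>t\<bar> \<le> e" for t using that by (auto simp: subset_eq)
  then show ?thesis using T(3) e(1) by blast
qed

lemma phi_near:
  assumes K: "compact K" "K \<subseteq> Om" and "e > 0"
  shows "\<exists>d>0. \<forall>t x. \<bar>t\<bar> \<le> d \<and> x \<in> K \<longrightarrow> (t, x) \<in> D \<and> dist (phi t x) x < e"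
proof -
  have c: "continuous_on D (\<lambda>z. dist ((\<lambda>(t, x). phi t x) z) (snd z))"
    by (intro continuous_intros smooth_on_continuous_on[OF smooth_phi])
  have "open (D \<inter> (\<lambda>z. dist ((\<lambda>(t, x). phi t x) z) (snd z)) -` {..<e})"
    using continuous_on_open_vimage[OF open_D] c by (metis Int_commute open_lessThan)
  from uniform_tube[OF K this] show ?thesis
    using D_0 phi_0 K(2) \<open>e > 0\<close> by (auto simp: subset_eq)
qed

lemma phi_first_order:
  assumes K: "compact K" "K \<subseteq> Om" and "e > 0"
  shows "\<exists>d>0. \<forall>t x. \<bar>t\<bar> \<le> d \<and> x \<in> K \<longrightarrow>
     (t, x) \<in> D \<and> norm (phi t x - x - t *\<^sub>R X x) \<le> e * \<bar>t\<bar>"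
proof -
  have "continuous_on D (\<lambda>z. X ((\<lambda>(t, x). phi t x) z))"
    by (rule continuous_on_compose2[OF smooth_on_continuous_on[OF smooth_X]
          smooth_on_continuous_on[OF smooth_phi]]) (use D_Om in auto)
  moreover have "continuous_on D (\<lambda>z. X (snd z))"
    by (rule continuous_on_compose2[OF smooth_on_continuous_on[OF smooth_X]])
       (use D_Om in \<open>auto intro!: continuous_intros\<close>)
  ultimately have c: "continuous_on D (\<lambda>z. norm (X ((\<lambda>(t, x). phi t x) z) - X (snd z)))"
    by (intro continuous_intros)
  have "open (D \<inter> (\<lambda>z. norm (X ((\<lambda>(t, x). phi t x) z) - X (snd z))) -` {..<e})"
    using continuous_on_open_vimage[OF open_D] c by (metis Int_commute open_lessThan)
  from uniform_tube[OF K this] obtain d where d: "d > 0" and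
    dd: "\<And>t x. \<bar>t\<bar> \<le> d \<Longrightarrow> x \<in> K \<Longrightarrow> (t, x) \<in> D \<and> norm (X (phi t x) - X x) < e"
    using D_0 phi_0 K(2) \<open>e > 0\<close> by (auto simp: subset_eq)
  have "norm (phi t x - x - t *\<^sub>R X x) \<le> e * \<bar>t\<bar>" if t: "\<bar>t\<bar> \<le> d" "x \<in> K" for t x
  proof -
    have "norm ((phi t x - t *\<^sub>R X x) - (phi 0 x - 0 *\<^sub>R X x)) \<le> e * norm (t - 0)"
    proof (rule differentiable_bound[of "{-d..d}" "\<lambda>s. phi s x - s *\<^sub>R X x"
          "\<lambda>s w. w *\<^sub>R (X (phi s x) - X x)"])
      fix s assume s: "s \<in> {-d..d}"
      then have sD: "(s, x) \<in> D" "norm (X (phi s x) - X x) < e" using dd[of s x] t by auto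
      show "((\<lambda>s. phi s x - s *\<^sub>R X x) has_derivative (\<lambda>w. w *\<^sub>R (X (phi s x) - X x))) (at s within {-d..d})"
        using phi_deriv[OF sD(1), THEN has_vector_derivative_at_within]
        by (auto intro!: derivative_eq_intros simp: has_vector_derivative_def algebra_simps)
      show "onorm (\<lambda>w. w *\<^sub>R (X (phi s x) - X x)) \<le> e"
        using sD(2) \<open>e > 0\<close> by (intro onorm_bound) (auto simp: mult.commute[of e] mult_left_mono)
    qed (use t d in auto)
    then show ?thesis using phi_0 t K(2) by (auto simp: subset_eq algebra_simps)
  qed
  then show ?thesis using d dd by blast
qed

text \<open>The Lipschitz constant is uniform in small times \<open>t\<close>; this is what bounds the accumulated error
  of the approximation of backward flows below.\<close>

lemma phi_Lipschitz:
  assumes z: "z \<in> Om"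
  shows "\<exists>r>0. \<exists>d>0. \<exists>C>0. cball z r \<subseteq> Om \<and> (\<forall>t x y. \<bar>t\<bar> \<le> d \<and> x \<in> cball z r \<and> y \<in> cball z r \<longrightarrow>
     (t, x) \<in> D \<and> norm (phi t x - phi t y) \<le> C * norm (x - y))"
proof -
  obtain r where r: "r > 0" "cball z r \<subseteq> Om" using z open_Om open_contains_cball by blast
  obtain d where d: "d > 0" and dD: "\<And>t x. \<bar>t\<bar> \<le> d \<Longrightarrow> x \<in> cball z r \<Longrightarrow> (t, x) \<in> D"
    using phi_near[OF compact_cball r(2) zero_less_one] by blast
  have "\<exists>B. \<forall>w \<in> {-d..d} \<times> cball z r. norm (frechet_derivative (\<lambda>(t, x). phi t x) (at w) (0, b)) \<le> B" for b
  proof -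
    have "continuous_on ({-d..d} \<times> cball z r) (\<lambda>w. frechet_derivative (\<lambda>(t, x). phi t x) (at w) (0, b))"
      by (rule continuous_on_subset[OF smooth_on_continuous_on[OF smooth_on_frechet_derivative[OF smooth_phi]]])
        (use dD in auto)
    then have "bounded ((\<lambda>w. frechet_derivative (\<lambda>(t, x). phi t x) (at w) (0, b)) ` ({-d..d} \<times> cball z r))"
      by (intro compact_imp_bounded compact_continuous_image compact_Times compact_Icc compact_cball)
    then show ?thesis by (auto simp: bounded_iff)
  qed
  then obtain B where B: "\<And>t x b. \<bar>t\<bar> \<le> d \<Longrightarrow> x \<in> cball z r \<Longrightarrow> norm (Dx t x b) \<le> B b"
    unfolding Dx_def by (metis SigmaI abs_le_iff atLeastAtMost_iff minus_le_iff)
  define C where "C = (\<Sum>b\<in>Basis. \<bar>B b\<bar>) + 1"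
  have C: "C > 0" by (auto simp: C_def intro: add_nonneg_pos sum_nonneg)
  have nD: "norm (Dx t x v) \<le> C * norm v" if "\<bar>t\<bar> \<le> d" "x \<in> cball z r" for t x v
  proof -
    have lin: "linear (Dx t x)" using linear_Dx dD that by blast
    have "Dx t x v = (\<Sum>b\<in>Basis. (v \<bullet> b) *\<^sub>R Dx t x b)"
      using lin by (subst euclidean_representation[of v, symmetric]) (simp add: linear_sum linear_scale)
    also have "norm \<dots> \<le> (\<Sum>b\<in>Basis. norm v * \<bar>B b\<bar>)"
    proof (rule sum_norm_le)
      fix b :: 'e assume b: "b \<in> Basis"
      have "norm (Dx t x b) \<le> \<bar>B b\<bar>" using B[OF that, of b] by linarith
      then show "norm ((v \<bullet> b) *\<^sub>R Dx t x b) \<le> norm v * \<bar>B b\<bar>"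
        using Basis_le_norm[OF b, of v] by (auto intro!: mult_mono)
    qed
    also have "\<dots> \<le> C * norm v" by (simp add: C_def sum_distrib_left[symmetric] algebra_simps)
    finally show ?thesis .
  qed
  have "norm (phi t x - phi t y) \<le> C * norm (x - y)"
    if t: "\<bar>t\<bar> \<le> d" "x \<in> cball z r" "y \<in> cball z r" for t x y
  proof (rule differentiable_bound[of "cball z r" "phi t" "Dx t"])
    fix u assume u: "u \<in> cball z r"
    show "(phi t has_derivative Dx t u) (at u within cball z r)"
      using phi_has_derivative_x[OF dD[OF t(1) u]] has_derivative_at_withinI by blast
    show "onorm (Dx t u) \<le> C" using nD[OF t(1) u] C by (intro onorm_bound) auto
  qed (use t in auto)
  then show ?thesis using r d C dD by blast
qed

end

section \<open>Lie algebras of vector fields in Euclidean space\<close>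

definition vf_bracket :: "('e::euclidean_space \<Rightarrow> 'e) \<Rightarrow> ('e \<Rightarrow> 'e) \<Rightarrow> 'e \<Rightarrow> 'e" where
  "vf_bracket X Y x = frechet_derivative Y (at x) (X x) - frechet_derivative X (at x) (Y x)"

text \<open>Only the values on \<open>Om\<close> are constrained, because the coordinate representative of a field on
  the manifold has a meaning only on the image of the chart.\<close>

inductive_set lie_closure :: "'e::euclidean_space set \<Rightarrow> ('e \<Rightarrow> 'e) set \<Rightarrow> ('e \<Rightarrow> 'e) set"
  for Om :: "'e set" and Fam :: "('e \<Rightarrow> 'e) set" where
  gen: "X \<in> Fam \<Longrightarrow> X \<in> lie_closure Om Fam"
| zero: "(\<And>x. x \<in> Om \<Longrightarrow> Z x = 0) \<Longrightarrow> Z \<in> lie_closure Om Fam"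
| lin: "X \<in> lie_closure Om Fam \<Longrightarrow> Y \<in> lie_closure Om Fam \<Longrightarrow>
    (\<And>x. x \<in> Om \<Longrightarrow> Z x = a *\<^sub>R X x + b *\<^sub>R Y x) \<Longrightarrow> Z \<in> lie_closure Om Fam"
| bracket: "X \<in> lie_closure Om Fam \<Longrightarrow> Y \<in> lie_closure Om Fam \<Longrightarrow>
    (\<And>x. x \<in> Om \<Longrightarrow> Z x = vf_bracket X Y x) \<Longrightarrow> Z \<in> lie_closure Om Fam"

lemma smooth_on_vf_bracket:
  assumes "open Om" "smooth_on Om X" "smooth_on Om Y"
  shows "smooth_on Om (vf_bracket X Y)"
  unfolding vf_bracket_def[abs_def]
  by (intro smooth_on_diff smooth_on_frechet_derivative_along assms)

lemma smooth_on_linear_combination: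
  assumes "open Om" "smooth_on Om X" "smooth_on Om Y"
    "\<And>x. x \<in> Om \<Longrightarrow> Z x = a *\<^sub>R X x + b *\<^sub>R Y x"
  shows "smooth_on Om Z"
proof (rule iffD2[OF smooth_on_cong[OF assms(1,4)]])
  show "smooth_on Om (\<lambda>x. a *\<^sub>R X x + b *\<^sub>R Y x)"
    by (intro smooth_on_add smooth_on_scaleR_const assms(1-3))
qed

lemma lie_closure_smooth:
  assumes "open Om" "\<And>X. X \<in> Fam \<Longrightarrow> smooth_on Om X"
  shows "Z \<in> lie_closure Om Fam \<Longrightarrow> smooth_on Om Z"
proof (induction rule: lie_closure.induct)
  case (gen X)
  then show ?case using assms by blast
next
  case (zero Z)
  then show ?case using smooth_on_cong[OF assms(1), of Z "\<lambda>x. 0"] smooth_on_const by blast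
next
  case (lin X Y Z a b)
  then show ?case using smooth_on_linear_combination[OF assms(1)] by blast
next
  case (bracket X Y Z)
  then show ?case
    using smooth_on_cong[OF assms(1), of Z "vf_bracket X Y"] smooth_on_vf_bracket[OF assms(1)] by blast
qed

lemma smooth_on_linear_frechet_derivative:
  "smooth_on S f \<Longrightarrow> x \<in> S \<Longrightarrow> linear (frechet_derivative f (at x))"
  using smooth_on_has_derivative has_derivative_linear by blast

lemma frechet_derivative_vf_bracket:
  assumes "open Om" "smooth_on Om X" "smooth_on Om Y" "x \<in> Om"
  shows "frechet_derivative (vf_bracket X Y) (at x) w =
     frechet_derivative Y (at x) (frechet_derivative X (at x) w)
   + frechet_derivative (\<lambda>y. frechet_derivative Y (at y) (X x)) (at x) w
   - frechet_derivative X (at x) (frechet_derivative Y (at x) w)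
   - frechet_derivative (\<lambda>y. frechet_derivative X (at y) (Y x)) (at x) w"
proof -
  have 1: "((\<lambda>z. frechet_derivative Y (at z) (X z)) has_derivative
     (\<lambda>w. frechet_derivative Y (at x) (frechet_derivative X (at x) w)
       + frechet_derivative (\<lambda>y. frechet_derivative Y (at y) (X x)) (at x) w)) (at x)"
    by (rule has_derivative_frechet_derivative_along[OF assms(1,3,4) has_derivative_ident
       smooth_on_has_derivative[OF assms(2,4)]])
  have 2: "((\<lambda>z. frechet_derivative X (at z) (Y z)) has_derivative
     (\<lambda>w. frechet_derivative X (at x) (frechet_derivative Y (at x) w)
       + frechet_derivative (\<lambda>y. frechet_derivative X (at y) (Y x)) (at x) w)) (at x)"
    by (rule has_derivative_frechet_derivative_along[OF assms(1,2,4) has_derivative_ident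
       smooth_on_has_derivative[OF assms(3,4)]])
  show ?thesis
    using frechet_derivative_at[OF has_derivative_diff[OF 1 2], symmetric]
    unfolding vf_bracket_def[abs_def] by (simp add: algebra_simps)
qed

text \<open>The second derivatives of \<open>X\<close>, \<open>Y\<close> and \<open>Z\<close> cancel in pairs by symmetry.\<close>

lemma vf_bracket_Jacobi:
  assumes "open Om" "smooth_on Om X" "smooth_on Om Y" "smooth_on Om Z" "x \<in> Om"
  shows "vf_bracket (vf_bracket X Y) Z x =
     vf_bracket X (vf_bracket Y Z) x - vf_bracket Y (vf_bracket X Z) x"
proof -
  note D = frechet_derivative_vf_bracket[OF assms(1) _ _ assms(5)]
  note L = smooth_on_linear_frechet_derivative[OF _ assms(5)]
  note Sy = smooth_on_second_derivative_symmetric[OF assms(1,5)]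
  show ?thesis
    unfolding vf_bracket_def[of "vf_bracket X Y"] vf_bracket_def[of X "vf_bracket Y Z"]
      vf_bracket_def[of Y "vf_bracket X Z"]
    unfolding D[OF assms(2,3)] D[OF assms(3,4)] D[OF assms(2,4)]
    unfolding vf_bracket_def
    using Sy[OF assms(2), of "Y x" "Z x"] Sy[OF assms(3), of "X x" "Z x"] Sy[OF assms(4), of "X x" "Y x"]
    by (simp add: linear_diff[OF L[OF assms(2)]] linear_diff[OF L[OF assms(3)]] linear_diff[OF L[OF assms(4)]])
qed

lemma frechet_derivative_linear_combination:
  assumes "open Om" "smooth_on Om X" "smooth_on Om Y" "x \<in> Om"
    "\<And>x. x \<in> Om \<Longrightarrow> Z x = a *\<^sub>R X x + b *\<^sub>R Y x"
  shows "frechet_derivative Z (at x) w =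
    a *\<^sub>R frechet_derivative X (at x) w + b *\<^sub>R frechet_derivative Y (at x) w"
proof -
  have "((\<lambda>x. a *\<^sub>R X x + b *\<^sub>R Y x) has_derivative
     (\<lambda>w. a *\<^sub>R frechet_derivative X (at x) w + b *\<^sub>R frechet_derivative Y (at x) w)) (at x)"
    by (intro has_derivative_add has_derivative_scaleR_right smooth_on_has_derivative[OF _ assms(4)] assms(2,3))
  then have "(Z has_derivative
     (\<lambda>w. a *\<^sub>R frechet_derivative X (at x) w + b *\<^sub>R frechet_derivative Y (at x) w)) (at x)"
    by (rule has_derivative_transform_within_open[OF _ assms(1,4)]) (use assms(5) in simp)
  from frechet_derivative_at[OF this, symmetric] show ?thesis by simp
qed

lemma frechet_derivative_cong:
  assumes "open S" "x \<in> S" "\<And>y. y \<in> S \<Longrightarrow> f y = g y"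
  shows "frechet_derivative f (at x) = frechet_derivative g (at x)"
proof -
  have "(f has_derivative E) (at x) \<longleftrightarrow> (g has_derivative E) (at x)" for E
    using has_derivative_transform_within_open[OF _ assms(1,2)] assms(3) by metis
  then show ?thesis by (simp add: frechet_derivative_def)
qed

lemma vf_bracket_cong:
  assumes "open S" "x \<in> S" "\<And>y. y \<in> S \<Longrightarrow> X y = X' y" "\<And>y. y \<in> S \<Longrightarrow> Y y = Y' y"
  shows "vf_bracket X Y x = vf_bracket X' Y' x"
  using frechet_derivative_cong[OF assms(1,2), of X X'] frechet_derivative_cong[OF assms(1,2), of Y Y'] assms
  by (simp add: vf_bracket_def)

lemma has_vector_derivative_in_subspace:
  fixes s :: "real \<Rightarrow> 'e::euclidean_space"
  assumes "subspace S" "(s has_vector_derivative l) (at 0)" "d > 0"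
    "\<And>t. 0 < t \<Longrightarrow> t < d \<Longrightarrow> s t \<in> S" "s 0 \<in> S"
  shows "l \<in> S"
proof -
  have "(\<lambda>h. norm (s (0 + h) - s 0 - h *\<^sub>R l) / norm h) \<midarrow>0\<rightarrow> 0"
    using assms(2) unfolding has_vector_derivative_def has_derivative_at by blast
  then have "((\<lambda>h. norm (s (0 + h) - s 0 - h *\<^sub>R l) / norm h) \<longlongrightarrow> 0) (at_right 0)"
    using filterlim_at_split by blast
  then have "((\<lambda>h. norm ((1/h) *\<^sub>R (s h - s 0) - l)) \<longlongrightarrow> 0) (at_right 0)"
  proof (rule Lim_transform_eventually)
    show "\<forall>\<^sub>F h in at_right 0. norm (s (0 + h) - s 0 - h *\<^sub>R l) / norm h = norm ((1/h) *\<^sub>R (s h - s 0) - l)"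
      unfolding eventually_at_right_field
    proof (intro exI conjI allI impI)
      show "(0::real) < 1" by simp
      fix h :: real assume h: "0 < h" "h < 1"
      then have "(1/h) *\<^sub>R (s h - s 0) - l = (1/h) *\<^sub>R (s h - s 0 - h *\<^sub>R l)"
        by (simp add: scaleR_diff_right)
      then show "norm (s (0 + h) - s 0 - h *\<^sub>R l) / norm h = norm ((1/h) *\<^sub>R (s h - s 0) - l)"
        using h by simp
    qed
  qed
  then have lim: "((\<lambda>h. (1/h) *\<^sub>R (s h - s 0)) \<longlongrightarrow> l) (at_right 0)"
    by (simp add: tendsto_norm_zero_iff LIM_zero_iff)
  show ?thesis
  proof (rule Lim_in_closed_set[OF closed_subspace[OF assms(1)] _ _ lim])
    show "\<forall>\<^sub>F h in at_right 0. (1/h) *\<^sub>R (s h - s 0) \<in> S"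
      unfolding eventually_at_right_field
      using assms by (intro exI[of _ d]) (auto intro: subspace_scale subspace_diff)
  qed simp
qed

section \<open>Local controllability\<close>

text \<open>\<open>R x y\<close> stands for reachability of \<open>y\<close> from \<open>x\<close>. The coefficients \<open>c\<close> carry what ampleness
  contributes: the reversed fields are positive combinations of the available ones. They depend on
  the point, and their continuity in the point is essential for the use of Brouwer's theorem.\<close>

locale control_family =
  fixes Om :: "'e::euclidean_space set" and I F :: "'u set" and X :: "'u \<Rightarrow> 'e \<Rightarrow> 'e"
    and phi :: "'u \<Rightarrow> real \<Rightarrow> 'e \<Rightarrow> 'e" and D :: "'u \<Rightarrow> (real \<times> 'e) set"
    and R :: "'e \<Rightarrow> 'e \<Rightarrow> bool" and c :: "'u \<Rightarrow> 'u \<Rightarrow> 'e \<Rightarrow> real"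
  assumes finite_I: "finite I" and F_I: "F \<subseteq> I" and open_Om: "open Om"
    and flow: "i \<in> I \<Longrightarrow> local_flow Om (D i) (phi i) (X i)"
    and R_refl: "R x x" and R_trans: "R x y \<Longrightarrow> R y z \<Longrightarrow> R x z"
    and R_phi: "i \<in> I \<Longrightarrow> (t, x) \<in> D i \<Longrightarrow> 0 \<le> t \<Longrightarrow> R x (phi i t x)"
    and c_nonneg: "u \<in> F \<Longrightarrow> i \<in> I \<Longrightarrow> x \<in> Om \<Longrightarrow> 0 \<le> c u i x"
    and c_continuous: "u \<in> F \<Longrightarrow> i \<in> I \<Longrightarrow> continuous_on Om (c u i)"
    and reverse: "u \<in> F \<Longrightarrow> x \<in> Om \<Longrightarrow> (\<Sum>i\<in>I. c u i x *\<^sub>R X i x) = - X u x"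
begin

lemma smooth_X: "i \<in> I \<Longrightarrow> smooth_on Om (X i)"
  using flow local_flow.smooth_X by blast

text \<open>To move by \<open>s\<close> along the combination \<open>\<Sum>i. k i x *\<^sub>R X i x\<close>, follow the flows of the \<open>X i\<close>
  in turn for the times \<open>s * k i x\<close>, with the coefficients frozen at the starting point \<open>x\<close>. The
  times vary with \<open>x\<close>, but continuously, so the step is a continuous map.\<close>

lemma positive_combination_step:
  assumes k: "\<And>i x. i \<in> I \<Longrightarrow> x \<in> Om \<Longrightarrow> 0 \<le> k i x" "\<And>i. i \<in> I \<Longrightarrow> continuous_on Om (k i)"
    and K: "compact K" "K \<subseteq> Om"
    and "finite J" "J \<subseteq> I" and "e > 0"
  shows "\<exists>s0>0. \<forall>s. 0 \<le> s \<and> s \<le> s0 \<longrightarrow> (\<exists>f. continuous_on K f \<and>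
      (\<forall>x\<in>K. R x (f x) \<and> norm (f x - x - s *\<^sub>R (\<Sum>i\<in>J. k i x *\<^sub>R X i x)) \<le> e * s))"
  using assms(5,6,7)
proof (induction J arbitrary: e rule: finite_induct)
  case empty
  then show ?case
    using R_refl by (intro exI[of _ 1]) (auto intro!: exI[of _ "\<lambda>x. x"])
next
  case (insert i J)
  then have iI: "i \<in> I" by simp
  interpret fl: local_flow Om "D i" "phi i" "X i" by (rule flow[OF iI])
  define e0 where "e0 = e"
  have e0: "e0 > 0" using insert.prems by (simp add: e0_def)
  obtain r where r: "r > 0" "(\<Union>x\<in>K. cball x r) \<subseteq> Om"
    using compact_subset_open_imp_cball_epsilon_subset[OF K(1) open_Om K(2)] by blast
  \<comment> \<open>A compact neighbourhood of \<open>K\<close> that contains the points after the earlier flows.\<close>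
  define K' where "K' = (\<lambda>(x, y). x + y) ` (K \<times> cball 0 r)"
  have K': "compact K'" unfolding K'_def
    by (intro compact_continuous_image compact_Times K compact_cball)
      (auto simp: case_prod_unfold intro!: continuous_intros)
  have inK': "y \<in> K'" if "x \<in> K" "norm (y - x) \<le> r" for x y
    unfolding K'_def using that by (intro image_eqI[of _ _ "(x, y - x)"]) auto
  have K'Om: "K' \<subseteq> Om"
    unfolding K'_def using r by (force simp: dist_norm)
  obtain M where M: "M > 0" "\<And>x. x \<in> K \<Longrightarrow> k i x \<le> M"
  proof -
    have "compact (k i ` K)"
      by (rule compact_continuous_image[OF continuous_on_subset[OF k(2)[OF iI] K(2)] K(1)])
    then have "bounded (k i ` K)" by (rule compact_imp_bounded)
    then obtain a where "\<forall>x\<in>K. norm (k i x) \<le> a" by (auto simp: bounded_iff)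
    then show ?thesis using that[of "\<bar>a\<bar> + 1"] by fastforce
  qed
  obtain B where B: "B \<ge> 0" "\<And>x. x \<in> K \<Longrightarrow> norm (\<Sum>i\<in>J. k i x *\<^sub>R X i x) \<le> B"
  proof -
    have "continuous_on Om (\<lambda>x. \<Sum>i\<in>J. k i x *\<^sub>R X i x)"
      using insert.prems by (intro continuous_intros k(2) smooth_on_continuous_on smooth_X) auto
    then have "compact ((\<lambda>x. \<Sum>i\<in>J. k i x *\<^sub>R X i x) ` K)"
      by (intro compact_continuous_image[OF continuous_on_subset[OF _ K(2)] K(1)])
    then have "bounded ((\<lambda>x. \<Sum>i\<in>J. k i x *\<^sub>R X i x) ` K)" by (rule compact_imp_bounded)
    then obtain a where "\<forall>x\<in>K. norm (\<Sum>i\<in>J. k i x *\<^sub>R X i x) \<le> a" by (auto simp: bounded_iff)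
    then show ?thesis using that[of "\<bar>a\<bar>"] by fastforce
  qed
  have e4: "e0 / 4 > 0" "e0 / (4 * M) > 0" using e0 M by auto
  obtain r2 where r2: "r2 > 0"
    "\<And>x y. x \<in> K' \<Longrightarrow> y \<in> K' \<Longrightarrow> dist y x < r2 \<Longrightarrow> dist (X i y) (X i x) < e0 / (4 * M)"
    using compact_uniformly_continuous[OF continuous_on_subset[OF smooth_on_continuous_on[OF fl.smooth_X] K'Om] K']
      e4(2) unfolding uniformly_continuous_on_def by metis
  obtain d where d: "d > 0" "\<And>t x. \<bar>t\<bar> \<le> d \<Longrightarrow> x \<in> K' \<Longrightarrow>
      (t, x) \<in> D i \<and> norm (phi i t x - x - t *\<^sub>R X i x) \<le> e0 / (4 * M) * \<bar>t\<bar>"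
    using fl.phi_first_order[OF K' K'Om e4(2)] by blast
  obtain s1 where s1: "s1 > 0" "\<And>s. 0 \<le> s \<Longrightarrow> s \<le> s1 \<Longrightarrow> (\<exists>f. continuous_on K f \<and>
      (\<forall>x\<in>K. R x (f x) \<and> norm (f x - x - s *\<^sub>R (\<Sum>i\<in>J. k i x *\<^sub>R X i x)) \<le> e0 / 4 * s))"
    using insert.IH[of "e0/4"] insert.prems e4 by auto
  \<comment> \<open>Keeps \<open>f x\<close> in \<open>K'\<close>, the variation of \<open>X i\<close> from \<open>x\<close> to \<open>f x\<close> below \<open>e0 / (4 * M)\<close>,
      and the flow times below \<open>d\<close>.\<close>
  define s0 where "s0 = min (min s1 (d / M)) (min (r / (B + e0)) (r2 / (2 * (B + e0))))"
  have Be: "B + e0 > 0" using B e0 by simp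
  have "\<exists>f. continuous_on K f \<and>
      (\<forall>x\<in>K. R x (f x) \<and> norm (f x - x - s *\<^sub>R (\<Sum>i\<in>insert i J. k i x *\<^sub>R X i x)) \<le> e * s)"
    if s: "0 \<le> s" "s \<le> s0" for s
  proof -
    have ss: "s \<le> s1" "s * M \<le> d" "s * (B + e0) \<le> r" "s * (B + e0) < r2"
      using s r2(1) Be M(1) by (auto simp: s0_def field_simps)
    obtain f where f: "continuous_on K f" "\<And>x. x \<in> K \<Longrightarrow> R x (f x)"
      "\<And>x. x \<in> K \<Longrightarrow> norm (f x - x - s *\<^sub>R (\<Sum>i\<in>J. k i x *\<^sub>R X i x)) \<le> e0 / 4 * s"
      using s1(2)[OF s(1) ss(1)] by blast
    have fx: "norm (f x - x) \<le> s * (B + e0)" if x: "x \<in> K" for x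
    proof -
      have "norm (f x - x) \<le> norm (f x - x - s *\<^sub>R (\<Sum>i\<in>J. k i x *\<^sub>R X i x)) + norm (s *\<^sub>R (\<Sum>i\<in>J. k i x *\<^sub>R X i x))"
        by (metis diff_add_cancel norm_triangle_ineq)
      also have "\<dots> \<le> e0 / 4 * s + s * B"
        using f(3)[OF x] B(2)[OF x] s by (intro add_mono) (auto intro: mult_left_mono)
      also have "\<dots> \<le> s * (B + e0)" using s e0 by (simp add: algebra_simps)
      finally show ?thesis .
    qed
    have fK: "f x \<in> K'" "x \<in> K'" "dist (f x) x < r2" if "x \<in> K" for x
      using inK'[OF that] fx[OF that] ss r(1) by (auto simp: dist_norm)
    have t: "0 \<le> s * k i x" "s * k i x \<le> d" "s * k i x \<le> s * M" if "x \<in> K" for x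
    proof -
      show 1: "s * k i x \<le> s * M" using M(2)[OF that] s by (intro mult_left_mono) auto
      show "0 \<le> s * k i x" using k(1)[OF iI] that K(2) s by auto
      show "s * k i x \<le> d" using 1 ss(2) by linarith
    qed
    define g where "g x = phi i (s * k i x) (f x)" for x
    have gD: "(s * k i x, f x) \<in> D i"
      "norm (g x - f x - (s * k i x) *\<^sub>R X i (f x)) \<le> e0 / (4 * M) * (s * k i x)" if x: "x \<in> K" for x
      using d(2)[of "s * k i x" "f x"] t[OF x] fK(1)[OF x] by (auto simp: g_def)
    have "continuous_on K g"
    proof -
      have "continuous_on K (\<lambda>x. (\<lambda>(t, x). phi i t x) (s * k i x, f x))"
        by (rule continuous_on_compose2[OF smooth_on_continuous_on[OF fl.smooth_phi]])
          (use gD(1) in \<open>auto intro!: continuous_intros f(1) continuous_on_subset[OF k(2)[OF iI] K(2)]\<close>)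
      then show ?thesis by (simp add: g_def)
    qed
    moreover have "R x (g x)" if x: "x \<in> K" for x
      unfolding g_def using R_trans[OF f(2)[OF x] R_phi[OF iI gD(1)[OF x] t(1)[OF x]]] .
    moreover have "norm (g x - x - s *\<^sub>R (\<Sum>i\<in>insert i J. k i x *\<^sub>R X i x)) \<le> e * s" if x: "x \<in> K" for x
    proof -
      have eq: "g x - x - s *\<^sub>R (\<Sum>i\<in>insert i J. k i x *\<^sub>R X i x) =
         (g x - f x - (s * k i x) *\<^sub>R X i (f x)) + (f x - x - s *\<^sub>R (\<Sum>i\<in>J. k i x *\<^sub>R X i x))
         + (s * k i x) *\<^sub>R (X i (f x) - X i x)"
        using insert.hyps by (simp add: algebra_simps)
      have b: "e0 / (4 * M) * (s * k i x) \<le> e0 / 4 * s"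
      proof -
        have "e0 / (4 * M) * (s * k i x) \<le> e0 / (4 * M) * (s * M)"
          by (rule mult_left_mono[OF t(3)[OF x] less_imp_le[OF e4(2)]])
        then show ?thesis using M(1) by simp
      qed
      have n: "norm (X i (f x) - X i x) \<le> e0 / (4 * M)"
        using r2(2)[OF fK(2,1)[OF x] fK(3)[OF x]] by (simp add: dist_norm)
      have "norm ((s * k i x) *\<^sub>R (X i (f x) - X i x)) = (s * k i x) * norm (X i (f x) - X i x)"
        using t(1)[OF x] by (metis abs_of_nonneg norm_scaleR)
      also have "\<dots> \<le> (s * k i x) * (e0 / (4 * M))"
        by (rule mult_left_mono[OF n t(1)[OF x]])
      also have "\<dots> = e0 / (4 * M) * (s * k i x)" by (rule mult.commute)
      also note b
      finally have "norm ((s * k i x) *\<^sub>R (X i (f x) - X i x)) \<le> e0 / 4 * s" .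
      then have "norm (g x - x - s *\<^sub>R (\<Sum>i\<in>insert i J. k i x *\<^sub>R X i x)) \<le> e0 / 4 * s + e0 / 4 * s + e0 / 4 * s"
        unfolding eq using order_trans[OF gD(2)[OF x] b] f(3)[OF x]
        by (intro norm_triangle_le add_mono)
      also have "\<dots> \<le> e * s" using s e0 by (simp add: e0_def)
      finally show ?thesis .
    qed
    ultimately show ?thesis by blast
  qed
  moreover have "s0 > 0" using s1(1) d(1) M(1) r(1) r2(1) Be by (simp add: s0_def)
  ultimately show ?case by blast
qed

text \<open>\<open>f\<close> is near \<open>z\<close> a uniform limit of maps that move each point to a point reachable from it. The
  maps are required to be continuous, although they need not come from a single control.\<close>

definition approx_realizable :: "('e \<Rightarrow> 'e) \<Rightarrow> 'e \<Rightarrow> bool" where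
  "approx_realizable f z \<longleftrightarrow> (\<exists>W. open W \<and> z \<in> W \<and> continuous_on W f \<and>
     (\<forall>e>0. \<exists>H. continuous_on W H \<and> (\<forall>x\<in>W. R x (H x) \<and> norm (H x - f x) < e)))"

lemma approx_realizable_id: "approx_realizable (\<lambda>x. x) z"
  unfolding approx_realizable_def using R_refl
  by (intro exI[of _ UNIV]) (auto intro!: exI[of _ "\<lambda>x. x"])

lemma approx_realizable_compose:
  assumes "approx_realizable f z" "approx_realizable g (f z)"
  shows "approx_realizable (\<lambda>x. g (f x)) z"
proof -
  obtain W where W: "open W" "z \<in> W" "continuous_on W f"
    "\<And>e. e > 0 \<Longrightarrow> \<exists>H. continuous_on W H \<and> (\<forall>x\<in>W. R x (H x) \<and> norm (H x - f x) < e)"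
    using assms(1) unfolding approx_realizable_def by blast
  obtain W' where W': "open W'" "f z \<in> W'" "continuous_on W' g"
    "\<And>e. e > 0 \<Longrightarrow> \<exists>H. continuous_on W' H \<and> (\<forall>x\<in>W'. R x (H x) \<and> norm (H x - g x) < e)"
    using assms(2) unfolding approx_realizable_def by blast
  obtain r where r: "r > 0" "cball (f z) r \<subseteq> W'" using W' open_contains_cball by blast
  define V where "V = W \<inter> f -` ball (f z) (r/2)"
  have V: "open V" "z \<in> V" "V \<subseteq> W"
    using continuous_on_open_vimage[OF W(1)] W r by (auto simp: V_def Int_commute)
  have uc: "uniformly_continuous_on (cball (f z) r) g"
    by (rule compact_uniformly_continuous[OF continuous_on_subset[OF W'(3) r(2)] compact_cball])
  have "\<exists>H. continuous_on V H \<and> (\<forall>x\<in>V. R x (H x) \<and> norm (H x - g (f x)) < e)" if e: "e > 0" for e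
  proof -
    obtain d where d: "d > 0" "\<And>x y. x \<in> cball (f z) r \<Longrightarrow> y \<in> cball (f z) r \<Longrightarrow> dist y x < d \<Longrightarrow> dist (g y) (g x) < e/2"
      using uc half_gt_zero[OF e] unfolding uniformly_continuous_on_def by metis
    obtain H where H: "continuous_on W H" "\<And>x. x \<in> W \<Longrightarrow> R x (H x) \<and> norm (H x - f x) < min d (r/2)"
      using W(4)[of "min d (r/2)"] d r by auto
    obtain H' where H': "continuous_on W' H'" "\<And>x. x \<in> W' \<Longrightarrow> R x (H' x) \<and> norm (H' x - g x) < e/2"
      using W'(4)[of "e/2"] e by auto
    have b: "f x \<in> cball (f z) r" "H x \<in> cball (f z) r" "dist (H x) (f x) < d" if x: "x \<in> V" for x
    proof -
      have 1: "dist (f z) (f x) < r/2" "dist (H x) (f x) < min d (r/2)"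
        using x H(2)[of x] V by (auto simp: V_def dist_norm)
      then show "f x \<in> cball (f z) r" "dist (H x) (f x) < d" using r by auto
      have "dist (f z) (H x) \<le> dist (f z) (f x) + dist (H x) (f x)" by (rule dist_triangle2)
      then show "H x \<in> cball (f z) r" using 1 by simp
    qed
    have "norm (H' (H x) - g (f x)) < e" if x: "x \<in> V" for x
    proof -
      have "dist (H' (H x)) (g (f x)) \<le> dist (H' (H x)) (g (H x)) + dist (g (H x)) (g (f x))"
        by (rule dist_triangle)
      also have "\<dots> < e/2 + e/2"
        using d(2)[OF b[OF x]] H'(2)[of "H x"] b(2)[OF x] r(2) by (intro add_strict_mono) (auto simp: dist_norm)
      finally show ?thesis by (simp add: dist_norm)
    qed
    moreover have "R x (H' (H x))" if "x \<in> V" for x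
      using R_trans H(2) H'(2) b(2)[OF that] r(2) V(3) that by blast
    moreover have "continuous_on V (\<lambda>x. H' (H x))"
      by (rule continuous_on_compose2[OF H'(1) continuous_on_subset[OF H(1) V(3)]]) (use b r in auto)
    ultimately show ?thesis by (intro exI[of _ "\<lambda>x. H' (H x)"]) blast
  qed
  moreover have "continuous_on V (\<lambda>x. g (f x))"
    by (rule continuous_on_compose2[OF W'(3) continuous_on_subset[OF W(3) V(3)]]) (use r in \<open>auto simp: V_def\<close>)
  ultimately show ?thesis unfolding approx_realizable_def using V by blast
qed

text \<open>The backward flow is approximated by \<open>N\<close> steps along \<open>- X u\<close> of length \<open>s = t / N\<close>. To avoid
  error growth, the point reached after \<open>k\<close> steps is carried back to time \<open>0\<close> by the exact flow
  for the time \<open>k * s\<close>, and the distance of the result from the starting point \<open>x\<close> is estimated: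
  each step changes it by at most the Lipschitz constant \<open>C\<close> of the flow times the error
  \<open>n * s\<close> of one step, so that the total is at most \<open>C * n * t\<close>.\<close>

lemma approx_realizable_backward:
  assumes u: "u \<in> F" and z: "z \<in> Om"
  shows "\<exists>d>0. \<exists>W. open W \<and> z \<in> W \<and>
    (\<forall>t x. 0 \<le> t \<and> t \<le> d \<and> x \<in> W \<longrightarrow> (- t, x) \<in> D u \<and> approx_realizable (phi u (- t)) x)"
proof -
  have uI: "u \<in> I" using u F_I by blast
  interpret fl: local_flow Om "D u" "phi u" "X u" by (rule flow[OF uI])
  obtain r d1 C where r: "r > 0" "cball z r \<subseteq> Om" and d1: "d1 > 0" and C: "C > 0"
    and Lip: "\<And>t x y. \<bar>t\<bar> \<le> d1 \<Longrightarrow> x \<in> cball z r \<Longrightarrow> y \<in> cball z r \<Longrightarrow>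
       norm (phi u t x - phi u t y) \<le> C * norm (x - y)"
    using fl.phi_Lipschitz[OF z] by blast
  have r4: "r / 4 > 0" using r by simp
  obtain d2 where d2: "d2 > 0"
    and near: "\<And>t x. \<bar>t\<bar> \<le> d2 \<Longrightarrow> x \<in> cball z r \<Longrightarrow> (t, x) \<in> D u \<and> dist (phi u t x) x < r / 4"
    using fl.phi_near[OF compact_cball r(2) r4] by blast
  define d where "d = min d1 d2"
  define W where "W = ball z (r/4)"
  have W: "open W" "z \<in> W" "W \<subseteq> cball z r" using r by (auto simp: W_def)
  have main: "\<exists>H. continuous_on W H \<and> (\<forall>x\<in>W. R x (H x) \<and> norm (H x - phi u (- t) x) < e)"
    if t: "0 \<le> t" "t \<le> d" and e: "e > 0" for t e
  proof -
    have td: "t \<le> d1" "t \<le> d2" using t by (auto simp: d_def)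
    \<comment> \<open>The bound \<open>n\<close> for the relative error of a step makes \<open>C * n * t\<close> smaller than \<open>m\<close>, which
        keeps all points inside \<open>cball z r\<close> and the final error below \<open>e / 2\<close>.\<close>
    define m where "m = min (r/4) (e / (2 * C))"
    define n where "n = m / ((C + 1) * (t + 1))"
    have m: "m > 0" "m \<le> r/4" "m \<le> e / (2 * C)" using r e C by (auto simp: m_def)
    have n: "n > 0" using m C t by (simp add: n_def)
    have nt: "n * t \<le> m" "C * n * t \<le> m"
    proof -
      have "n * ((C + 1) * (t + 1)) = m" using C t by (simp add: n_def)
      moreover have "t \<le> (C + 1) * (t + 1)" "C * t \<le> (C + 1) * (t + 1)"
        using C t by (auto simp: algebra_simps add_nonneg_nonneg)
      ultimately show "n * t \<le> m" "C * n * t \<le> m"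
        using mult_left_mono[of t "(C + 1) * (t + 1)" n] mult_left_mono[of "C * t" "(C + 1) * (t + 1)" n] n
        by (auto simp: algebra_simps)
    qed
    have n2: "n / 2 > 0" using n by simp
    obtain s0 where s0: "s0 > 0" "\<And>s. 0 \<le> s \<Longrightarrow> s \<le> s0 \<Longrightarrow> \<exists>f. continuous_on (cball z r) f \<and>
      (\<forall>x\<in>cball z r. R x (f x) \<and> norm (f x - x - s *\<^sub>R (\<Sum>i\<in>I. c u i x *\<^sub>R X i x)) \<le> n / 2 * s)"
      using positive_combination_step[of "c u", OF c_nonneg[OF u] c_continuous[OF u] compact_cball r(2) finite_I subset_refl n2]
      by blast
    obtain d3 where d3: "d3 > 0" "\<And>t x. \<bar>t\<bar> \<le> d3 \<Longrightarrow> x \<in> cball z r \<Longrightarrow>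
       norm (phi u t x - x - t *\<^sub>R X u x) \<le> n / 2 * \<bar>t\<bar>"
      using fl.phi_first_order[OF compact_cball r(2) n2] by blast
    obtain N where N: "t / min s0 d3 < real N" using reals_Archimedean2 by blast
    have N0: "real N > 0" using N t s0 d3 by (smt (verit) divide_nonneg_pos)
    define s where "s = t / real N"
    have s: "0 \<le> s" "s \<le> s0" "s \<le> d3" "real N * s = t" "s \<le> t"
    proof -
      define \<mu> where "\<mu> = min s0 d3"
      have "\<mu> > 0" "t / \<mu> < real N" using N s0 d3 by (auto simp: \<mu>_def)
      then have "s < \<mu>" using N0 by (simp add: s_def field_simps)
      then show "s \<le> s0" "s \<le> d3" by (auto simp: \<mu>_def)
      show "0 \<le> s" "real N * s = t" using N0 t by (auto simp: s_def)
      show "s \<le> t" using N0 t by (simp add: s_def field_simps mult_le_cancel_left1)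
    qed
    obtain g where g: "continuous_on (cball z r) g" "\<And>x. x \<in> cball z r \<Longrightarrow> R x (g x)"
      "\<And>x. x \<in> cball z r \<Longrightarrow> norm (g x - x - s *\<^sub>R (\<Sum>i\<in>I. c u i x *\<^sub>R X i x)) \<le> n / 2 * s"
      using s0(2)[OF s(1,2)] by blast
    have gp: "norm (g x - phi u (- s) x) \<le> n * s" if x: "x \<in> cball z r" for x
    proof -
      have rv: "(\<Sum>i\<in>I. c u i x *\<^sub>R X i x) = - X u x" using reverse[OF u] x r(2) by blast
      have "norm ((g x - x - s *\<^sub>R (\<Sum>i\<in>I. c u i x *\<^sub>R X i x)) - (phi u (- s) x - x - (- s) *\<^sub>R X u x))
        \<le> n / 2 * s + n / 2 * s"
        by (rule order_trans[OF norm_triangle_ineq4 add_mono[OF g(3)[OF x]]])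
          (use d3(2)[of "- s" x] x s in auto)
      then show ?thesis by (simp add: rv)
    qed
    have step: "\<exists>f. continuous_on W f \<and> (\<forall>x\<in>W. R x (f x) \<and> f x \<in> cball z r \<and> (real k * s, f x) \<in> D u
        \<and> norm (phi u (real k * s) (f x) - x) \<le> C * n * (real k * s))" if "k \<le> N" for k
      using that
    proof (induction k)
      case 0
      show ?case
        using W(3) r(2) R_refl fl.D_0 fl.phi_0
        by (intro exI[of _ "\<lambda>x. x"]) (auto simp: subset_eq)
    next
      case (Suc k)
      then obtain f where f: "continuous_on W f" "\<And>x. x \<in> W \<Longrightarrow> R x (f x)" "\<And>x. x \<in> W \<Longrightarrow> f x \<in> cball z r"
        "\<And>x. x \<in> W \<Longrightarrow> (real k * s, f x) \<in> D u"
        "\<And>x. x \<in> W \<Longrightarrow> norm (phi u (real k * s) (f x) - x) \<le> C * n * (real k * s)" by auto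
      have ks: "0 \<le> real k * s" "real k * s \<le> t" "real (Suc k) * s \<le> t" "0 \<le> real (Suc k) * s"
        using s Suc.prems mult_right_mono[of "real k" "real N" s] mult_right_mono[of "real (Suc k)" "real N" s]
        by auto
      have P: "R x (g (f x)) \<and> g (f x) \<in> cball z r \<and> (real (Suc k) * s, g (f x)) \<in> D u
        \<and> norm (phi u (real (Suc k) * s) (g (f x)) - x) \<le> C * n * (real (Suc k) * s)" if x: "x \<in> W" for x
      proof -
        define y where "y = f x"
        \<comment> \<open>\<open>y\<close> is the point after \<open>k\<close> steps, \<open>b\<close> its carried-back position near \<open>x\<close>, and \<open>p\<close> the
            exact position to which the next step \<open>g y\<close> is compared.\<close>
        define b where "b = phi u (real k * s) y"
        define p where "p = phi u (- s) y"
        have y: "y \<in> cball z r" "(real k * s, y) \<in> D u" using f(3,4)[OF x] by (auto simp: y_def)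
        have bx: "norm (b - x) \<le> C * n * (real k * s)" using f(5)[OF x] by (simp add: b_def y_def)
        also have "\<dots> \<le> C * n * t" using ks C n by (intro mult_left_mono) auto
        finally have "norm (b - x) \<le> r/4" using nt m by linarith
        moreover have "norm (x - z) < r/4" using x by (simp add: W_def dist_norm norm_minus_commute)
        ultimately have bz: "norm (b - z) < r/2" using norm_triangle_ineq[of "b - x" "x - z"] by simp
        have bK: "b \<in> cball z r" using bz r by (simp add: dist_norm norm_minus_commute)
        have bD: "(- (real k * s), b) \<in> D u" "phi u (- (real k * s)) b = y"
          using fl.D_uminus[OF y(2)] fl.phi_uminus[OF y(2)] by (auto simp: b_def)
        have sD: "(- s, y) \<in> D u" using near[of "- s" y] y(1) s td by auto
        have sum: "- (real k * s) + - s = - (real (Suc k) * s)" by (simp add: algebra_simps)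
        have p1: "(- (real (Suc k) * s), b) \<in> D u" "p = phi u (- (real (Suc k) * s)) b"
          using fl.D_add[OF bD(1), of "- s"] fl.phi_add[OF bD(1), of "- s"] sD
          unfolding bD(2) sum p_def by auto
        have "dist p b < r/4"
          unfolding p1(2) using near[of "- (real (Suc k) * s)" b] bK ks td by auto
        then have pz: "norm (p - z) < 3 * r / 4"
          using norm_triangle_ineq[of "p - b" "b - z"] bz by (simp add: dist_norm)
        then have pK: "p \<in> cball z r" using r by (simp add: dist_norm norm_minus_commute)
        have pb: "phi u (real (Suc k) * s) p = b"
          using fl.phi_uminus[OF p1(1)] unfolding p1(2) by simp
        have gy: "norm (g y - p) \<le> n * s" using gp[OF y(1)] by (simp add: p_def)
        have "n * s \<le> n * t" using n s by (intro mult_left_mono) auto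
        then have "norm (g y - p) \<le> r/4" using gy nt m by linarith
        then have "norm (g y - z) < r" using norm_triangle_ineq[of "g y - p" "p - z"] pz by simp
        then have gK: "g y \<in> cball z r" by (simp add: dist_norm norm_minus_commute)
        have gD: "(real (Suc k) * s, g y) \<in> D u" using near[of "real (Suc k) * s" "g y"] gK ks td by auto
        have "norm (phi u (real (Suc k) * s) (g y) - b) \<le> C * norm (g y - p)"
          using Lip[of "real (Suc k) * s" "g y" p] gK pK ks td unfolding pb by auto
        also have "\<dots> \<le> C * (n * s)" using gy C by (intro mult_left_mono) auto
        finally have "norm (phi u (real (Suc k) * s) (g y) - x) \<le> C * (n * s) + C * n * (real k * s)"
          using norm_triangle_ineq[of "phi u (real (Suc k) * s) (g y) - b" "b - x"] bx by simp
        also have "\<dots> = C * n * (real (Suc k) * s)" by (simp add: algebra_simps)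
        finally show ?thesis using gK gD R_trans[OF f(2)[OF x] g(2)[OF f(3)[OF x]]] by (simp add: y_def)
      qed
      moreover have "continuous_on W (\<lambda>x. g (f x))"
        by (rule continuous_on_compose2[OF g(1) f(1)]) (use f(3) in auto)
      ultimately show ?case by (intro exI[of _ "\<lambda>x. g (f x)"]) blast
    qed
    obtain H where H: "continuous_on W H" "\<And>x. x \<in> W \<Longrightarrow> R x (H x)" "\<And>x. x \<in> W \<Longrightarrow> H x \<in> cball z r"
        "\<And>x. x \<in> W \<Longrightarrow> (t, H x) \<in> D u" "\<And>x. x \<in> W \<Longrightarrow> norm (phi u t (H x) - x) \<le> C * n * t"
      using step[OF order_refl] unfolding s(4) by blast
    have "norm (H x - phi u (- t) x) < e" if x: "x \<in> W" for x
    proof -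
      define b where "b = phi u t (H x)"
      have Hb: "H x = phi u (- t) b" using fl.phi_uminus[OF H(4)[OF x]] by (simp add: b_def)
      have bx: "norm (b - x) \<le> m" using H(5)[OF x] nt by (simp add: b_def)
      moreover have "norm (x - z) < r/4" using x by (simp add: W_def dist_norm norm_minus_commute)
      ultimately have "norm (b - z) < r" using norm_triangle_ineq[of "b - x" "x - z"] m r by simp
      then have "b \<in> cball z r" by (simp add: dist_norm norm_minus_commute)
      then have "norm (phi u (- t) b - phi u (- t) x) \<le> C * norm (b - x)"
        using Lip[of "- t" b x] x W(3) td t by auto
      also have "\<dots> \<le> C * (e / (2 * C))" using bx m C by (intro mult_left_mono) auto
      also have "\<dots> < e" using C e by simp
      finally show ?thesis by (simp add: Hb)
    qed
    then show ?thesis using H(1,2) by blast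
  qed
  show ?thesis
  proof (intro exI conjI allI impI)
    show "d > 0" using d1 d2 by (simp add: d_def)
    show "open W" "z \<in> W" using W by auto
    fix t x assume tx: "0 \<le> t \<and> t \<le> d \<and> x \<in> W"
    have D': "(- t, x) \<in> D u" if "x \<in> W" for x using near[of "- t" x] that tx W(3) by (auto simp: d_def)
    then show "(- t, x) \<in> D u" using tx by blast
    have "continuous_on W (phi u (- t))"
      using fl.phi_has_derivative_x[OF D', THEN has_derivative_continuous]
      by (intro continuous_at_imp_continuous_on) auto
    then show "approx_realizable (phi u (- t)) x"
      unfolding approx_realizable_def using tx W(1) main[of t] by blast
  qed
qed

text \<open>The state of the construction of a family \<open>G (v, x)\<close> of points reachable from \<open>x\<close>, with a
  parameter \<open>v\<close> that perturbs the switching times: \<open>y\<close> is the endpoint for the start \<open>q\<close> and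
  \<open>v = 0\<close>, and \<open>A\<close> the derivative of the endpoint in \<open>v\<close>. The approximately realizable map \<open>P\<close>
  leads back from \<open>y\<close> to \<open>q\<close>. The parameter space is the model space itself, so that full rank
  means that \<open>A\<close> is injective.\<close>

definition return_state :: "'e \<Rightarrow> 'e \<Rightarrow> ('e \<Rightarrow> 'e) \<Rightarrow> bool" where
  "return_state q y A \<longleftrightarrow> linear A \<and> (\<exists>G P P' W. open W \<and> (0, q) \<in> W \<and> continuous_on W G \<and>
     (\<forall>(v, x)\<in>W. R x (G (v, x))) \<and> G (0, q) = y \<and> ((\<lambda>v. G (v, q)) has_derivative A) (at (0::'e)) \<and>
     approx_realizable P y \<and> P y = q \<and> (P has_derivative P') (at y) \<and> inj P')"

lemma return_state_init: "return_state q q (\<lambda>v. 0)"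
  unfolding return_state_def
proof (intro conjI exI)
  show "linear (\<lambda>v. 0 :: 'e)" by (simp add: linear_iff)
  show "((\<lambda>v. snd (v, q)) has_derivative (\<lambda>v. 0)) (at 0)" by simp
  show "approx_realizable (\<lambda>x. x) q" by (rule approx_realizable_id)
  show "((\<lambda>x. x) has_derivative (\<lambda>x. x)) (at q)" by (rule has_derivative_ident)
qed (auto intro!: R_refl continuous_intros open_UNIV)

text \<open>A further flow for the time \<open>t + e \<bullet> v\<close> keeps the way back, by the backward flow, and adds
  the control vector to the range of the derivative in the parameter direction \<open>e\<close>; here it is
  pulled back to \<open>y\<close>, using that the flow preserves \<open>X u\<close>. The time \<open>t\<close> must be positive to leave
  room for both signs of \<open>e \<bullet> v\<close>. For \<open>e = 0\<close> the point is moved without a new parameter.\<close>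

lemma return_state_step:
  assumes st: "return_state q y A" and u: "u \<in> F" and N: "open N" "y \<in> N" "N \<subseteq> Om"
  shows "\<exists>d>0. \<forall>t. 0 < t \<and> t < d \<longrightarrow> (t, y) \<in> D u \<and> phi u t y \<in> N \<and>
     return_state q (phi u t y) (\<lambda>v. local_flow.Dx (phi u) t y ((e \<bullet> v) *\<^sub>R X u y + A v))"
proof -
  have uI: "u \<in> I" using u F_I by blast
  interpret fl: local_flow Om "D u" "phi u" "X u" by (rule flow[OF uI])
  have yO: "y \<in> Om" using N by blast
  obtain G P P' W where linA: "linear A" and W: "open W" "(0, q) \<in> W" "continuous_on W G"
    "\<And>v x. (v, x) \<in> W \<Longrightarrow> R x (G (v, x))" and G: "G (0, q) = y" "((\<lambda>v. G (v, q)) has_derivative A) (at 0)"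
    and P: "approx_realizable P y" "P y = q" "(P has_derivative P') (at y)" "inj P'"
    using st unfolding return_state_def by blast
  obtain d1 W0 where d1: "d1 > 0" "open W0" "y \<in> W0"
     "\<And>t x. 0 \<le> t \<Longrightarrow> t \<le> d1 \<Longrightarrow> x \<in> W0 \<Longrightarrow> (- t, x) \<in> D u \<and> approx_realizable (phi u (- t)) x"
    using approx_realizable_backward[OF u yO] by blast
  obtain e0 where e0: "e0 > 0" "ball y e0 \<subseteq> W0 \<inter> N"
    using open_contains_ball[of "W0 \<inter> N"] d1 N by blast
  obtain d2 where d2: "d2 > 0" "\<And>t. \<bar>t\<bar> \<le> d2 \<Longrightarrow> (t, y) \<in> D u \<and> dist (phi u t y) y < e0"
    using fl.phi_near[of "{y}" e0] yO e0 by auto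
  show ?thesis
  proof (rule exI[of _ "min d1 d2"], intro conjI allI impI)
    show "0 < min d1 d2" using d1 d2 by simp
    fix t assume t: "0 < t \<and> t < min d1 d2"
    have tD: "(t, y) \<in> D u" and "phi u t y \<in> ball y e0"
      using d2(2)[of t] t by (auto simp: dist_commute)
    then have z: "phi u t y \<in> W0" "phi u t y \<in> N" using e0 by auto
    show "(t, y) \<in> D u" "phi u t y \<in> N" using tD z by auto
    let ?z = "phi u t y"
    have zb: "phi u (- t) ?z = y" using fl.phi_uminus[OF tD] .
    have zD: "(- t, ?z) \<in> D u" using fl.D_uminus[OF tD] .
    define h where "h w = (t + e \<bullet> fst w, G w)" for w :: "'e \<times> 'e"
    define W' where "W' = W \<inter> h -` (({0<..} \<times> UNIV) \<inter> D u)"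
    have "continuous_on W h" unfolding h_def by (intro continuous_intros W)
    then have oW': "open W'" unfolding W'_def
      using continuous_on_open_vimage[OF W(1), of h] fl.open_D
      by (metis Int_commute open_Int open_Times open_UNIV open_greaterThan)
    let ?G = "\<lambda>w. phi u (t + e \<bullet> fst w) (G w)"
    let ?A = "\<lambda>v. fl.Dx t y ((e \<bullet> v) *\<^sub>R X u y + A v)"
    have linD: "linear (fl.Dx t y)" using fl.linear_Dx[OF tD] .
    show "return_state q ?z ?A"
      unfolding return_state_def
    proof (intro conjI exI)
      show "linear ?A"
        using linear_compose[OF _ linD, of "\<lambda>v. (e \<bullet> v) *\<^sub>R X u y + A v"] linA
        by (simp add: linear_iff o_def algebra_simps)
      show "open W'" by (rule oW')
      show "(0, q) \<in> W'" using W G t tD by (simp add: W'_def h_def)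
      have "continuous_on W' (\<lambda>w. (\<lambda>(t, x). phi u t x) (h w))"
        by (rule continuous_on_compose2[OF smooth_on_continuous_on[OF fl.smooth_phi]
             continuous_on_subset[OF \<open>continuous_on W h\<close>]]) (auto simp: W'_def)
      then show "continuous_on W' ?G" by (simp add: h_def)
      show "\<forall>(v, x)\<in>W'. R x (?G (v, x))"
        using R_trans[OF W(4) R_phi[OF uI]] by (auto simp: W'_def h_def)
      show "?G (0, q) = ?z" using G by simp
      have "((\<lambda>v. phi u (t + e \<bullet> v) (G (v, q))) has_derivative
         (\<lambda>w. (e \<bullet> w) *\<^sub>R X u (phi u (t + e \<bullet> 0) (G (0, q))) + fl.Dx (t + e \<bullet> 0) (G (0, q)) (A w))) (at 0)"
        by (rule fl.has_derivative_phi_compose[OF _ G(2)])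
          (use tD G in \<open>auto intro!: derivative_eq_intros\<close>)
      then show "((\<lambda>v. ?G (v, q)) has_derivative ?A) (at 0)"
        using fl.Dx_X[OF tD] G(1) by (simp add: linear_add[OF linD] linear_scale[OF linD])
      show "approx_realizable (\<lambda>x. P (phi u (- t) x)) ?z"
        by (rule approx_realizable_compose) (use d1(4)[of t ?z] t z P(1) zb in auto)
      show "P (phi u (- t) ?z) = q" using zb P(2) by simp
      show "((\<lambda>x. P (phi u (- t) x)) has_derivative (\<lambda>v. P' (fl.Dx (- t) ?z v))) (at ?z)"
        using has_derivative_compose[OF fl.phi_has_derivative_x[OF zD], of P P'] P(3) zb by simp
      show "inj (\<lambda>v. P' (fl.Dx (- t) ?z v))"
        using inj_compose[OF P(4) fl.inj_Dx[OF zD]] by (simp add: o_def)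
    qed
  qed
qed

text \<open>Suppose spaces \<open>T\<close> are attached to points, contain the control vectors and are moved forward by
  the flows. If a field \<open>Z\<close> takes values in all of them, so does its pullback along the flow of
  \<open>X u\<close>, and the derivative of the pullback at time \<open>0\<close>, which is the bracket of \<open>X u\<close> and \<open>Z\<close>.
  For brackets of arbitrary elements of the Lie algebra, the property is strengthened: bracketing
  with the element preserves the fields with values in the spaces. By the Jacobi identity, this
  property is stable under brackets.\<close>

lemma lie_closure_in_tangent_family:
  fixes S :: "('e \<times> 'e set) set"
  assumes sub: "\<And>y T. (y, T) \<in> S \<Longrightarrow> y \<in> Om \<and> subspace T"
    and X_in: "\<And>y T u. (y, T) \<in> S \<Longrightarrow> u \<in> F \<Longrightarrow> X u y \<in> T"
    and inv: "\<And>y T u. (y, T) \<in> S \<Longrightarrow> u \<in> F \<Longrightarrow>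
       \<exists>d>0. \<forall>t. 0 < t \<and> t < d \<longrightarrow> (t, y) \<in> D u \<and> (phi u t y, local_flow.Dx (phi u) t y ` T) \<in> S"
    and Z: "Z \<in> lie_closure Om (X ` F)" and yT: "(y, T) \<in> S"
  shows "Z y \<in> T"
proof -
  define good where "good Z \<longleftrightarrow> smooth_on Om Z \<and> (\<forall>(y, T)\<in>S. Z y \<in> T)" for Z
  have good_lin: "good Z" if "good Y1" "good Y2" "\<And>x. x \<in> Om \<Longrightarrow> Z x = a *\<^sub>R Y1 x + b *\<^sub>R Y2 x"
    for Z Y1 Y2 a b
  proof -
    have "smooth_on Om Z"
      by (rule smooth_on_linear_combination[OF open_Om _ _ that(3)]) (use that in \<open>auto simp: good_def\<close>)
    moreover have "Z y \<in> T" if "(y, T) \<in> S" for y T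
    proof -
      have "Y1 y \<in> T" "Y2 y \<in> T" using \<open>good Y1\<close> \<open>good Y2\<close> that by (auto simp: good_def)
      then show ?thesis
        using sub[OF that] \<open>\<And>x. x \<in> Om \<Longrightarrow> Z x = a *\<^sub>R Y1 x + b *\<^sub>R Y2 x\<close>
        by (simp add: subspace_add subspace_scale)
    qed
    ultimately show ?thesis by (auto simp: good_def)
  qed
  have good_X: "good (X u)" if "u \<in> F" for u
    using that X_in smooth_X F_I by (auto simp: good_def)
  have good_bracket_X: "good (vf_bracket (X u) Y)" if u: "u \<in> F" and Y: "good Y" for u Y
  proof -
    have uI: "u \<in> I" using u F_I by blast
    interpret fl: local_flow Om "D u" "phi u" "X u" by (rule flow[OF uI])
    have Ys: "smooth_on Om Y" using Y by (simp add: good_def)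
    have "vf_bracket (X u) Y y \<in> T" if yT: "(y, T) \<in> S" for y T
    proof -
      have y: "y \<in> Om" and T: "subspace T" using sub yT by auto
      obtain d where d: "d > 0" "\<And>t. 0 < t \<Longrightarrow> t < d \<Longrightarrow> (t, y) \<in> D u \<and> (phi u t y, fl.Dx t y ` T) \<in> S"
        using inv[OF yT u] by blast
      show ?thesis
        unfolding vf_bracket_def
      proof (rule has_vector_derivative_in_subspace[OF T fl.pullback_has_vector_derivative[OF y Ys] d(1)])
        fix t assume t: "0 < t" "t < d"
        then obtain s where s: "s \<in> T" "Y (phi u t y) = fl.Dx t y s"
          using d(2)[OF t] Y unfolding good_def by blast
        then show "fl.Dx (- t) (phi u t y) (Y (phi u t y)) \<in> T"
          using fl.Dx_uminus d(2)[OF t] by simp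
      next
        show "fl.Dx (- 0) (phi u 0 y) (Y (phi u 0 y)) \<in> T"
          using fl.Dx_0[OF y] fl.phi_0[OF y] Y yT by (auto simp: good_def)
      qed
    qed
    then show ?thesis
      using smooth_on_vf_bracket[OF open_Om fl.smooth_X Ys] by (auto simp: good_def)
  qed
  have "good Z \<and> (\<forall>Y. good Y \<longrightarrow> good (vf_bracket Z Y))" using Z
  proof (induction rule: lie_closure.induct)
    case (gen Z)
    then show ?case using good_X good_bracket_X by blast
  next
    case (zero Z)
    have z: "good (\<lambda>x. 0)" using sub subspace_0 by (auto simp: good_def smooth_on_const)
    have "vf_bracket Z Y x = 0" if "x \<in> Om" "good Y" for x Y
    proof -
      have "vf_bracket Z Y x = vf_bracket (\<lambda>x. 0) Y x"
        by (rule vf_bracket_cong[OF open_Om that(1)]) (use zero in auto)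
      also have "\<dots> = 0"
        using that smooth_on_linear_frechet_derivative[OF _ that(1), of Y]
        by (simp add: vf_bracket_def good_def linear_0)
      finally show ?thesis .
    qed
    then show ?case using good_lin[OF z z, of _ 0 0] zero by auto
  next
    case (lin Y1 Y2 Z a b)
    have "good Z" using good_lin[of Y1 Y2 Z a b] lin by blast
    moreover have "good (vf_bracket Z Y)" if Y: "good Y" for Y
    proof (rule good_lin[of "vf_bracket Y1 Y" "vf_bracket Y2 Y" _ a b])
      fix x assume x: "x \<in> Om"
      have "smooth_on Om Y1" "smooth_on Om Y2" "smooth_on Om Y" using lin Y by (auto simp: good_def)
      note fd = frechet_derivative_linear_combination[OF open_Om this(1,2) x lin(3)]
        and L = smooth_on_linear_frechet_derivative[OF this(3) x]
      show "vf_bracket Z Y x = a *\<^sub>R vf_bracket Y1 Y x + b *\<^sub>R vf_bracket Y2 Y x"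
        using lin(3)[OF x] by (simp add: vf_bracket_def fd linear_add[OF L] linear_scale[OF L] algebra_simps)
    qed (use lin Y in auto)
    ultimately show ?case by blast
  next
    case (bracket Y1 Y2 Z)
    have "good (vf_bracket Y1 Y2)" using bracket by blast
    then have "good Z" using good_lin[of "vf_bracket Y1 Y2" "vf_bracket Y1 Y2" Z 1 0] bracket(3) by simp
    moreover have "good (vf_bracket Z Y)" if Y: "good Y" for Y
    proof (rule good_lin[of "vf_bracket Y1 (vf_bracket Y2 Y)" "vf_bracket Y2 (vf_bracket Y1 Y)" _ 1 "-1"])
      fix x assume x: "x \<in> Om"
      have "smooth_on Om Y1" "smooth_on Om Y2" "smooth_on Om Y" using bracket Y by (auto simp: good_def)
      note J = vf_bracket_Jacobi[OF open_Om this x]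
      have "vf_bracket Z Y x = vf_bracket (vf_bracket Y1 Y2) Y x"
        by (rule vf_bracket_cong[OF open_Om x]) (use bracket(3) in auto)
      then show "vf_bracket Z Y x = 1 *\<^sub>R vf_bracket Y1 (vf_bracket Y2 Y) x + (-1) *\<^sub>R vf_bracket Y2 (vf_bracket Y1 Y) x"
        using J by simp
    qed (use bracket Y in auto)
    ultimately show ?case by blast
  qed
  then show ?thesis using yT by (auto simp: good_def)
qed

end

lemma eventually_nhds_continuous_on:
  assumes "continuous_on S f" "open S" "q \<in> S" "open T" "f q \<in> T"
  shows "eventually (\<lambda>x. f x \<in> T) (nhds q)"
proof -
  have "open (S \<inter> f -` T)" "q \<in> S \<inter> f -` T"
    using assms continuous_on_open_vimage[OF assms(2)] by (auto simp: Int_commute)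
  then show ?thesis unfolding eventually_nhds by blast
qed

text \<open>Consequently a small perturbation of the standard basis is again a basis.\<close>

lemma near_Basis_lower_bound:
  fixes Z :: "'e::euclidean_space \<Rightarrow> 'e"
  assumes "\<And>b. b \<in> Basis \<Longrightarrow> norm (Z b - b) < 1 / (2 * DIM('e))"
  shows "norm v / 2 \<le> norm (\<Sum>b\<in>Basis. (v \<bullet> b) *\<^sub>R Z b)"
proof -
  have "norm ((\<Sum>b\<in>Basis. (v \<bullet> b) *\<^sub>R Z b) - v) = norm (\<Sum>b\<in>Basis. (v \<bullet> b) *\<^sub>R (Z b - b))"
    by (subst (2) euclidean_representation[of v, symmetric]) (simp add: sum_subtractf scaleR_diff_right)
  also have "\<dots> \<le> (\<Sum>b\<in>(Basis::'e set). norm v * (1 / (2 * DIM('e))))"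
  proof (rule sum_norm_le)
    fix b :: 'e assume b: "b \<in> Basis"
    show "norm ((v \<bullet> b) *\<^sub>R (Z b - b)) \<le> norm v * (1 / (2 * DIM('e)))"
      using Basis_le_norm[OF b, of v] assms[OF b] unfolding norm_scaleR by (intro mult_mono) auto
  qed
  also have "\<dots> = norm v / 2" by simp
  finally show ?thesis
    using norm_triangle_sub[of v "\<Sum>b\<in>Basis. (v \<bullet> b) *\<^sub>R Z b"] by (simp add: norm_minus_commute)
qed

context control_family
begin

text \<open>Take a state whose derivative \<open>A\<close> has a kernel of the least possible dimension. No step can
  shrink the kernel further, so for every such state the range of \<open>A\<close> contains all control vectors
  \<open>X u y\<close>; steps with \<open>e = 0\<close> lead to states of the same kind. Hence the ranges contain the Lie
  algebra. If \<open>A\<close> were not injective, its range would be a proper subspace.\<close>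

lemma exists_full_rank_return_state:
  assumes q: "q \<in> Om" and LA: "\<And>v. \<exists>Z \<in> lie_closure Om (X ` F). Z q = v"
  shows "\<exists>y A. return_state q y A \<and> inj A"
proof -
  obtain Z where Z: "\<And>v. Z v \<in> lie_closure Om (X ` F)" "\<And>v. Z v q = v" using LA by metis
  have Zs: "smooth_on Om (Z v)" for v
    using lie_closure_smooth[OF open_Om _ Z(1)] smooth_X F_I by auto
  \<comment> \<open>All states stay in \<open>N\<close>, where the values of the fields \<open>Z b\<close> span the whole space.\<close>
  define N where "N = Om \<inter> (\<Inter>b\<in>Basis. Om \<inter> (\<lambda>y. norm (Z b y - b)) -` {..< 1 / (2 * DIM('e))})"
  have oN: "open (Om \<inter> (\<lambda>y. norm (Z b y - b)) -` {..< 1 / (2 * DIM('e))})" for b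
  proof -
    have "continuous_on Om (\<lambda>y. norm (Z b y - b))"
      by (intro continuous_intros smooth_on_continuous_on[OF Zs])
    then show ?thesis
      using continuous_on_open_vimage[OF open_Om] by (metis Int_commute open_lessThan)
  qed
  have "open N" unfolding N_def by (rule open_Int[OF open_Om open_INT[OF finite_Basis]]) (use oN in blast)
  then have N: "open N" "q \<in> N" "N \<subseteq> Om"
    using q Z(2) by (auto simp: N_def)
  define ker where "ker A = {v. A v = 0}" for A :: "'e \<Rightarrow> 'e"
  have subker: "subspace (ker A)" if "linear A" for A
    unfolding ker_def using that by (rule linear_subspace_kernel)
  have lin: "linear A" if "return_state q y A" for y A using that by (simp add: return_state_def)
  define Q where "Q k \<longleftrightarrow> (\<exists>y A. return_state q y A \<and> y \<in> N \<and> dim (ker A) = k)" for k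
  have "Q (dim (ker (\<lambda>v. 0)))" using return_state_init N(2) by (auto simp: Q_def)
  define k0 where "k0 = (LEAST k. Q k)"
  have Qk0: "Q k0" unfolding k0_def by (rule LeastI) fact
  then obtain y0 A0 where st0: "return_state q y0 A0" "y0 \<in> N" "dim (ker A0) = k0" by (auto simp: Q_def)
  \<comment> \<open>The spaces to which \<open>lie_closure_in_tangent_family\<close> applies.\<close>
  define S where "S = {(y, range A) | y A. return_state q y A \<and> y \<in> N \<and> dim (ker A) = k0}"
  have "inj A0"
  proof (rule ccontr)
    assume "\<not> inj A0"
    then obtain e0 where e0: "e0 \<noteq> 0" "A0 e0 = 0"
      using linear_injective_0[OF lin[OF st0(1)]] by blast
    have k0: "k0 > 0"
    proof (rule ccontr)
      assume "\<not> k0 > 0"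
      then have "ker A0 \<subseteq> {0}" using st0(3) by simp
      then show False using e0 by (auto simp: ker_def)
    qed
    have "Z v y0 \<in> range A0" for v
    proof (rule lie_closure_in_tangent_family[OF _ _ _ Z(1), of S])
      show "(y0, range A0) \<in> S" using st0 by (auto simp: S_def)
    next
      fix y T assume "(y, T) \<in> S"
      then show "y \<in> Om \<and> subspace T"
        using N(3) lin linear_subspace_image[OF _ subspace_UNIV] by (auto simp: S_def)
    next
      fix y T u assume "(y, T) \<in> S" and u: "u \<in> F"
      then obtain A where A: "return_state q y A" "y \<in> N" "dim (ker A) = k0" "T = range A"
        by (auto simp: S_def)
      have linA: "linear A" using lin A by blast
      show "X u y \<in> T"
      proof (rule ccontr)
        assume nX: "X u y \<notin> T"
        have "ker A \<noteq> {0}"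
        proof
          assume "ker A = {0}"
          then have "dim (ker A) = 0" by (simp only: dim_eq_0 subset_refl)
          then show False using A(3) k0 by linarith
        qed
        moreover have "0 \<in> ker A" using subspace_0[OF subker[OF linA]] .
        ultimately obtain e where e: "e \<in> ker A" "e \<noteq> 0" by blast
        obtain d where d: "d > 0" "\<And>t. 0 < t \<Longrightarrow> t < d \<Longrightarrow> (t, y) \<in> D u \<and> phi u t y \<in> N \<and>
           return_state q (phi u t y) (\<lambda>v. local_flow.Dx (phi u) t y ((e \<bullet> v) *\<^sub>R X u y + A v))"
          using return_state_step[OF A(1) u N(1) A(2) N(3), of e] by blast
        define t where "t = d / 2"
        have t: "0 < t" "t < d" using d by (auto simp: t_def)
        interpret fl: local_flow Om "D u" "phi u" "X u" using flow F_I u by blast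
        define B where "B v = fl.Dx t y ((e \<bullet> v) *\<^sub>R X u y + A v)" for v
        have tD: "(t, y) \<in> D u" and N': "phi u t y \<in> N" and stB: "return_state q (phi u t y) B"
          using d(2)[OF t] unfolding B_def by auto
        \<comment> \<open>The new kernel lies in the old one and is orthogonal to \<open>e\<close>, which belongs to the old one.\<close>
        have B0: "v \<in> ker A \<and> e \<bullet> v = 0" if "v \<in> ker B" for v
        proof -
          have "fl.Dx t y ((e \<bullet> v) *\<^sub>R X u y + A v) = fl.Dx t y 0"
            using that linear_0[OF fl.linear_Dx[OF tD]] by (simp add: ker_def B_def)
          then have z: "(e \<bullet> v) *\<^sub>R X u y + A v = 0" using injD[OF fl.inj_Dx[OF tD]] by blast
          have "e \<bullet> v = 0"
          proof (rule ccontr)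
            assume ne: "e \<bullet> v \<noteq> 0"
            have "X u y = (1 / (e \<bullet> v)) *\<^sub>R ((e \<bullet> v) *\<^sub>R X u y)" using ne by simp
            also have "(e \<bullet> v) *\<^sub>R X u y = - A v" using z by (simp add: eq_neg_iff_add_eq_0)
            also have "(1 / (e \<bullet> v)) *\<^sub>R (- A v) = A ((- (1 / (e \<bullet> v))) *\<^sub>R v)"
              using linA by (simp add: linear_scale linear_neg)
            finally show False using nX A(4) by blast
          qed
          then show ?thesis using z by (simp add: ker_def)
        qed
        have "ker B \<subset> ker A" using B0 e by fastforce
        then have "dim (ker B) < dim (ker A)"
          using dim_psubset span_eq_iff[THEN iffD2, OF subker] linA lin[OF stB] by metis
        moreover have "Q (dim (ker B))" using stB N' by (auto simp: Q_def)
        then have "k0 \<le> dim (ker B)" unfolding k0_def by (rule Least_le)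
        ultimately show False using A(3) by simp
      qed
    next
      fix y T u assume "(y, T) \<in> S" and u: "u \<in> F"
      then obtain A where A: "return_state q y A" "y \<in> N" "dim (ker A) = k0" "T = range A"
        by (auto simp: S_def)
      interpret fl: local_flow Om "D u" "phi u" "X u" using flow F_I u by blast
      obtain d where d: "d > 0" "\<And>t. 0 < t \<Longrightarrow> t < d \<Longrightarrow> (t, y) \<in> D u \<and> phi u t y \<in> N \<and>
           return_state q (phi u t y) (\<lambda>v. fl.Dx t y (A v))"
        using return_state_step[OF A(1) u N(1) A(2) N(3), of 0] by auto
      have "(phi u t y, fl.Dx t y ` T) \<in> S" if t: "0 < t" "t < d" for t
      proof -
        have tD: "(t, y) \<in> D u" using d(2)[OF t] by blast
        have "ker (\<lambda>v. fl.Dx t y (A v)) = ker A"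
          unfolding ker_def using linear_0[OF fl.linear_Dx[OF tD]] fl.inj_Dx[OF tD] by (metis injD)
        moreover have "fl.Dx t y ` T = range (\<lambda>v. fl.Dx t y (A v))" using A(4) by auto
        ultimately show ?thesis unfolding S_def using d(2)[OF t] A(3) by auto
      qed
      then show "\<exists>d>0. \<forall>t. 0 < t \<and> t < d \<longrightarrow> (t, y) \<in> D u \<and> (phi u t y, fl.Dx t y ` T) \<in> S"
        using d by blast
    qed
    then have sub: "(\<Sum>b\<in>Basis. (v \<bullet> b) *\<^sub>R Z b y0) \<in> range A0" for v
      using linear_subspace_image[OF lin[OF st0(1)] subspace_UNIV]
      by (intro subspace_sum subspace_scale) auto
    let ?T = "\<lambda>v. \<Sum>b\<in>Basis. (v \<bullet> b) *\<^sub>R Z b y0"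
    have nT: "norm v / 2 \<le> norm (?T v)" for v
      by (rule near_Basis_lower_bound) (use st0(2) in \<open>auto simp: N_def\<close>)
    have "v = 0" if "?T v = 0" for v
      using nT[of v] unfolding that by simp
    moreover have linT: "linear ?T"
      by (auto simp: linear_iff inner_add_left scaleR_add_left sum.distrib scaleR_right.sum)
    ultimately have "inj ?T" by (simp only: linear_injective_0[OF linT]) blast
    then have sT: "surj ?T" by (rule linear_injective_imp_surjective[OF linT _ refl])
    have "surj A0"
    proof (rule set_eqI, rule iffI)
      fix w
      obtain v where "w = ?T v" using surjD[OF sT, of w] by blast
      then show "w \<in> range A0" using sub[of v] by simp
    qed simp
    then show False using \<open>\<not> inj A0\<close> linear_surjective_imp_injective[OF lin[OF st0(1)]] by blast
  qed
  then show ?thesis using st0 by blast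
qed

text \<open>Reparametrised by \<open>g\<close>, the inverse of the derivative of \<open>v \<mapsto> P (G (v, q))\<close>, the family
  \<open>w \<mapsto> P (G (g w, x))\<close> is close to \<open>w \<mapsto> q + w\<close> on a ball, for \<open>x = q\<close> by differentiability and for
  nearby \<open>x\<close> by uniform continuity. Replacing \<open>P\<close> by a realizable approximation \<open>H\<close> changes
  little, and a continuous map close to a translation covers a ball by Brouwer's theorem.\<close>

lemma full_rank_return_state_imp_mutually_reachable:
  assumes st: "return_state q y A" and "inj A"
  shows "\<exists>B. open B \<and> q \<in> B \<and> (\<forall>x\<in>B. \<forall>p\<in>B. R x p)"
proof -
  obtain G P P' W where linA: "linear A" and W: "open W" "(0, q) \<in> W" "continuous_on W G"
    "\<And>v x. (v, x) \<in> W \<Longrightarrow> R x (G (v, x))" and G: "G (0, q) = y" "((\<lambda>v. G (v, q)) has_derivative A) (at 0)"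
    and P: "approx_realizable P y" "P y = q" "(P has_derivative P') (at y)" "inj P'"
    using st unfolding return_state_def by blast
  obtain V where V: "open V" "y \<in> V" "continuous_on V P"
    "\<And>e. e > 0 \<Longrightarrow> \<exists>H. continuous_on V H \<and> (\<forall>x\<in>V. R x (H x) \<and> norm (H x - P x) < e)"
    using P(1) unfolding approx_realizable_def by blast
  have linP: "linear P'" using P(3) has_derivative_linear by blast
  have "linear (\<lambda>v. P' (A v))" "inj (\<lambda>v. P' (A v))"
    using linear_compose[OF linA linP] inj_compose[OF P(4) \<open>inj A\<close>] by (auto simp: o_def)
  then obtain g where g: "linear g" "\<And>w. P' (A (g w)) = w"
    using linear_injective_isomorphism by metis
  have g0: "g 0 = 0" by (rule linear_0[OF g(1)])
  have gd: "(g has_derivative g) (at 0)" using g(1) by (simp add: linear_conv_bounded_linear bounded_linear_imp_has_derivative)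
  have gc: "continuous_on T g" for T using g(1) by (simp add: linear_continuous_on linear_conv_bounded_linear)
  have "((\<lambda>w. G (g w, q)) has_derivative (\<lambda>w. A (g w))) (at 0)"
    using has_derivative_compose[OF gd, of "\<lambda>v. G (v, q)" A] G(2) g0 by simp
  from has_derivative_compose[OF this, of P P'] P(3) G(1) g0 g(2)
  have "((\<lambda>w. P (G (g w, q))) has_derivative (\<lambda>w. w)) (at 0)" by simp
  then obtain r0 where r0: "r0 > 0"
    "\<And>w. norm w < r0 \<Longrightarrow> norm (P (G (g w, q)) - q - w) \<le> 1/4 * norm w"
    unfolding has_derivative_at_alt using g0 G(1) P(2)
    by (auto elim!: allE[of _ "1/4"])
  define h where "h w = G (g (fst w), snd w)" for w :: "'e \<times> 'e"
  have g2: "continuous_on T (\<lambda>w. (g (fst w), snd w))" for T :: "('e \<times> 'e) set"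
    by (intro continuous_on_Pair continuous_on_compose2[OF gc[of UNIV] continuous_on_fst]
        continuous_on_snd continuous_on_id) auto
  define Y where "Y = (\<lambda>w. (g (fst w), snd w)) -` W"
  have Y: "open Y" unfolding Y_def by (rule open_vimage[OF W(1) g2])
  have hc: "continuous_on Y h" unfolding h_def
    by (rule continuous_on_compose2[OF W(3) g2]) (auto simp: Y_def)
  define Y' where "Y' = Y \<inter> h -` V"
  have "open Y'" using continuous_on_open_vimage[OF Y] hc V(1) by (auto simp: Y'_def Int_commute)
  moreover have "(0, q) \<in> Y'" using g0 W(2) G(1) V(2) by (auto simp: Y'_def Y_def h_def)
  ultimately obtain S1 S2 where S: "open S1" "open S2" "0 \<in> S1" "q \<in> S2" "S1 \<times> S2 \<subseteq> Y'"
    by (metis open_prod_elim mem_Times_iff fst_conv snd_conv)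
  obtain r1 r2 where r12: "r1 > 0" "cball 0 r1 \<subseteq> S1" "r2 > 0" "cball q r2 \<subseteq> S2"
    using S open_contains_cball by metis
  define r where "r = min (min r1 r2) (r0 / 2)"
  have r: "r > 0" "r < r0" "r \<le> r1" "r \<le> r2" using r0 r12 by (auto simp: r_def)
  have inY: "(w, x) \<in> Y'" if "w \<in> cball 0 r" "x \<in> cball q r" for w x
  proof -
    have "w \<in> S1" "x \<in> S2" using that r r12 by (auto simp: subset_eq)
    then show ?thesis using S by blast
  qed
  have "continuous_on Y' (\<lambda>w. P (h w))"
    by (rule continuous_on_compose2[OF V(3) continuous_on_subset[OF hc]]) (auto simp: Y'_def)
  then have "uniformly_continuous_on (cball 0 r \<times> cball q r) (\<lambda>w. P (h w))"
    using inY by (intro compact_uniformly_continuous compact_Times compact_cball)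
      (auto intro: continuous_on_subset)
  moreover have r8: "r / 8 > 0" using r by simp
  ultimately obtain s where s: "s > 0" "\<And>a b. a \<in> cball 0 r \<times> cball q r \<Longrightarrow> b \<in> cball 0 r \<times> cball q r \<Longrightarrow>
      dist b a < s \<Longrightarrow> dist (P (h b)) (P (h a)) < r / 8"
    unfolding uniformly_continuous_on_def by metis
  obtain H where H: "continuous_on V H" "\<And>x. x \<in> V \<Longrightarrow> R x (H x) \<and> norm (H x - P x) < r / 8"
    using V(4)[OF r8] by blast
  define \<rho> where "\<rho> = min s (r / 2)"
  have rho: "\<rho> > 0" "\<rho> \<le> s" "\<rho> \<le> r / 2" using s r by (auto simp: \<rho>_def)
  have "R x p" if x: "x \<in> ball q \<rho>" and p: "p \<in> ball q \<rho>" for x p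
  proof -
    have xr: "x \<in> cball q r" "q \<in> cball q r" using x rho r by auto
    define k where "k w = H (h (w, x)) - q" for w
    have hV: "h (w, x) \<in> V" "(w, x) \<in> Y" if "w \<in> cball 0 r" for w
      using inY[OF that xr(1)] by (auto simp: Y'_def)
    have kc: "continuous_on (cball 0 r) k"
    proof -
      have "continuous_on (cball 0 r) (\<lambda>w. h (w, x))"
        by (rule continuous_on_compose2[OF hc]) (use hV in \<open>auto intro!: continuous_intros\<close>)
      then have "continuous_on (cball 0 r) (\<lambda>w. H (h (w, x)))"
        by (rule continuous_on_compose2[OF H(1)]) (use hV in auto)
      then show ?thesis unfolding k_def by (intro continuous_intros)
    qed
    have kw: "norm (k w - w) \<le> r / 2" if w: "w \<in> cball 0 r" for w
    proof -
      have 1: "norm (H (h (w, x)) - P (h (w, x))) < r / 8" using H(2) hV w by blast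
      have 2: "dist (P (h (w, x))) (P (h (w, q))) < r / 8"
        by (rule s(2)) (use w xr x rho in \<open>auto simp: dist_prod_def dist_commute\<close>)
      have "norm w \<le> r" using w by simp
      then have 3: "norm (P (h (w, q)) - q - w) \<le> r / 4"
        using r0(2)[of w] r by (simp add: h_def)
      have "k w - w = (H (h (w, x)) - P (h (w, x))) + (P (h (w, x)) - P (h (w, q))) + (P (h (w, q)) - q - w)"
        by (simp add: k_def)
      then have "norm (k w - w) \<le> r / 8 + r / 8 + r / 4"
        using 1 2 3 by (simp only:) (intro norm_triangle_le add_mono, auto simp: dist_norm)
      then show ?thesis by simp
    qed
    have "\<exists>w\<in>cball (0::'e) r. k w = p - q"
    proof (rule brouwer_surjective_cball[OF kc r(1), of _ "{p - q}"])
      fix z w :: 'e assume z: "z \<in> {p - q}" and w: "w \<in> cball 0 r"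
      have "norm (z + (w - k w)) \<le> norm (p - q) + norm (k w - w)"
        using z norm_triangle_ineq[of z "w - k w"] by (simp add: norm_minus_commute)
      also have "\<dots> \<le> r / 2 + r / 2"
        using kw[OF w] p rho by (intro add_mono) (auto simp: dist_norm norm_minus_commute)
      finally show "z + (w - k w) \<in> cball 0 r" by simp
    qed simp
    then obtain w where w: "w \<in> cball 0 r" "H (h (w, x)) = p" by (auto simp: k_def)
    have "R x (h (w, x))" using W(4)[of "g w" x] hV(2)[OF w(1)] by (simp add: h_def Y_def)
    moreover have "R (h (w, x)) p" using H(2)[OF hV(1)[OF w(1)]] w(2) by simp
    ultimately show ?thesis using R_trans by blast
  qed
  then show ?thesis using rho(1) by (intro exI[of _ "ball q \<rho>"]) auto
qed

theorem locally_controllable: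
  assumes "q \<in> Om" "\<And>v. \<exists>Z \<in> lie_closure Om (X ` F). Z q = v"
  shows "\<exists>B. open B \<and> q \<in> B \<and> (\<forall>x\<in>B. \<forall>p\<in>B. R x p)"
  using exists_full_rank_return_state[OF assms] full_rank_return_state_imp_mutually_reachable by blast

end

section \<open>Ampleness and reversal of control vectors\<close>

text \<open>If vectors depending continuously on \<open>x\<close> are independent at \<open>q\<close>, they are independent near
  \<open>q\<close>, and the coefficients \<open>a j x v\<close> of \<open>v\<close> depend continuously on \<open>x\<close>. The linear map \<open>T x\<close>
  carries the vectors at \<open>q\<close> to those at \<open>x\<close> and is close to the identity, so that its inverse is
  bounded uniformly in \<open>x\<close>; \<open>a j x\<close> is a coordinate functional composed with this inverse.\<close>

lemma continuous_coefficients: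
  fixes Y :: "'i \<Rightarrow> 'e::euclidean_space \<Rightarrow> 'e"
  assumes J: "finite J" and S: "open S" "q \<in> S" and Y: "\<And>j. j \<in> J \<Longrightarrow> continuous_on S (Y j)"
    and ind: "inj_on (\<lambda>j. Y j q) J" "independent ((\<lambda>j. Y j q) ` J)"
  obtains W a where "open W" "q \<in> W" "W \<subseteq> S"
    "\<And>x. x \<in> W \<Longrightarrow> inj_on (\<lambda>j. Y j x) J"
    "\<And>x. x \<in> W \<Longrightarrow> independent ((\<lambda>j. Y j x) ` J)"
    "\<And>x k j. x \<in> W \<Longrightarrow> j \<in> J \<Longrightarrow> a j x (\<Sum>i\<in>J. k i *\<^sub>R Y i x) = (k j :: real)"
    "\<And>f j. continuous_on W f \<Longrightarrow> j \<in> J \<Longrightarrow> continuous_on W (\<lambda>x. a j x (f x))"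
proof -
  have "\<exists>l. linear l \<and> (\<forall>v \<in> (\<lambda>j. Y j q) ` J. l v = (if v = Y j q then 1 else (0::real)))" for j
    by (rule linear_independent_extend[OF ind(2)])
  then have "\<exists>l. \<forall>j. linear (l j) \<and>
      (\<forall>v \<in> (\<lambda>j. Y j q) ` J. l j v = (if v = Y j q then 1 else (0::real)))"
    by (intro choice allI)
  then obtain l where l: "\<And>j. linear (l j)"
    "\<And>j i. i \<in> J \<Longrightarrow> l j (Y i q) = (if Y i q = Y j q then 1 else (0::real))" by auto
  then have lij: "l j (Y i q) = (if i = j then 1 else 0)" if "i \<in> J" "j \<in> J" for i j
    using that ind(1) by (auto simp: inj_on_def)
  have "\<exists>B. \<forall>v. norm (l j v) \<le> B * norm v" for j using linear_bounded[OF l(1)] .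
  then obtain B where B: "\<And>j v. norm (l j v) \<le> B j * norm v" by metis
  define T where "T x v = v + (\<Sum>j\<in>J. l j v *\<^sub>R (Y j x - Y j q))" for x v
  have linT: "linear (T x)" for x
    unfolding T_def using l(1)
    by (auto simp: linear_iff scaleR_add_left sum.distrib scaleR_right.sum scaleR_add_right)
  have TY: "T x (Y i q) = Y i x" if "i \<in> J" for i x
  proof -
    have "(\<Sum>j\<in>J. l j (Y i q) *\<^sub>R (Y j x - Y j q)) = (\<Sum>j\<in>J. if i = j then Y j x - Y j q else 0)"
      by (rule sum.cong) (auto simp: lij that)
    also have "\<dots> = Y i x - Y i q" using that J by simp
    finally show ?thesis by (simp add: T_def)
  qed
  define m where "m x = (\<Sum>j\<in>J. B j * norm (Y j x - Y j q))" for x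
  define W where "W = S \<inter> m -` {..<1/2}"
  have mc: "continuous_on S m" unfolding m_def by (intro continuous_intros Y)
  have W: "open W" unfolding W_def
    using continuous_on_open_vimage[OF S(1)] mc by (metis Int_commute open_lessThan)
  have W: "open W" "q \<in> W" "W \<subseteq> S"
    using W S(2) by (auto simp: W_def m_def)
  have Tlow: "norm v \<le> 2 * norm (T x v)" if "x \<in> W" for x v
  proof -
    have "norm (T x v - v) \<le> (\<Sum>j\<in>J. B j * norm v * norm (Y j x - Y j q))"
      unfolding T_def using B by (auto intro!: sum_norm_le mult_right_mono)
    also have "\<dots> = norm v * m x" by (simp add: m_def sum_distrib_left mult_ac)
    also have "\<dots> \<le> norm v * (1/2)" using that by (intro mult_left_mono) (auto simp: W_def)
    finally show ?thesis using norm_triangle_sub[of v "T x v"] by (simp add: norm_minus_commute)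
  qed
  have injT: "inj (T x)" if "x \<in> W" for x
    using Tlow[OF that] linear_injective_0[OF linT] by (metis mult_zero_right norm_le_zero_iff norm_zero)
  have "\<exists>g. (\<forall>v. g (T x v) = v) \<and> (\<forall>v. T x (g v) = v)" if "x \<in> W" for x
    using linear_injective_isomorphism[OF linT injT[OF that]] by blast
  then obtain Ti where Ti: "\<And>x v. x \<in> W \<Longrightarrow> Ti x (T x v) = v" "\<And>x v. x \<in> W \<Longrightarrow> T x (Ti x v) = v" by metis
  define a where "a j x v = l j (Ti x v)" for j x v
  show ?thesis
  proof (rule that[of W a])
    fix x assume x: "x \<in> W"
    have im: "(\<lambda>j. Y j x) ` J = T x ` ((\<lambda>j. Y j q) ` J)" using TY by (auto simp: image_image)
    show "independent ((\<lambda>j. Y j x) ` J)"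
      unfolding im
      by (rule linear_independent_injective_image[OF linT ind(2) inj_on_subset[OF injT[OF x] subset_UNIV]])
    show "inj_on (\<lambda>j. Y j x) J"
    proof (rule inj_onI)
      fix i j assume ij: "i \<in> J" "j \<in> J" "Y i x = Y j x"
      then have "T x (Y i q) = T x (Y j q)" by (simp add: TY)
      then have "Y i q = Y j q" by (rule injD[OF injT[OF x]])
      then show "i = j" using inj_onD[OF ind(1)] ij by blast
    qed
  next
    fix x k and j assume x: "x \<in> W" and j: "j \<in> J"
    have "(\<Sum>i\<in>J. k i *\<^sub>R Y i x) = T x (\<Sum>i\<in>J. k i *\<^sub>R Y i q)"
      using linT by (simp add: linear_sum linear_scale TY)
    then have "a j x (\<Sum>i\<in>J. k i *\<^sub>R Y i x) = (\<Sum>i\<in>J. k i * l j (Y i q))"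
      using l(1)[of j] Ti(1)[OF x] by (simp add: a_def linear_sum linear_scale)
    also have "\<dots> = (\<Sum>i\<in>J. if i = j then k i else 0)" by (rule sum.cong) (auto simp: lij j)
    also have "\<dots> = k j" using j J by simp
    finally show "a j x (\<Sum>i\<in>J. k i *\<^sub>R Y i x) = k j" .
  next
    fix f :: "'e \<Rightarrow> 'e" and j assume f: "continuous_on W f" and j: "j \<in> J"
    have "continuous_on W (\<lambda>x. Ti x (f x))"
      unfolding continuous_on_def
    proof
      fix x0 assume x0: "x0 \<in> W"
      define z where "z = Ti x0 (f x0)"
      have "continuous_on W (\<lambda>x. f x - T x z)"
        unfolding T_def by (intro continuous_intros f continuous_on_subset[OF Y W(3)])
      then have "((\<lambda>x. f x - T x z) \<longlongrightarrow> f x0 - T x0 z) (at x0 within W)"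
        using x0 by (simp add: continuous_on_def)
      then have "((\<lambda>x. 2 * norm (f x - T x z)) \<longlongrightarrow> 2 * norm (f x0 - T x0 z)) (at x0 within W)"
        by (rule tendsto_mult_left[OF tendsto_norm])
      then have lim: "((\<lambda>x. 2 * norm (f x - T x z)) \<longlongrightarrow> 0) (at x0 within W)"
        using Ti(2)[OF x0] by (simp add: z_def)
      have "((\<lambda>x. Ti x (f x) - z) \<longlongrightarrow> 0) (at x0 within W)"
      proof (rule Lim_null_comparison[OF _ lim])
        have "norm (Ti x (f x) - z) \<le> 2 * norm (f x - T x z)" if "x \<in> W" for x
          using Tlow[OF that, of "Ti x (f x) - z"] Ti(2)[OF that] by (simp add: linear_diff[OF linT])
        then show "\<forall>\<^sub>F x in at x0 within W. norm (Ti x (f x) - z) \<le> 2 * norm (f x - T x z)"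
          by (auto simp: eventually_at_filter)
      qed
      then show "((\<lambda>x. Ti x (f x)) \<longlongrightarrow> Ti x0 (f x0)) (at x0 within W)"
        by (simp add: LIM_zero_iff z_def)
    qed
    then show "continuous_on W (\<lambda>x. a j x (f x))"
      unfolding a_def by (rule bounded_linear.continuous_on[OF l(1)[of j, unfolded linear_conv_bounded_linear]])
  qed (use W in auto)
qed

text \<open>Let \<open>J\<close> index a basis of the control space at \<open>q\<close>. By ampleness, \<open>- (\<Sum>j\<in>J. X j q)\<close> is a convex
  combination of control vectors. With the same weights, the combination \<open>f x\<close> at a nearby point
  \<open>x\<close> is \<open>\<Sum>j\<in>J. g j x *\<^sub>R X j x\<close> with all \<open>g j x\<close> close to \<open>- 1\<close>; here the constancy of the
  dimension is needed, as it makes the \<open>X j x\<close> a basis of the control space at \<open>x\<close>. Adding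
  positive multiples of the \<open>X j x\<close> to a large multiple of \<open>f x\<close> gives any vector with
  coefficients bounded by \<open>M\<close>, in particular \<open>- X u x\<close>.\<close>

lemma reversing_coefficients:
  fixes X :: "'u \<Rightarrow> 'e::euclidean_space \<Rightarrow> 'e"
  assumes S: "open S" "q \<in> S" and X: "\<And>u. u \<in> U \<Longrightarrow> continuous_on S (X u)"
    and F: "finite F" "F \<subseteq> U"
    and dim: "\<And>x. x \<in> S \<Longrightarrow> dim ((\<lambda>u. X u x) ` U) = k"
    and hull: "convex hull ((\<lambda>u. X u q) ` U) = span ((\<lambda>u. X u q) ` U)"
  obtains W I c where "open W" "q \<in> W" "W \<subseteq> S" "finite I" "F \<subseteq> I" "I \<subseteq> U"
    "\<And>u i. u \<in> F \<Longrightarrow> i \<in> I \<Longrightarrow> continuous_on W (c u i)"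
    "\<And>u i x. u \<in> F \<Longrightarrow> i \<in> I \<Longrightarrow> x \<in> W \<Longrightarrow> (0::real) \<le> c u i x"
    "\<And>u x. u \<in> F \<Longrightarrow> x \<in> W \<Longrightarrow> (\<Sum>i\<in>I. c u i x *\<^sub>R X i x) = - X u x"
proof -
  obtain B where B: "B \<subseteq> (\<lambda>u. X u q) ` U" "independent B" "card B = dim ((\<lambda>u. X u q) ` U)"
    using basis_exists[of "(\<lambda>u. X u q) ` U"] by metis
  have finB: "finite B" using B(2) independent_imp_finite by blast
  have "\<exists>u\<in>U. X u q = v" if "v \<in> (\<lambda>u. X u q) ` U" for v using that by auto
  then obtain sel where sel: "\<And>v. v \<in> (\<lambda>u. X u q) ` U \<Longrightarrow> sel v \<in> U \<and> X (sel v) q = v" by metis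
  define J where "J = sel ` B"
  have selB: "X (sel v) q = v" if "v \<in> B" for v using sel that B(1) by blast
  have JU: "J \<subseteq> U" using sel B(1) by (auto simp: J_def)
  have finJ: "finite J" using finB by (simp add: J_def)
  have imJ: "(\<lambda>j. X j q) ` J = B" using selB by (auto simp: J_def image_image)
  have injJ: "inj_on (\<lambda>j. X j q) J" using selB by (auto simp: J_def inj_on_def)
  have cardJ: "card J = k" using card_image[OF injJ] imJ B(3) dim[OF S(2)] by simp
  have XJ: "\<And>j. j \<in> J \<Longrightarrow> continuous_on S (X j)" using X JU by blast
  have indJ: "independent ((\<lambda>j. X j q) ` J)" using imJ B(2) by simp
  obtain W1 a where W1: "open W1" "q \<in> W1" "W1 \<subseteq> S"
    and indx: "\<And>x. x \<in> W1 \<Longrightarrow> inj_on (\<lambda>j. X j x) J"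
      "\<And>x. x \<in> W1 \<Longrightarrow> independent ((\<lambda>j. X j x) ` J)"
    and a: "\<And>x k j. x \<in> W1 \<Longrightarrow> j \<in> J \<Longrightarrow> a j x (\<Sum>i\<in>J. k i *\<^sub>R X i x) = (k j :: real)"
    and ac: "\<And>f j. continuous_on W1 f \<Longrightarrow> j \<in> J \<Longrightarrow> continuous_on W1 (\<lambda>x. a j x (f x))"
    by (rule continuous_coefficients[OF finJ S XJ injJ indJ])
      (assumption | (rule that; (assumption | blast)))+
  have rep: "v = (\<Sum>j\<in>J. a j x v *\<^sub>R X j x)" if x: "x \<in> W1" and v: "v \<in> span ((\<lambda>u. X u x) ` U)" for x v
  proof -
    have inj: "inj_on (\<lambda>j. X j x) J" and ind: "independent ((\<lambda>j. X j x) ` J)" using indx[OF x] by auto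
    have "(\<lambda>u. X u x) ` U \<subseteq> span ((\<lambda>j. X j x) ` J)"
      by (rule card_ge_dim_independent) (use ind JU card_image[OF inj] cardJ dim x W1 in auto)
    then have "v \<in> span ((\<lambda>j. X j x) ` J)" using v span_mono span_span by blast
    then obtain k where "v = (\<Sum>w\<in>(\<lambda>j. X j x) ` J. k w *\<^sub>R w)"
      using span_finite[OF finite_imageI[OF finJ]] by auto
    then have "v = (\<Sum>j\<in>J. k (X j x) *\<^sub>R X j x)" using inj by (simp add: sum.reindex)
    then show ?thesis using a[OF x, of _ "\<lambda>j. k (X j x)"] by simp
  qed
  have "- (\<Sum>j\<in>J. X j q) \<in> span ((\<lambda>u. X u q) ` U)"
    using JU by (intro span_neg span_sum span_base) auto
  then have "- (\<Sum>j\<in>J. X j q) \<in> convex hull ((\<lambda>u. X u q) ` U)" using hull by simp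
  then obtain C b where C: "finite C" "C \<subseteq> (\<lambda>u. X u q) ` U" "\<And>v. v \<in> C \<Longrightarrow> 0 \<le> b v"
    "(\<Sum>v\<in>C. b v *\<^sub>R v) = - (\<Sum>j\<in>J. X j q)"
    unfolding convex_hull_explicit by blast
  define L where "L = sel ` C"
  define lam where "lam i = (if i \<in> L then b (X i q) else 0)" for i
  have selC: "X (sel v) q = v" if "v \<in> C" for v using sel that C(2) by blast
  have LU: "L \<subseteq> U" "finite L" using sel C(1,2) by (auto simp: L_def)
  have lam0: "0 \<le> lam i" for i using C(3) selC by (auto simp: lam_def L_def)
  have "inj_on sel C" using selC by (metis inj_onI)
  then have Lsum: "(\<Sum>i\<in>L. lam i *\<^sub>R X i q) = - (\<Sum>j\<in>J. X j q)"
    using selC C(4) by (simp add: L_def sum.reindex lam_def)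
  define f where "f x = (\<Sum>i\<in>L. lam i *\<^sub>R X i x)" for x
  define g where "g j x = a j x (f x)" for j x
  define h where "h u j x = a j x (X u x)" for u j x
  have gc: "continuous_on W1 (g j)" if "j \<in> J" for j
    unfolding g_def f_def using LU
    by (intro ac that continuous_intros continuous_on_subset[OF X W1(3)]) auto
  have hc: "continuous_on W1 (h u j)" if "j \<in> J" "u \<in> U" for u j
    unfolding h_def by (intro ac that continuous_on_subset[OF X W1(3)])
  have fg: "f x = (\<Sum>j\<in>J. g j x *\<^sub>R X j x)" if "x \<in> W1" for x
    unfolding g_def using LU(1)
    by (intro rep that, unfold f_def) (intro span_sum span_scale span_base, auto)
  have Xh: "X u x = (\<Sum>j\<in>J. h u j x *\<^sub>R X j x)" if "x \<in> W1" "u \<in> U" for x u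
    unfolding h_def using that by (intro rep) (auto intro!: span_base)
  have gq: "g j q = - 1" if "j \<in> J" for j
    using a[OF W1(2) that, of "\<lambda>_. - 1"] Lsum by (simp add: g_def f_def sum_negf)
  define M where "M = (\<Sum>u\<in>F. \<Sum>j\<in>J. \<bar>h u j q\<bar>) + 1"
  have hM: "\<bar>h u j q\<bar> < M" if "u \<in> F" "j \<in> J" for u j
  proof -
    have "\<bar>h u j q\<bar> \<le> (\<Sum>j\<in>J. \<bar>h u j q\<bar>)" using that finJ by (intro member_le_sum) auto
    also have "\<dots> \<le> (\<Sum>u\<in>F. \<Sum>j\<in>J. \<bar>h u j q\<bar>)"
      using that F(1) by (intro member_le_sum[of u F "\<lambda>u. \<Sum>j\<in>J. \<bar>h u j q\<bar>"]) (auto intro: sum_nonneg)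
    finally show ?thesis by (simp add: M_def)
  qed
  have M: "M > 0" by (auto simp: M_def intro!: add_nonneg_pos sum_nonneg)
  have "\<forall>\<^sub>F x in nhds q. g j x \<in> {..< -1/2}" if "j \<in> J" for j
    by (rule eventually_nhds_continuous_on[OF gc[OF that] W1(1,2)]) (use gq that in auto)
  moreover have "\<forall>\<^sub>F x in nhds q. h u j x \<in> {-M<..<M}" if "j \<in> J" "u \<in> F" for u j
    by (rule eventually_nhds_continuous_on[OF hc[OF that(1) subsetD[OF F(2) that(2)]] W1(1,2)])
      (use hM[OF that(2,1)] in \<open>auto simp: abs_less_iff\<close>)
  moreover have "\<forall>\<^sub>F x in nhds q. x \<in> W1" using W1 by (simp add: eventually_nhds_in_open)
  ultimately have "\<forall>\<^sub>F x in nhds q. x \<in> W1 \<and> (\<forall>j\<in>J. g j x \<in> {..< -1/2}) \<and> (\<forall>j\<in>J. \<forall>u\<in>F. h u j x \<in> {-M<..<M})"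
    using finJ F by (intro eventually_conj eventually_ball_finite ballI) auto
  then obtain W where W: "open W" "q \<in> W" and WW: "\<And>x. x \<in> W \<Longrightarrow> x \<in> W1"
    "\<And>x j. x \<in> W \<Longrightarrow> j \<in> J \<Longrightarrow> g j x < -1/2" "\<And>x j u. x \<in> W \<Longrightarrow> j \<in> J \<Longrightarrow> u \<in> F \<Longrightarrow> - M < h u j x \<and> h u j x < M"
    unfolding eventually_nhds by auto
  define I where "I = F \<union> J \<union> L"
  define c where "c u i x = 2 * M * lam i + (if i \<in> J then - (2 * M * g i x) - h u i x else 0)" for u i x
  show ?thesis
  proof (rule that[of W I c])
    show "finite I" "F \<subseteq> I" "I \<subseteq> U" using F finJ LU JU by (auto simp: I_def)
    show "W \<subseteq> S" using WW(1) W1(3) by blast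
    have WW1: "W \<subseteq> W1" using WW(1) by blast
    show "continuous_on W (c u i)" if u: "u \<in> F" for u i
      using subsetD[OF F(2) u]
      by (cases "i \<in> J")
        (auto simp: c_def intro!: continuous_intros continuous_on_subset[OF gc WW1] continuous_on_subset[OF hc WW1])
    show "0 \<le> c u i x" if u: "u \<in> F" and x: "x \<in> W" for u i x
    proof (cases "i \<in> J")
      case True
      have "M * 1 \<le> M * (- (2 * g i x))" using WW(2)[OF x True] M by (intro mult_left_mono) auto
      then have "0 \<le> - (2 * M * g i x) - h u i x" using WW(3)[OF x True u] by (simp add: algebra_simps)
      then show ?thesis using True lam0[of i] M by (simp add: c_def)
    next
      case False
      then show ?thesis using lam0[of i] M by (simp add: c_def)
    qed
    fix u x assume u: "u \<in> F" and x: "x \<in> W"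
    have uU: "u \<in> U" using u F by blast
    have finI: "finite I" using F finJ LU by (simp add: I_def)
    have "(\<Sum>i\<in>I. c u i x *\<^sub>R X i x) = (\<Sum>i\<in>I. (2 * M * lam i) *\<^sub>R X i x) +
        (\<Sum>i\<in>I. if i \<in> J then (- (2 * M * g i x) - h u i x) *\<^sub>R X i x else 0)"
      unfolding sum.distrib[symmetric] by (rule sum.cong) (auto simp: c_def scaleR_add_left)
    also have "(\<Sum>i\<in>I. (2 * M * lam i) *\<^sub>R X i x) = (\<Sum>i\<in>L. (2 * M * lam i) *\<^sub>R X i x)"
      by (rule sum.mono_neutral_right[OF finI]) (auto simp: I_def lam_def)
    also have "\<dots> = (2 * M) *\<^sub>R f x" by (simp add: f_def scaleR_right.sum)
    also have "(\<Sum>i\<in>I. if i \<in> J then (- (2 * M * g i x) - h u i x) *\<^sub>R X i x else 0) =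
        (\<Sum>i\<in>J. (- (2 * M * g i x) - h u i x) *\<^sub>R X i x)"
    proof -
      have "I \<inter> J = J" by (auto simp: I_def)
      then show ?thesis using sum.inter_restrict[OF finI, of "\<lambda>i. (- (2 * M * g i x) - h u i x) *\<^sub>R X i x" J] by simp
    qed
    also have "\<dots> = - ((2 * M) *\<^sub>R (\<Sum>j\<in>J. g j x *\<^sub>R X j x)) - (\<Sum>j\<in>J. h u j x *\<^sub>R X j x)"
      by (simp add: scaleR_diff_left sum_subtractf scaleR_right.sum sum_negf)
    also have "\<dots> = - ((2 * M) *\<^sub>R f x) - X u x" using fg[OF WW(1)[OF x]] Xh[OF WW(1)[OF x] uU] by simp
    finally show "(\<Sum>i\<in>I. c u i x *\<^sub>R X i x) = - X u x" by simp
  qed (use W in auto)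
qed

section \<open>Charts\<close>

text \<open>Brackets are natural: in the derivatives of both sides of \<open>rel\<close>, the second derivative of \<open>psi\<close>
  occurs with the arguments \<open>X z\<close> and \<open>Y z\<close> in both orders, and cancels.\<close>

lemma vf_bracket_pushforward:
  assumes S: "open S" "smooth_on S psi" "z \<in> S" and T: "psi z \<in> T" "smooth_on T X'" "smooth_on T Y'"
    and XY: "smooth_on S X" "smooth_on S Y"
    and rel: "\<And>y. y \<in> S \<Longrightarrow> X' (psi y) = frechet_derivative psi (at y) (X y)"
      "\<And>y. y \<in> S \<Longrightarrow> Y' (psi y) = frechet_derivative psi (at y) (Y y)"
  shows "vf_bracket X' Y' (psi z) = frechet_derivative psi (at z) (vf_bracket X Y z)"
proof -
  have key: "frechet_derivative Z' (at (psi z)) (frechet_derivative psi (at z) w) =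
      frechet_derivative psi (at z) (frechet_derivative Z (at z) w) +
      frechet_derivative (\<lambda>x. frechet_derivative psi (at x) (Z z)) (at z) w"
    if Z: "smooth_on T Z'" "smooth_on S Z" "\<And>y. y \<in> S \<Longrightarrow> Z' (psi y) = frechet_derivative psi (at y) (Z y)"
    for Z Z' w
  proof -
    have 1: "((\<lambda>y. Z' (psi y)) has_derivative
        (\<lambda>w. frechet_derivative Z' (at (psi z)) (frechet_derivative psi (at z) w))) (at z)"
      by (rule has_derivative_compose[OF smooth_on_has_derivative[OF S(2,3)] smooth_on_has_derivative[OF Z(1) T(1)]])
    have 2: "((\<lambda>y. Z' (psi y)) has_derivative (\<lambda>w.
        frechet_derivative psi (at z) (frechet_derivative Z (at z) w) +
        frechet_derivative (\<lambda>x. frechet_derivative psi (at x) (Z z)) (at z) w)) (at z)"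
      by (rule has_derivative_transform_within_open[OF
            has_derivative_frechet_derivative_along[OF S has_derivative_ident smooth_on_has_derivative[OF Z(2) S(3)]] S(1,3)])
        (use Z(3) in simp)
    show ?thesis using fun_cong[OF has_derivative_unique[OF 1 2]] .
  qed
  show ?thesis
    using key[OF T(3) XY(2) rel(2), of "X z"] key[OF T(2) XY(1) rel(1), of "Y z"]
      smooth_on_second_derivative_symmetric[OF S(1,3,2), of "X z" "Y z"]
      linear_diff[OF smooth_on_linear_frechet_derivative[OF S(2,3)]] rel[OF S(3)]
    by (simp add: vf_bracket_def)
qed

locale atlas =
  fixes A :: "('a::topological_space, 'e::euclidean_space) chart set"
  assumes atlas: "smooth_atlas A"
begin

lemma is_chart: "c \<in> A \<Longrightarrow> is_chart c"
  using atlas by (simp add: smooth_atlas_def)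

lemma open_domain: "c \<in> A \<Longrightarrow> open (fst c)"
  and open_image: "c \<in> A \<Longrightarrow> open (snd c ` fst c)"
  and continuous_chart: "c \<in> A \<Longrightarrow> continuous_on (fst c) (snd c)"
  and continuous_chart_inv: "c \<in> A \<Longrightarrow> continuous_on (snd c ` fst c) (chart_inv c)"
  and chart_inv_chart: "c \<in> A \<Longrightarrow> q \<in> fst c \<Longrightarrow> chart_inv c (snd c q) = q"
  and chart_chart_inv: "c \<in> A \<Longrightarrow> x \<in> snd c ` fst c \<Longrightarrow> snd c (chart_inv c x) = x"
  and chart_inv_in: "c \<in> A \<Longrightarrow> x \<in> snd c ` fst c \<Longrightarrow> chart_inv c x \<in> fst c"
  using is_chart[of c] by (auto simp: is_chart_def homeomorphism_def)

lemma chart_at: "chart_at A q \<in> A" "q \<in> fst (chart_at A q)"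
proof -
  have "q \<in> (\<Union>c\<in>A. fst c)" using atlas by (simp add: smooth_atlas_def)
  then have "\<exists>c. c \<in> A \<and> q \<in> fst c" by blast
  then have "chart_at A q \<in> A \<and> q \<in> fst (chart_at A q)"
    unfolding chart_at_def by (rule someI_ex)
  then show "chart_at A q \<in> A" "q \<in> fst (chart_at A q)" by auto
qed

lemma open_chart_image:
  assumes "c \<in> A" "open W"
  shows "open (snd c ` (fst c \<inter> W))"
proof -
  have "snd c ` (fst c \<inter> W) = snd c ` fst c \<inter> chart_inv c -` W"
    using chart_inv_chart[OF assms(1)] by force
  then show ?thesis
    using continuous_on_open_vimage[OF open_image[OF assms(1)]] continuous_chart_inv[OF assms(1)] assms(2)
    by (metis Int_commute)
qed

lemma open_chart_preimage:
  assumes "c \<in> A" "open W"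
  shows "open (fst c \<inter> snd c -` W)"
  using continuous_on_open_vimage[OF open_domain[OF assms(1)]] continuous_chart[OF assms(1)] assms(2)
  by (metis Int_commute)

lemma smooth_transition:
  "c \<in> A \<Longrightarrow> d \<in> A \<Longrightarrow> smooth_on (snd c ` (fst c \<inter> fst d)) (snd d \<circ> chart_inv c)"
  using atlas by (simp add: smooth_atlas_def)

lemma coords_change:
  assumes c: "c \<in> A" "q \<in> fst c" and d: "d \<in> A" "q \<in> fst d"
  shows "coords A d q v = frechet_derivative (snd d \<circ> chart_inv c) (at (snd c q)) (coords A c q v)"
proof -
  define e where "e = chart_at A q"
  have e: "e \<in> A" "q \<in> fst e" using chart_at[of q] by (auto simp: e_def)
  have tr: "((snd d' \<circ> chart_inv c') has_derivative frechet_derivative (snd d' \<circ> chart_inv c') (at (snd c' q))) (at (snd c' q))"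
    if "c' \<in> A" "q \<in> fst c'" "d' \<in> A" "q \<in> fst d'" for c' d'
    by (rule smooth_on_has_derivative[OF smooth_transition[OF that(1,3)]]) (use that in auto)
  have "((\<lambda>y. (snd d \<circ> chart_inv c) ((snd c \<circ> chart_inv e) y)) has_derivative
      (\<lambda>v. frechet_derivative (snd d \<circ> chart_inv c) (at (snd c q))
         (frechet_derivative (snd c \<circ> chart_inv e) (at (snd e q)) v))) (at (snd e q))"
    using has_derivative_compose[OF tr[OF e c], of "snd d \<circ> chart_inv c"] tr[OF c d]
    by (simp add: chart_inv_chart[OF e])
  then have "((snd d \<circ> chart_inv e) has_derivative
      (\<lambda>v. frechet_derivative (snd d \<circ> chart_inv c) (at (snd c q))
         (frechet_derivative (snd c \<circ> chart_inv e) (at (snd e q)) v))) (at (snd e q))"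
    by (rule has_derivative_transform_within_open[OF _ open_chart_image[OF e(1) open_Int[OF open_domain[OF c(1)] open_domain[OF d(1)]]]])
      (use e(2) c(2) d(2) chart_inv_chart[OF e(1)] chart_inv_chart[OF c(1)] in auto)
  from fun_cong[OF frechet_derivative_at[OF this]] show ?thesis
    unfolding coords_def e_def[symmetric] by simp
qed

lemma linear_coords:
  assumes "c \<in> A" "q \<in> fst c"
  shows "linear (coords A c q)"
  unfolding coords_def[abs_def]
  by (rule smooth_on_linear_frechet_derivative[OF smooth_transition[OF chart_at(1) assms(1)]])
    (use assms chart_at in auto)

text \<open>A tangent vector at \<open>q\<close> is its own coordinate vector in the preferred chart.\<close>

lemma coords_chart_at: "coords A (chart_at A q) q v = v"
proof -
  let ?c = "chart_at A q"
  have "((\<lambda>x. x) has_derivative (\<lambda>x. x)) (at (snd ?c q))" by (rule has_derivative_ident)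
  then have "((snd ?c \<circ> chart_inv ?c) has_derivative (\<lambda>x. x)) (at (snd ?c q))"
    by (rule has_derivative_transform_within_open[OF _ open_image[OF chart_at(1)]])
      (use chart_at chart_inv_chart[OF chart_at(1)[of q]] in auto)
  from fun_cong[OF frechet_derivative_at[OF this]] show ?thesis unfolding coords_def by simp
qed

lemma inj_coords:
  assumes "c \<in> A" "q \<in> fst c"
  shows "inj (coords A c q)"
  using coords_change[OF assms chart_at, unfolded coords_chart_at] by (metis injI)

lemma local_rep_chart:
  "c \<in> A \<Longrightarrow> q \<in> fst c \<Longrightarrow> local_rep A c X (snd c q) = coords A c q (X q)"
  by (simp add: local_rep_def chart_inv_chart)

text \<open>The bracket is defined at each point in the preferred chart there; by naturality every chart
  computes it.\<close>

lemma local_rep_lie_bracket: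
  assumes c: "c \<in> A" and x: "x \<in> snd c ` fst c"
    and X: "smooth_vector_field_on A UNIV X" and Y: "smooth_vector_field_on A UNIV Y"
  shows "local_rep A c (lie_bracket A X Y) x = vf_bracket (local_rep A c X) (local_rep A c Y) x"
proof -
  obtain q where q: "q \<in> fst c" "x = snd c q" using x by blast
  define d where "d = chart_at A q"
  have d: "d \<in> A" "q \<in> fst d" using chart_at[of q] by (auto simp: d_def)
  let ?S = "snd d ` (fst d \<inter> fst c)" and ?psi = "snd c \<circ> chart_inv d"
  have xd: "?psi (snd d q) = x" using d q by (simp add: chart_inv_chart)
  have sm: "smooth_on (snd c' ` fst c') (local_rep A c' Z)"
    if "c' \<in> A" "smooth_vector_field_on A UNIV Z" for c' Z
    using that by (simp add: smooth_vector_field_on_def)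
  have sub: "?S \<subseteq> snd d ` fst d" by blast
  have rel: "local_rep A c Z (?psi y) = frechet_derivative ?psi (at y) (local_rep A d Z y)" if y: "y \<in> ?S" for y Z
  proof -
    obtain p where p: "p \<in> fst d" "p \<in> fst c" "y = snd d p" using y by blast
    then show ?thesis
      using coords_change[OF d(1) p(1) c p(2)] local_rep_chart[OF c p(2)] local_rep_chart[OF d(1) p(1)]
      by (simp add: chart_inv_chart[OF d(1) p(1)])
  qed
  have "vf_bracket (local_rep A c X) (local_rep A c Y) (?psi (snd d q)) =
     frechet_derivative ?psi (at (snd d q)) (vf_bracket (local_rep A d X) (local_rep A d Y) (snd d q))"
  proof (rule vf_bracket_pushforward[of ?S, where T = "snd c ` fst c"])
    show "open ?S" by (rule open_chart_image[OF d(1) open_domain[OF c]])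
    show "smooth_on ?S ?psi" by (rule smooth_transition[OF d(1) c])
    show "snd d q \<in> ?S" using d q by blast
    show "?psi (snd d q) \<in> snd c ` fst c" using xd x by simp
    show "smooth_on ?S (local_rep A d X)" "smooth_on ?S (local_rep A d Y)"
      using smooth_on_subset[OF sm[OF d(1)] sub] X Y by auto
    show "smooth_on (snd c ` fst c) (local_rep A c X)" "smooth_on (snd c ` fst c) (local_rep A c Y)"
      using sm[OF c] X Y by auto
  qed (fact rel)+
  moreover have "vf_bracket (local_rep A d X) (local_rep A d Y) (snd d q) = lie_bracket A X Y q"
    by (simp add: vf_bracket_def lie_bracket_def d_def Let_def)
  ultimately have "vf_bracket (local_rep A c X) (local_rep A c Y) x = coords A c q (lie_bracket A X Y q)"
    unfolding xd by (simp add: coords_def d_def)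
  then show ?thesis using local_rep_chart[OF c q(1)] q(2) by simp
qed

lemma local_rep_add:
  assumes "c \<in> A" "x \<in> snd c ` fst c"
  shows "local_rep A c (\<lambda>q. a *\<^sub>R X q + b *\<^sub>R Y q) x = a *\<^sub>R local_rep A c X x + b *\<^sub>R local_rep A c Y x"
  unfolding local_rep_def
  using linear_coords[OF assms(1) chart_inv_in[OF assms]] by (simp add: linear_add linear_scale)

lemma lie_algebra_gen_local_rep:
  assumes Fam: "\<And>X. X \<in> Fam \<Longrightarrow> smooth_vector_field_on A UNIV X"
    and Z: "Z \<in> lie_algebra_gen A Fam"
  shows "smooth_vector_field_on A UNIV Z \<and> (\<forall>c\<in>A. \<forall>W \<subseteq> snd c ` fst c.
     local_rep A c Z \<in> lie_closure W (local_rep A c ` Fam))"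
  using Z
proof (induction rule: lie_algebra_gen.induct)
  case (gen X)
  then show ?case using Fam by (auto intro: lie_closure.gen)
next
  case zero
  have z: "local_rep A c (\<lambda>q. 0) x = 0" if "c \<in> A" "x \<in> snd c ` fst c" for c x
    unfolding local_rep_def using linear_0[OF linear_coords[OF that(1) chart_inv_in[OF that]]] .
  have "smooth_on (snd c ` fst c) (local_rep A c (\<lambda>q. 0))" if "c \<in> A" for c
    using smooth_on_cong[OF open_image[OF that], of "local_rep A c (\<lambda>q. 0)" "\<lambda>x. 0"] z[OF that] smooth_on_const
    by blast
  then show ?case using z by (auto simp: smooth_vector_field_on_def intro!: lie_closure.zero)
next
  case (add X Y)
  have l: "local_rep A c (\<lambda>q. X q + Y q) x = 1 *\<^sub>R local_rep A c X x + 1 *\<^sub>R local_rep A c Y x"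
    if "c \<in> A" "x \<in> snd c ` fst c" for c x
    using local_rep_add[OF that, of 1 X 1 Y] by simp
  have "smooth_on (snd c ` fst c) (local_rep A c (\<lambda>q. X q + Y q))" if "c \<in> A" for c
    by (rule smooth_on_linear_combination[OF open_image[OF that] _ _ l[OF that]])
      (use add that in \<open>auto simp: smooth_vector_field_on_def\<close>)
  then show ?case
    using add l by (auto simp: smooth_vector_field_on_def intro!: lie_closure.lin[OF _ _ l])
next
  case (scale X r)
  have l: "local_rep A c (\<lambda>q. r *\<^sub>R X q) x = r *\<^sub>R local_rep A c X x + 0 *\<^sub>R local_rep A c X x"
    if "c \<in> A" "x \<in> snd c ` fst c" for c x
    using local_rep_add[OF that, of r X 0 X] by simp
  have "smooth_on (snd c ` fst c) (local_rep A c (\<lambda>q. r *\<^sub>R X q))" if "c \<in> A" for c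
    by (rule smooth_on_linear_combination[OF open_image[OF that] _ _ l[OF that]])
      (use scale that in \<open>auto simp: smooth_vector_field_on_def\<close>)
  then show ?case
    using scale l by (auto simp: smooth_vector_field_on_def intro!: lie_closure.lin[OF _ _ l])
next
  case (bracket X Y)
  have XY: "smooth_vector_field_on A UNIV X" "smooth_vector_field_on A UNIV Y" using bracket by auto
  note l = local_rep_lie_bracket[OF _ _ XY]
  have "smooth_on (snd c ` fst c) (local_rep A c (lie_bracket A X Y))" if c: "c \<in> A" for c
  proof -
    have "smooth_on (snd c ` fst c) (vf_bracket (local_rep A c X) (local_rep A c Y))"
      by (rule smooth_on_vf_bracket[OF open_image[OF c]])
        (use XY c in \<open>auto simp: smooth_vector_field_on_def\<close>)
    then show ?thesis by (rule iffD2[OF smooth_on_cong[OF open_image[OF c] l[OF c]], rotated])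
  qed
  then show ?case
    using bracket l by (auto simp: smooth_vector_field_on_def intro!: lie_closure.bracket[OF _ _ l])
qed

text \<open>The property that \<open>generates_flow\<close> demands of some \<open>P\<close>.\<close>

definition flow_of :: "('a \<Rightarrow> 'e) \<Rightarrow> (real \<Rightarrow> 'a \<Rightarrow> 'a) \<Rightarrow> bool" where
  "flow_of X P \<longleftrightarrow> P 0 = id \<and> (\<forall>s t. P (s + t) = P s \<circ> P t) \<and>
     continuous_on UNIV (\<lambda>(t, q). P t q) \<and>
     (\<forall>c\<in>A. \<forall>d\<in>A. smooth_on {(t, x). x \<in> snd c ` fst c \<and> P t (chart_inv c x) \<in> fst d}
        (\<lambda>(t, x). snd d (P t (chart_inv c x)))) \<and>
     (\<forall>q t. \<forall>c\<in>A. P t q \<in> fst c \<longrightarrow>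
        ((\<lambda>s. snd c (P s q)) has_vector_derivative coords A c (P t q) (X (P t q))) (at t))"

lemma generates_flow_iff: "generates_flow A X \<longleftrightarrow> (\<exists>P. flow_of X P)"
  unfolding generates_flow_def flow_of_def ..

lemma flow_of_0: "flow_of X P \<Longrightarrow> P 0 q = q"
  by (simp add: flow_of_def)

lemma flow_of_add: "flow_of X P \<Longrightarrow> P s (P t q) = P (s + t) q"
  by (simp add: flow_of_def)

lemma flow_of_uminus: "flow_of X P \<Longrightarrow> P (- t) (P t q) = q" "flow_of X P \<Longrightarrow> P t (P (- t) q) = q"
  by (simp_all add: flow_of_add flow_of_0)

lemma continuous_on_flow_of:
  assumes "flow_of X P" "continuous_on S a" "continuous_on S b"
  shows "continuous_on S (\<lambda>s. P (a s) (b s))"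
proof -
  have "continuous_on S (\<lambda>s. (\<lambda>(t, q). P t q) (a s, b s))"
    by (rule continuous_on_compose2[of UNIV]) (use assms in \<open>auto simp: flow_of_def intro!: continuous_intros\<close>)
  then show ?thesis by simp
qed

lemma local_flow_chart:
  assumes c: "c \<in> A" and W: "open W" "W \<subseteq> snd c ` fst c"
    and X: "smooth_vector_field_on A UNIV X" and P: "flow_of X P"
  shows "local_flow W {(t, x). x \<in> W \<and> P t (chart_inv c x) \<in> fst c \<and> snd c (P t (chart_inv c x)) \<in> W}
    (\<lambda>t x. snd c (P t (chart_inv c x))) (local_rep A c X)" (is "local_flow W ?D ?phi _")
proof
  show "open W" by fact
  have "continuous_on (UNIV \<times> W) (\<lambda>w. P (fst w) (chart_inv c (snd w)))"
    by (intro continuous_on_flow_of[OF P] continuous_intros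
        continuous_on_compose2[OF continuous_on_subset[OF continuous_chart_inv[OF c] W(2)]]) auto
  moreover have "open (UNIV \<times> W)" using W by (intro open_Times) auto
  ultimately have "open ((\<lambda>w. P (fst w) (chart_inv c (snd w))) -` (fst c \<inter> snd c -` W) \<inter> (UNIV \<times> W))"
    using continuous_on_open_vimage open_chart_preimage[OF c W(1)] by blast
  moreover have "?D = (\<lambda>w. P (fst w) (chart_inv c (snd w))) -` (fst c \<inter> snd c -` W) \<inter> (UNIV \<times> W)" by auto
  ultimately show "open ?D" by simp
  have "smooth_on {(t, x). x \<in> snd c ` fst c \<and> P t (chart_inv c x) \<in> fst c} (\<lambda>(t, x). ?phi t x)"
    using P c by (simp add: flow_of_def)
  then show "smooth_on ?D (\<lambda>(t, x). ?phi t x)" by (rule smooth_on_subset) (use W in auto)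
  have "smooth_on (snd c ` fst c) (local_rep A c X)" using X c by (simp add: smooth_vector_field_on_def)
  then show "smooth_on W (local_rep A c X)" by (rule smooth_on_subset) fact
  show "?phi 0 x = x" if "x \<in> W" for x using that W chart_chart_inv[OF c] flow_of_0[OF P] by auto
  show "(0, x) \<in> ?D" if "x \<in> W" for x
    using that W chart_chart_inv[OF c] chart_inv_in[OF c] flow_of_0[OF P] by (auto simp: subset_eq)
  show "x \<in> W \<and> ?phi t x \<in> W" if "(t, x) \<in> ?D" for t x using that by auto
  show "((\<lambda>s. ?phi s x) has_vector_derivative local_rep A c X (?phi t x)) (at t)" if "(t, x) \<in> ?D" for t x
    using that P c local_rep_chart[OF c, of "P t (chart_inv c x)" X] unfolding flow_of_def by auto
  show "(t, ?phi s x) \<in> ?D \<longleftrightarrow> (s + t, x) \<in> ?D" if "(s, x) \<in> ?D" for s t x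
    using that chart_inv_chart[OF c] flow_of_add[OF P] by (auto simp: add.commute)
  show "?phi t (?phi s x) = ?phi (s + t) x" if "(s, x) \<in> ?D" for s t x
    using that chart_inv_chart[OF c] flow_of_add[OF P] by (auto simp: add.commute)
qed

end

section \<open>Trajectories of piecewise constant controls\<close>

locale flow_system = atlas A
  for A :: "('a::topological_space, 'e::euclidean_space) chart set" +
  fixes U :: "'u set" and V :: "'u \<Rightarrow> 'a \<Rightarrow> 'e" and P :: "'u \<Rightarrow> real \<Rightarrow> 'a \<Rightarrow> 'a"
  assumes smooth_V: "u \<in> U \<Longrightarrow> smooth_vector_field_on A UNIV (V u)"
    and flow_P: "u \<in> U \<Longrightarrow> flow_of (V u) (P u)"
begin

text \<open>Only finitely many flows are composed, so reachability in this sense is reachability by a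
  piecewise constant control.\<close>

inductive reach :: "'a \<Rightarrow> 'a \<Rightarrow> bool" where
  idle: "reach x x"
| follow: "reach x y \<Longrightarrow> u \<in> U \<Longrightarrow> 0 \<le> t \<Longrightarrow> reach x (P u t y)"

lemma reach_trans: "reach y z \<Longrightarrow> reach x y \<Longrightarrow> reach x z"
  by (induction rule: reach.induct) (auto intro: reach.follow)

lemma reach_flow: "u \<in> U \<Longrightarrow> 0 \<le> t \<Longrightarrow> reach x (P u t x)"
  using reach.follow[OF reach.idle] .

text \<open>The composed flow is continuous, so the same controls steer nearby points into \<open>B\<close>.\<close>

lemma reach_into_open:
  assumes "reach x y" "open B" "y \<in> B"
  shows "\<exists>N. open N \<and> x \<in> N \<and> (\<forall>x'\<in>N. \<exists>y'\<in>B. reach x' y')"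
  using assms
proof (induction arbitrary: B rule: reach.induct)
  case (idle x)
  then show ?case using reach.idle by blast
next
  case (follow x y u t)
  have "continuous_on UNIV (P u t)"
    using continuous_on_flow_of[OF flow_P[OF follow.hyps(2)] continuous_on_const continuous_on_id] .
  then have "open (P u t -` B)" using follow.prems(1) by (simp add: continuous_on_open_vimage)
  then obtain N where "open N" "x \<in> N" "\<forall>x'\<in>N. \<exists>y'\<in>P u t -` B. reach x' y'"
    using follow.IH[of "P u t -` B"] follow.prems by auto
  then show ?case using reach.follow[OF _ follow.hyps(2,3)] by (metis vimageE)
qed

text \<open>The composed flow has a continuous inverse, so the same controls reach the points near \<open>y\<close> from
  points of \<open>B\<close>.\<close>

lemma reach_from_open:
  assumes "reach x y" "open B" "x \<in> B"
  shows "\<exists>N. open N \<and> y \<in> N \<and> (\<forall>y'\<in>N. \<exists>x'\<in>B. reach x' y')"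
  using assms
proof (induction rule: reach.induct)
  case (idle x)
  then show ?case using reach.idle by blast
next
  case (follow x y u t)
  then obtain N where N: "open N" "y \<in> N" "\<And>y'. y' \<in> N \<Longrightarrow> \<exists>x'\<in>B. reach x' y'" by blast
  have fl: "flow_of (V u) (P u)" using flow_P[OF follow.hyps(2)] .
  have "continuous_on UNIV (P u (- t))"
    using continuous_on_flow_of[OF fl continuous_on_const continuous_on_id] .
  then have "open (P u (- t) -` N)" using N(1) by (simp add: continuous_on_open_vimage)
  moreover have "P u t y \<in> P u (- t) -` N" using N(2) flow_of_uminus(1)[OF fl] by simp
  moreover have "\<exists>x'\<in>B. reach x' y'" if "y' \<in> P u (- t) -` N" for y'
  proof -
    have "P u (- t) y' \<in> N" using that by simp
    then obtain x' where "x' \<in> B" "reach x' (P u (- t) y')" using N(3) by blast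
    then show ?thesis using reach.follow[OF _ follow.hyps(2,3), of x' "P u (- t) y'"] flow_of_uminus(2)[OF fl] by auto
  qed
  ultimately show ?case by blast
qed

lemma continuous_on_local_rep_along:
  assumes c: "c \<in> A" and u: "u \<in> U" and q: "continuous_on S q" "q ` S \<subseteq> fst c"
  shows "continuous_on S (\<lambda>s. coords A c (q s) (V u (q s)))"
proof -
  have "smooth_on (snd c ` fst c) (local_rep A c (V u))"
    using smooth_V[OF u] c by (simp add: smooth_vector_field_on_def)
  then have "continuous_on S (\<lambda>s. local_rep A c (V u) (snd c (q s)))"
    by (rule continuous_on_compose2[OF smooth_on_continuous_on continuous_on_compose2[OF continuous_chart[OF c] q]])
      (use q(2) in auto)
  then show ?thesis
    by (rule continuous_on_eq) (use q(2) local_rep_chart[OF c] in auto)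
qed

text \<open>The point obtained by flowing back from \<open>q r\<close> to time \<open>s\<close> is locally constant in \<open>r\<close>, by
  uniqueness of integral curves in a chart. In the chart the curve is differentiable by the
  fundamental theorem of calculus; the control may differ from \<open>w\<close> at the endpoints \<open>s\<close> and
  \<open>t\<close>, which does not change the integrals.\<close>

lemma solves_constant_control:
  assumes sol: "solves A V u T q" and st: "0 \<le> s" "s \<le> t" "t \<le> T"
    and w: "w \<in> U" "\<And>r. s < r \<Longrightarrow> r < t \<Longrightarrow> u r = w"
  shows "q t = P w (t - s) (q s)"
proof -
  have fl: "flow_of (V w) (P w)" using flow_P[OF w(1)] .
  have cq: "continuous_on {s..t} q"
    using sol st by (auto simp: solves_def intro: continuous_on_subset)
  have "P w (s - s) (q s) = P w (s - t) (q t)"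
  proof (rule connected_local_const[of "{s..t}" s t "\<lambda>r. P w (s - r) (q r)"])
    show "\<forall>r0\<in>{s..t}. eventually (\<lambda>r. P w (s - r0) (q r0) = P w (s - r) (q r)) (at r0 within {s..t})"
    proof
      fix r0 assume r0: "r0 \<in> {s..t}"
      define c where "c = chart_at A (q r0)"
      have c: "c \<in> A" "q r0 \<in> fst c" using chart_at[of "q r0"] by (auto simp: c_def)
      let ?D = "{(t, x). x \<in> snd c ` fst c \<and> P w t (chart_inv c x) \<in> fst c \<and>
        snd c (P w t (chart_inv c x)) \<in> snd c ` fst c}"
      interpret fl: local_flow "snd c ` fst c" ?D
        "\<lambda>t x. snd c (P w t (chart_inv c x))" "local_rep A c (V w)"
        by (rule local_flow_chart[OF c(1) open_image[OF c(1)] subset_refl smooth_V[OF w(1)] fl])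
      have "continuous_on {s..t} (\<lambda>r. P w (r0 - r) (q r))"
        by (intro continuous_on_flow_of[OF fl] continuous_intros cq)
      then have "eventually (\<lambda>r. P w (r0 - r) (q r) \<in> fst c) (at r0 within {s..t})"
        using r0 c(2) flow_of_0[OF fl] open_domain[OF c(1)]
        by (auto simp: continuous_on_def intro!: topological_tendstoD)
      moreover have "eventually (\<lambda>r. q r \<in> fst c) (at r0 within {s..t})"
        using cq r0 c(2) open_domain[OF c(1)] by (auto simp: continuous_on_def intro!: topological_tendstoD)
      ultimately have "eventually (\<lambda>r. P w (r0 - r) (q r) \<in> fst c \<and> q r \<in> fst c) (at r0 within {s..t})"
        by (rule eventually_conj)
      then obtain d where d: "d > 0"
        "\<And>r. r \<in> {s..t} \<Longrightarrow> r \<noteq> r0 \<Longrightarrow> dist r r0 < d \<Longrightarrow> P w (r0 - r) (q r) \<in> fst c \<and> q r \<in> fst c"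
        unfolding eventually_at by blast
      define a b where "a = max s (r0 - d/2)" and "b = min t (r0 + d/2)"
      have ab: "a \<le> r0" "r0 \<le> b" "s \<le> a" "b \<le> t" using r0 d(1) by (auto simp: a_def b_def)
      have inc: "P w (r0 - r) (q r) \<in> fst c \<and> q r \<in> fst c" if "r \<in> {a..b}" for r
      proof (cases "r = r0")
        case True
        then show ?thesis using c(2) flow_of_0[OF fl] by simp
      next
        case False
        have "r \<in> {s..t}" "dist r r0 < d" using that d(1) by (auto simp: a_def b_def dist_real_def)
        then show ?thesis using d(2) False by blast
      qed
      define G where "G r = coords A c (q r) (V w (q r))" for r
      have Gc: "continuous_on {a..b} G" unfolding G_def
        by (rule continuous_on_local_rep_along[OF c(1) w(1) continuous_on_subset[OF cq]]) (use inc ab in auto)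
      have int: "integral {a..r} G = snd c (q r) - snd c (q a)" if r: "r \<in> {a..b}" for r
      proof -
        have "integral {a..r} (\<lambda>s. coords A c (q s) (V (u s) (q s))) = snd c (q r) - snd c (q a)"
          using sol c(1) inc r ab st unfolding solves_def by (auto simp: image_subset_iff)
        moreover have "integral {a..r} (\<lambda>s. coords A c (q s) (V (u s) (q s))) = integral {a..r} G"
        proof (rule integral_spike[of "{s, t}"])
          fix x assume "x \<in> {a..r} - {s, t}"
          then have "u x = w" using r ab by (intro w(2)) auto
          then show "G x = coords A c (q x) (V (u x) (q x))" by (simp add: G_def)
        qed simp
        ultimately show ?thesis by simp
      qed
      have der: "((\<lambda>r. snd c (q r)) has_vector_derivative local_rep A c (V w) (snd c (q r))) (at r within {a..b})"
        if r: "r \<in> {a..b}" for r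
      proof -
        have "((\<lambda>r. snd c (q a) + integral {a..r} G) has_vector_derivative G r) (at r within {a..b})"
          using integral_has_vector_derivative[OF Gc r] by (auto intro!: derivative_eq_intros)
        then have "((\<lambda>r. snd c (q r)) has_vector_derivative G r) (at r within {a..b})"
          by (rule has_vector_derivative_transform[OF r, rotated]) (use int in simp)
        then show ?thesis using local_rep_chart[OF c(1)] inc[OF r] by (simp add: G_def)
      qed
      have eq: "P w (s - r0) (q r0) = P w (s - r) (q r)" if r: "r \<in> {a..b}" for r
      proof -
        have D: "(r0 - r, snd c (q r)) \<in> ?D"
          if "r \<in> {a..b}" for r
          using inc[OF that] chart_inv_chart[OF c(1)] by auto
        have "snd c (P w (r0 - r) (chart_inv c (snd c (q r)))) = snd c (q r0)"
          by (rule fl.integral_curve_unique[OF der D]) (use ab r in auto)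
        then have "snd c (P w (r0 - r) (q r)) = snd c (q r0)"
          using chart_inv_chart[OF c(1)] inc[OF r] by simp
        then have "P w (r0 - r) (q r) = q r0"
          using chart_inv_chart[OF c(1)] inc[OF r] c(2) by metis
        then show ?thesis using flow_of_add[OF fl, of "s - r0" "r0 - r" "q r"] by simp
      qed
      show "eventually (\<lambda>r. P w (s - r0) (q r0) = P w (s - r) (q r)) (at r0 within {s..t})"
        unfolding eventually_at
      proof (intro exI conjI ballI impI)
        show "d/2 > 0" using d by simp
        fix r assume r: "r \<in> {s..t}" "r \<noteq> r0 \<and> dist r r0 < d/2"
        show "P w (s - r0) (q r0) = P w (s - r) (q r)"
        proof (intro eq)
          have "\<bar>r - r0\<bar> < d/2" using r by (simp add: dist_real_def)
          then have "r0 - d/2 \<le> r" "r \<le> r0 + d/2" by linarith+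
          then show "r \<in> {a..b}" using r by (simp add: a_def b_def)
        qed
      qed
    qed
  qed (use st in auto)
  then have "P w (t - s) (P w (s - t) (q t)) = P w (t - s) (q s)" using flow_of_0[OF fl] by simp
  then show ?thesis using flow_of_add[OF fl] flow_of_0[OF fl] by simp
qed

text \<open>Induction on the number of switching times strictly between \<open>s\<close> and \<open>t\<close>.\<close>

lemma solves_reach:
  assumes sol: "solves A V u T q" and pw: "piecewise_constant u" and U: "range u \<subseteq> U"
    and st: "0 \<le> s" "s \<le> t" "t \<le> T"
  shows "reach (q s) (q t)"
proof -
  obtain S where S: "finite S"
    "\<And>a b. 0 \<le> a \<Longrightarrow> a \<le> b \<Longrightarrow> b \<le> T \<Longrightarrow> {a..b} \<inter> S = {} \<Longrightarrow> u a = u b"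
    using spec[OF spec[OF pw[unfolded piecewise_constant_def], of 0], of T] by auto
  have "card (S \<inter> {s<..<t}) = n \<Longrightarrow> 0 \<le> s \<Longrightarrow> s \<le> t \<Longrightarrow> t \<le> T \<Longrightarrow> reach (q s) (q t)" for n
  proof (induction n arbitrary: s t rule: less_induct)
    case (less n)
    show ?case
    proof (cases "S \<inter> {s<..<t} = {}")
      case True
      define w where "w = u ((s + t) / 2)"
      have "u r = w" if r: "s < r" "r < t" for r
      proof -
        let ?m = "(s + t) / 2"
        \<comment> \<open>The control at \<open>r\<close> is compared with its value at the midpoint.\<close>
        have "{min r ?m..max r ?m} \<inter> S = {}" using True r by (auto simp: min_def max_def)
        then have "u (min r ?m) = u (max r ?m)" using r less.prems by (intro S(2)) auto
        then show ?thesis by (auto simp: w_def min_def max_def split: if_splits)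
      qed
      moreover have "w \<in> U" using U by (auto simp: w_def)
      ultimately have "q t = P w (t - s) (q s)"
        using solves_constant_control[OF sol] less.prems by blast
      then show ?thesis using reach_flow[OF \<open>w \<in> U\<close>, of "t - s"] less.prems by simp
    next
      case False
      then obtain r where r: "r \<in> S" "s < r" "r < t" by auto
      have "S \<inter> {s<..<r} \<subset> S \<inter> {s<..<t}" "S \<inter> {r<..<t} \<subset> S \<inter> {s<..<t}" using r by auto
      then have "card (S \<inter> {s<..<r}) < n" "card (S \<inter> {r<..<t}) < n"
        using psubset_card_mono[of "S \<inter> {s<..<t}"] S(1) less.prems(1) by auto
      then have "reach (q s) (q r)" "reach (q r) (q t)"
        using less.IH[OF _ refl] less.prems r by auto
      then show ?thesis using reach_trans by blast
    qed
  qed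
  then show ?thesis using st by blast
qed

lemma solves_append_flow:
  assumes sol: "solves A V u1 T1 q1" and w: "w \<in> U" and tau: "0 \<le> tau"
  defines "u \<equiv> \<lambda>t. if t \<le> T1 then u1 t else w"
    and "q \<equiv> \<lambda>t. if t \<le> T1 then q1 t else P w (t - T1) (q1 T1)"
  shows "solves A V u (T1 + tau) q"
proof -
  have fl: "flow_of (V w) (P w)" using flow_P[OF w] .
  have T1: "0 \<le> T1" and cq1: "continuous_on {0..T1} q1" using sol by (auto simp: solves_def)
  have q2: "q t = P w (t - T1) (q1 T1)" if "T1 \<le> t" for t
    using that flow_of_0[OF fl] by (auto simp: q_def)
  have c1: "continuous_on {0..T1} q"
    by (rule continuous_on_eq[OF cq1]) (simp add: q_def)
  have c2: "continuous_on {T1..} q"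
    by (rule continuous_on_eq[of _ "\<lambda>t. P w (t - T1) (q1 T1)"])
      (use q2 in \<open>auto intro!: continuous_on_flow_of[OF fl] continuous_intros\<close>)
  have "continuous_on ({0..T1} \<union> {T1..T1 + tau}) q"
    by (intro continuous_on_closed_Un c1 continuous_on_subset[OF c2]) auto
  moreover have "{0..T1} \<union> {T1..T1 + tau} = {0..T1 + tau}" using T1 tau by auto
  ultimately have cq: "continuous_on {0..T1 + tau} q" by simp
  have "(\<lambda>s. coords A c (q s) (V (u s) (q s))) absolutely_integrable_on {a..b} \<and>
        integral {a..b} (\<lambda>s. coords A c (q s) (V (u s) (q s))) = snd c (q b) - snd c (q a)"
    (is "?G absolutely_integrable_on _ \<and> _")
    if c: "c \<in> A" and ab: "0 \<le> a" "a \<le> b" "b \<le> T1 + tau" and im: "q ` {a..b} \<subseteq> fst c" for c a b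
  proof -
    let ?Q = "\<lambda>a b. ?G absolutely_integrable_on {a..b} \<and> integral {a..b} ?G = snd c (q b) - snd c (q a)"
    have left: "?Q a' b'" if "a \<le> a'" "a' \<le> b'" "b' \<le> b" "b' \<le> T1" for a' b'
    proof -
      let ?G1 = "\<lambda>s. coords A c (q1 s) (V (u1 s) (q1 s))"
      have "q1 ` {a'..b'} \<subseteq> fst c"
      proof
        fix y assume "y \<in> q1 ` {a'..b'}"
        then obtain s where s: "s \<in> {a'..b'}" "y = q1 s" by blast
        then have "y = q s" "s \<in> {a..b}" using that by (auto simp: q_def)
        then show "y \<in> fst c" using im by blast
      qed
      then have "?G1 absolutely_integrable_on {a'..b'} \<and> integral {a'..b'} ?G1 = snd c (q1 b') - snd c (q1 a')"
        using sol c ab that unfolding solves_def by auto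
      moreover have "?G absolutely_integrable_on {a'..b'} \<longleftrightarrow> ?G1 absolutely_integrable_on {a'..b'}"
        by (rule absolutely_integrable_spike_eq[of "{}"]) (use that in \<open>auto simp: q_def u_def\<close>)
      moreover have "integral {a'..b'} ?G = integral {a'..b'} ?G1"
        by (rule integral_spike[of "{}"]) (use that in \<open>auto simp: q_def u_def\<close>)
      ultimately show ?thesis using that by (simp add: q_def)
    qed
    have right: "?Q a' b'" if "a \<le> a'" "a' \<le> b'" "b' \<le> b" "T1 \<le> a'" for a' b'
    proof -
      let ?G2 = "\<lambda>s. coords A c (q s) (V w (q s))"
      have im': "q ` {a'..b'} \<subseteq> fst c" using im that by (auto simp: image_subset_iff)
      have "continuous_on {a'..b'} ?G2"
        by (rule continuous_on_local_rep_along[OF c w continuous_on_subset[OF c2] im']) (use that in auto)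
      then have i2: "?G2 absolutely_integrable_on {a'..b'}" by (rule absolutely_integrable_continuous_real)
      have "(?G2 has_integral (snd c (q b') - snd c (q a'))) {a'..b'}"
      proof (rule fundamental_theorem_of_calculus[OF that(2)])
        fix s assume s: "s \<in> {a'..b'}"
        then have qs: "q s = P w (s - T1) (q1 T1)" using q2 that by auto
        moreover have "q s \<in> fst c" using im' s by blast
        ultimately have "P w (s - T1) (q1 T1) \<in> fst c" by simp
        then have "((\<lambda>r. snd c (P w r (q1 T1))) has_vector_derivative ?G2 s) (at (s - T1))"
          using fl c qs unfolding flow_of_def by auto
        then have "((\<lambda>r. snd c (P w (r - T1) (q1 T1))) has_vector_derivative 1 *\<^sub>R ?G2 s) (at s)"
          by (intro vector_diff_chain_at[unfolded o_def, of "\<lambda>r. r - T1" 1 s "\<lambda>r. snd c (P w r (q1 T1))"])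
            (auto intro!: derivative_eq_intros)
        then have "((\<lambda>r. snd c (P w (r - T1) (q1 T1))) has_vector_derivative ?G2 s) (at s within {a'..b'})"
          by (simp add: has_vector_derivative_at_within)
        then show "((\<lambda>r. snd c (q r)) has_vector_derivative ?G2 s) (at s within {a'..b'})"
          by (rule has_vector_derivative_transform[OF s, rotated]) (use q2 that in auto)
      qed
      then have "integral {a'..b'} ?G2 = snd c (q b') - snd c (q a')" by (rule integral_unique)
      moreover have "?G absolutely_integrable_on {a'..b'} \<longleftrightarrow> ?G2 absolutely_integrable_on {a'..b'}"
        by (rule absolutely_integrable_spike_eq[of "{T1}"]) (use that in \<open>auto simp: u_def\<close>)
      moreover have "integral {a'..b'} ?G = integral {a'..b'} ?G2"
        by (rule integral_spike[of "{T1}"]) (use that in \<open>auto simp: u_def\<close>)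
      ultimately show ?thesis using i2 by simp
    qed
    consider "b \<le> T1" | "T1 \<le> a" | "a \<le> T1" "T1 \<le> b" by linarith
    then show ?thesis
    proof cases
      case 1
      then show ?thesis using left[of a b] ab by simp
    next
      case 2
      then show ?thesis using right[of a b] ab by simp
    next
      case 3
      have l: "?Q a T1" and r: "?Q T1 b" using left[of a T1] right[of T1 b] 3 by auto
      have i: "?G absolutely_integrable_on {a..b}"
        by (rule absolutely_integrable_on_combine[OF conjunct1[OF l] conjunct1[OF r] 3])
      moreover have "integral {a..T1} ?G + integral {T1..b} ?G = integral {a..b} ?G"
        by (rule Henstock_Kurzweil_Integration.integral_combine[OF 3])
          (use i in \<open>simp add: absolutely_integrable_on_def\<close>)
      ultimately show ?thesis using l r by simp
    qed
  qed
  then show ?thesis unfolding solves_def using T1 tau cq by auto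
qed

lemma piecewise_constant_append:
  assumes "piecewise_constant u1"
  shows "piecewise_constant (\<lambda>t. if t \<le> T1 then u1 t else w)"
  unfolding piecewise_constant_def
proof (intro allI)
  fix a b
  obtain S where S: "finite S" "\<forall>s t. a \<le> s \<and> s \<le> t \<and> t \<le> b \<and> {s..t} \<inter> S = {} \<longrightarrow> u1 s = u1 t"
    using spec[OF spec[OF assms[unfolded piecewise_constant_def], of a], of b] by auto
  show "\<exists>S. finite S \<and> (\<forall>s t. a \<le> s \<and> s \<le> t \<and> t \<le> b \<and> {s..t} \<inter> S = {} \<longrightarrow>
     (if s \<le> T1 then u1 s else w) = (if t \<le> T1 then u1 t else w))"
    using S by (intro exI[of _ "insert T1 S"]) auto
qed

lemma reach_imp_trajectory:
  assumes "reach x y" and U: "U \<noteq> {}"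
  shows "\<exists>u T q. piecewise_constant u \<and> range u \<subseteq> U \<and> solves A V u T q \<and> q 0 = x \<and> q T = y"
  using assms(1)
proof (induction rule: reach.induct)
  case (idle x)
  obtain w where w: "w \<in> U" using U by blast
  have "solves A V (\<lambda>t. w) 0 (\<lambda>t. x)"
    by (auto simp: solves_def intro!: absolutely_integrable_continuous_real continuous_intros)
  moreover have "piecewise_constant (\<lambda>t. w)" by (auto simp: piecewise_constant_def intro!: exI[of _ "{}"])
  ultimately show ?case using w
    by (intro exI[of _ "\<lambda>t. w"] exI[of _ "0 :: real"] exI[of _ "\<lambda>t. x"]) auto
next
  case (follow x y w tau)
  then obtain u1 T1 q1 where 1: "piecewise_constant u1" "range u1 \<subseteq> U" "solves A V u1 T1 q1" "q1 0 = x" "q1 T1 = y"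
    by blast
  have T1: "0 \<le> T1" using 1(3) by (simp add: solves_def)
  let ?u = "\<lambda>t. if t \<le> T1 then u1 t else w" and ?q = "\<lambda>t. if t \<le> T1 then q1 t else P w (t - T1) (q1 T1)"
  have "solves A V ?u (T1 + tau) ?q" by (rule solves_append_flow[OF 1(3) follow.hyps(2,3)])
  moreover have "piecewise_constant ?u" by (rule piecewise_constant_append[OF 1(1)])
  moreover have "range ?u \<subseteq> U" using 1(2) follow.hyps(2) by auto
  moreover have "?q 0 = x" using T1 1(4) by simp
  moreover have "?q (T1 + tau) = P w tau y"
    using 1(5) follow.hyps(3) flow_of_0[OF flow_P[OF follow.hyps(2)]] by auto
  ultimately show ?case by blast
qed

end

section \<open>Controllability\<close>

context flow_system
begin

lemma dim_local_control_vectors: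
  assumes c: "c \<in> A" "y \<in> fst c"
  shows "dim ((\<lambda>u. local_rep A c (V u) (snd c y)) ` U) = dim (control_span U V y)"
proof -
  have "(\<lambda>u. local_rep A c (V u) (snd c y)) ` U = coords A c y ` control_vectors U V y"
    using local_rep_chart[OF c] by (auto simp: control_vectors_def image_image)
  also have "dim \<dots> = dim (control_vectors U V y)"
    by (rule dim_image_eq[OF linear_coords[OF c] inj_on_subset[OF inj_coords[OF c] subset_UNIV]])
  finally show ?thesis by (simp add: control_span_def dim_span)
qed

text \<open>The local statement in the preferred chart \<open>c\<close> at \<open>q\<close>, in which the control vectors at \<open>q\<close>
  and the values of the Lie algebra at \<open>q\<close> are their own coordinates.\<close>

lemma ample_LARC_imp_mutually_reachable:
  assumes ample: "ample_at A U V q" and larc: "LARC A U V q"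
  shows "\<exists>B. open B \<and> q \<in> B \<and> (\<forall>x\<in>B. \<forall>y\<in>B. reach x y)"
proof -
  define c where "c = chart_at A q"
  have c: "c \<in> A" "q \<in> fst c" using chart_at[of q] by (auto simp: c_def)
  define X where "X u = local_rep A c (V u)" for u
  define x0 where "x0 = snd c q"
  have Xq: "X u x0 = V u q" for u
    unfolding X_def x0_def local_rep_chart[OF c] by (simp add: c_def coords_chart_at)
  obtain B where B: "open B" "q \<in> B" "smooth_subbundle_on A B (control_span U V)"
    and hull: "convex hull (control_vectors U V q) = control_span U V q"
    using ample unfolding ample_at_def control_vectors_open_at_def by blast
  from bspec[OF B(3)[unfolded smooth_subbundle_on_def] B(2)]
  obtain W' E and k :: nat where W': "open W'" "q \<in> W'"
    and "\<forall>y\<in>W'. inj_on (\<lambda>i. E i y) {..<k} \<and> independent ((\<lambda>i. E i y) ` {..<k}) \<and>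
           span ((\<lambda>i. E i y) ` {..<k}) = control_span U V y"
    by (elim exE conjE) (rule that)
  note E = bspec[OF this(3)]
  define S where "S = snd c ` (fst c \<inter> W')"
  have S: "open S" "x0 \<in> S" "S \<subseteq> snd c ` fst c"
    using open_chart_image[OF c(1) W'(1)] c W' by (auto simp: S_def x0_def)
  have smooth_X: "smooth_on (snd c ` fst c) (X u)" if "u \<in> U" for u
    using smooth_V[OF that] c(1) by (simp add: X_def smooth_vector_field_on_def)
  have dimS: "dim ((\<lambda>u. X u x) ` U) = k" if x: "x \<in> S" for x
  proof -
    obtain y where y: "y \<in> fst c" "y \<in> W'" "x = snd c y" using x by (auto simp: S_def)
    have "dim (control_span U V y) = dim (span ((\<lambda>i. E i y) ` {..<k}))" using E[OF y(2)] by simp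
    also have "\<dots> = card ((\<lambda>i. E i y) ` {..<k})"
      by (rule dim_span_eq_card_independent) (use E[OF y(2)] in blast)
    also have "\<dots> = k" using E[OF y(2)] by (simp add: card_image)
    finally show ?thesis using dim_local_control_vectors[OF c(1) y(1)] y(3) by (simp add: X_def)
  qed
  have hull': "convex hull ((\<lambda>u. X u x0) ` U) = span ((\<lambda>u. X u x0) ` U)"
    using hull by (simp add: Xq control_vectors_def control_span_def)
  obtain F where F: "finite F" "F \<subseteq> U" "(\<lambda>Z. Z q) ` lie_algebra_gen A (V ` F) = UNIV"
    using larc unfolding LARC_def by blast
  have Xc: "\<And>u. u \<in> U \<Longrightarrow> continuous_on S (X u)"
    using smooth_on_continuous_on[OF smooth_X] S(3) continuous_on_subset by blast
  obtain W I k where W: "open W" "x0 \<in> W" "W \<subseteq> S" and I: "finite I" "F \<subseteq> I" "I \<subseteq> U"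
    and k: "\<And>u i. u \<in> F \<Longrightarrow> i \<in> I \<Longrightarrow> continuous_on W (k u i)"
      "\<And>u i x. u \<in> F \<Longrightarrow> i \<in> I \<Longrightarrow> x \<in> W \<Longrightarrow> (0::real) \<le> k u i x"
      "\<And>u x. u \<in> F \<Longrightarrow> x \<in> W \<Longrightarrow> (\<Sum>i\<in>I. k u i x *\<^sub>R X i x) = - X u x"
    by (rule reversing_coefficients[OF S(1,2) Xc F(1,2) dimS hull'])
      (assumption | (rule that; (assumption | blast)))+
  have WO: "W \<subseteq> snd c ` fst c" using W(3) S(3) by blast
  define D where "D u = {(t, x). x \<in> W \<and> P u t (chart_inv c x) \<in> fst c \<and> snd c (P u t (chart_inv c x)) \<in> W}" for u
  interpret cf: control_family W I F X "\<lambda>u t x. snd c (P u t (chart_inv c x))" D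
    "\<lambda>x y. reach (chart_inv c x) (chart_inv c y)" k
  proof (rule control_family.intro)
    show "local_flow W (D i) (\<lambda>t x. snd c (P i t (chart_inv c x))) (X i)" if "i \<in> I" for i
      unfolding D_def X_def using that I(3)
      by (intro local_flow_chart[OF c(1) W(1) WO] smooth_V flow_P) auto
    show "reach (chart_inv c x) (chart_inv c (snd c (P i t (chart_inv c x))))"
      if "i \<in> I" "(t, x) \<in> D i" "0 \<le> t" for i t x
      using that I(3) chart_inv_chart[OF c(1)] by (auto simp: D_def intro!: reach_flow)
    show "reach (chart_inv c x) (chart_inv c z)"
      if "reach (chart_inv c x) (chart_inv c y)" "reach (chart_inv c y) (chart_inv c z)" for x y z
      using reach_trans that by blast
  qed (use W I k reach.idle in auto)
  have "\<exists>Z\<in>lie_closure W (X ` F). Z x0 = v" for v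
  proof -
    obtain Z where Z: "Z \<in> lie_algebra_gen A (V ` F)" "Z q = v" using F(3) by (metis (no_types) UNIV_I imageE)
    have "local_rep A c Z \<in> lie_closure W (local_rep A c ` V ` F)"
      using lie_algebra_gen_local_rep[OF _ Z(1)] smooth_V F(2) c(1) WO by blast
    moreover have "local_rep A c ` V ` F = X ` F" by (auto simp: X_def image_image)
    moreover have "local_rep A c Z x0 = v"
      unfolding x0_def local_rep_chart[OF c] using Z(2) by (simp add: c_def coords_chart_at)
    ultimately show ?thesis by auto
  qed
  from cf.locally_controllable[OF W(2) this] obtain B' where B': "open B'" "x0 \<in> B'"
    "\<And>x p. x \<in> B' \<Longrightarrow> p \<in> B' \<Longrightarrow> reach (chart_inv c x) (chart_inv c p)" by blast
  have "reach x y" if "x \<in> fst c \<inter> snd c -` B'" "y \<in> fst c \<inter> snd c -` B'" for x y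
    using B'(3)[of "snd c x" "snd c y"] that chart_inv_chart[OF c(1)] by auto
  moreover have "open (fst c \<inter> snd c -` B')" by (rule open_chart_preimage[OF c(1) B'(1)])
  moreover have "q \<in> fst c \<inter> snd c -` B'" using c(2) B'(2) by (simp add: x0_def)
  ultimately show ?thesis by blast
qed

text \<open>The set \<open>B\<close> serves as a hub: points near \<open>p\<close> get into it as \<open>p\<close> does, and out of it they
  are reached as \<open>p\<close> is.\<close>

lemma mutually_reachable_nhd:
  assumes B: "open B" "\<And>x y. x \<in> B \<Longrightarrow> y \<in> B \<Longrightarrow> reach x y"
    and pz: "reach p z" "z \<in> B" and zp: "reach z' p" "z' \<in> B"
  shows "\<exists>N. open N \<and> p \<in> N \<and> (\<forall>x\<in>N. \<forall>y\<in>N. reach x y)"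
proof -
  obtain N1 where N1: "open N1" "p \<in> N1" "\<And>x. x \<in> N1 \<Longrightarrow> \<exists>y\<in>B. reach x y"
    using reach_into_open[OF pz(1) B(1) pz(2)] by blast
  obtain N2 where N2: "open N2" "p \<in> N2" "\<And>x. x \<in> N2 \<Longrightarrow> \<exists>y\<in>B. reach y x"
    using reach_from_open[OF zp(1) B(1) zp(2)] by blast
  have "reach x y" if "x \<in> N1 \<inter> N2" "y \<in> N1 \<inter> N2" for x y
  proof -
    have "x \<in> N1" "y \<in> N2" using that by auto
    then obtain x' y' where xy: "x' \<in> B" "reach x x'" "y' \<in> B" "reach y' y" using N1(3) N2(3) by blast
    show ?thesis using reach_trans[OF xy(4) reach_trans[OF B(2)[OF xy(1,3)] xy(2)]] .
  qed
  then show ?thesis using N1 N2 by (intro exI[of _ "N1 \<inter> N2"]) auto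
qed

text \<open>The set of points reachable from \<open>p\<close> and its complement are both open.\<close>

lemma locally_mutually_reachable_imp_reach:
  assumes conn: "connected (UNIV :: 'a set)"
    and loc: "\<And>p. \<exists>N. open N \<and> p \<in> N \<and> (\<forall>x\<in>N. \<forall>y\<in>N. reach x y)"
  shows "reach p p'"
proof -
  have "\<forall>a\<in>UNIV. \<forall>\<^sub>F b in at a within UNIV. reach p a = reach p b"
  proof
    fix a :: 'a
    obtain N where N: "open N" "a \<in> N" "\<And>x y. x \<in> N \<Longrightarrow> y \<in> N \<Longrightarrow> reach x y"
      using loc[of a] by auto
    have "reach p a = reach p b" if "b \<in> N" for b
      using reach_trans[OF N(3)[OF N(2) that], of p] reach_trans[OF N(3)[OF that N(2)], of p] by blast
    then show "\<forall>\<^sub>F b in at a within UNIV. reach p a = reach p b"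
      using N(1,2) unfolding eventually_at_topological by blast
  qed
  from connected_local_const[OF conn _ _ this, of p p'] show ?thesis using reach.idle by simp
qed

end

theorem theoremA:
  fixes A :: "('a::{t2_space, second_countable_topology}, 'e::euclidean_space) chart set"
    and U :: "'u set" and V :: "'u \<Rightarrow> 'a \<Rightarrow> 'e" and Adm :: "(real \<Rightarrow> 'u) set"
  assumes "smooth_atlas A"
    and "compact (UNIV :: 'a set)" and "connected (UNIV :: 'a set)"
    and "control_system A U V Adm"
    and "\<forall>p. \<exists>T q. T > 0 \<and> closed_orbit A V Adm T q \<and> q 0 = p \<and>
           (\<exists>\<tau>\<in>{0..T}. ample_at A U V (q \<tau>) \<and> LARC A U V (q \<tau>))"
  shows "controllable A V Adm"
proof -
  interpret atlas A using assms(1) by unfold_locales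
  have "\<forall>u\<in>U. \<exists>P. flow_of (V u) P"
    using assms(4) by (simp add: control_system_def generates_flow_iff)
  then obtain P where P: "\<And>u. u \<in> U \<Longrightarrow> flow_of (V u) (P u)" by metis
  interpret flow_system A U V P
    using assms(4) P by unfold_locales (auto simp: control_system_def)
  have adm: "piecewise_constant u \<Longrightarrow> range u \<subseteq> U \<Longrightarrow> u \<in> Adm" for u
    using assms(4) by (auto simp: control_system_def)
  have approx: "\<exists>u' q'. piecewise_constant u' \<and> range u' \<subseteq> U \<and> solves A V u' T q' \<and>
      q' t0 = q t0 \<and> q' \<tau> \<in> B"
    if tr: "trajectory A V Adm T q" and t0: "t0 \<in> {0..T}" and tau: "\<tau> \<in> {0..T}"
      and B: "open B" "q \<tau> \<in> B" for T q t0 \<tau> B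
  proof -
    \<comment> \<open>A neighbourhood of the graph of \<open>q\<close> that restricts approximating curves only at the time \<open>\<tau>\<close>.\<close>
    define W where "W = ((- {\<tau>}) \<times> UNIV) \<union> (UNIV \<times> B)"
    have W: "open W" unfolding W_def using B(1) by (intro open_Un open_Times) auto
    have qW: "\<forall>t\<in>{0..T}. (t, q t) \<in> W" using B(2) by (auto simp: W_def)
    have "\<forall>W. open W \<and> (\<forall>t\<in>{0..T}. (t, q t) \<in> W) \<longrightarrow>
           (\<exists>u' q'. piecewise_constant u' \<and> range u' \<subseteq> U \<and> solves A V u' T q' \<and>
              q' t0 = q t0 \<and> (\<forall>t\<in>{0..T}. (t, q' t) \<in> W))"
      using assms(4) tr t0 unfolding control_system_def approximable_by_piecewise_constant_def by simp
    then obtain u' q' where "piecewise_constant u'" "range u' \<subseteq> U" "solves A V u' T q'"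
      "q' t0 = q t0" "\<forall>t\<in>{0..T}. (t, q' t) \<in> W" using W qW by blast
    then show ?thesis using tau by (intro exI[of _ u'] exI[of _ q']) (auto simp: W_def)
  qed
  have loc: "\<exists>N. open N \<and> p \<in> N \<and> (\<forall>x\<in>N. \<forall>y\<in>N. reach x y)" for p
  proof -
    obtain T q \<tau> where T: "T > 0" and q: "trajectory A V Adm T q" "q 0 = q T" "q 0 = p"
      and tau: "\<tau> \<in> {0..T}" "ample_at A U V (q \<tau>)" "LARC A U V (q \<tau>)"
      using assms(5) unfolding closed_orbit_def by blast
    obtain B where B: "open B" "q \<tau> \<in> B" "\<And>x y. x \<in> B \<Longrightarrow> y \<in> B \<Longrightarrow> reach x y"
      using ample_LARC_imp_mutually_reachable[OF tau(2,3)] by blast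
    obtain u1 q1 where 1: "piecewise_constant u1" "range u1 \<subseteq> U" "solves A V u1 T q1" "q1 0 = p" "q1 \<tau> \<in> B"
      using approx[OF q(1) _ tau(1) B(1,2), of 0] T q(3) by auto
    obtain u2 q2 where 2: "piecewise_constant u2" "range u2 \<subseteq> U" "solves A V u2 T q2" "q2 T = p" "q2 \<tau> \<in> B"
      using approx[OF q(1) _ tau(1) B(1,2), of T] T q(2,3) by auto
    have "reach p (q1 \<tau>)" using solves_reach[OF 1(3,1,2), of 0 \<tau>] tau(1) 1(4) by simp
    moreover have "reach (q2 \<tau>) p" using solves_reach[OF 2(3,1,2), of \<tau> T] tau(1) 2(4) by simp
    ultimately show ?thesis using mutually_reachable_nhd[OF B(1,3)] 1(5) 2(5) by blast
  qed
  obtain T q u where "u \<in> Adm" "solves A V u T q"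
    using assms(5) unfolding closed_orbit_def trajectory_def by blast
  then have U: "U \<noteq> {}" using assms(4) by (auto simp: control_system_def)
  show ?thesis
    unfolding controllable_def trajectory_def
  proof (intro allI)
    fix p p'
    obtain u T q where "piecewise_constant u" "range u \<subseteq> U" "solves A V u T q" "q 0 = p" "q T = p'"
      using reach_imp_trajectory[OF locally_mutually_reachable_imp_reach[OF assms(3) loc] U] by blast
    then show "\<exists>T q. (\<exists>u\<in>Adm. solves A V u T q) \<and> q 0 = p \<and> q T = p'" using adm by blast
  qed
qed

end
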